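(* Let $\mathbb{F}$ be an algebraically closed field of characteristic $0$, let $m\ge 0$ and $n\ge 1$ be integers, and let $\mathfrak{h}_{2m,n}$ be the Lie superalgebra over $\mathbb{F}$ with basis $\{z;x_1,\ldots,x_{2m}\mid y_1,\ldots,y_n\}$ ($z,x_i$ even, $y_j$ odd) whose non-zero brackets of basis elements are $[x_i,x_{m+i}]=z$ ($1\le i\le m$) (and $[x_{m+i},x_i]=-z$) and $[y_j,y_j]=z$ ($1\le j\le n$). Let $\mathfrak{G}_{2m,n}$ be the associative superalgebra generated by even elements $\xi_1,\ldots,\xi_{2m}$ and odd elements $\eta_1,\ldots,\eta_n$ subject to the relations $$\xi_i\xi_j+\xi_j\xi_i=0,\quad \xi_i\eta_k+\eta_k\xi_i=0,\quad \eta_k\eta_s-\eta_s\eta_k=0\qquad(1\le i,j\le 2m,\ 1\le k,s\le n),$$ $$\sum_{i=1}^m\xi_i\xi_{m+i}-\tfrac12\sum_{i=1}^n\eta_i\eta_i=0,$$ with the $\mathbb{Z}$-grading $\|\xi_i\|=\|\eta_k\|=1$. Then, as a $\mathbb{Z}$-graded superalgebra, $H^{\bullet}(\mathfrak{h}_{2m,n})$ is isomorphic to $\mathfrak{G}_{2m,n}$. In particular, for every integer $k\ge 0$, $$\dim H^k(\mathfrak{h}_{2m,n})=\mathfrak{d}^k(2m,n)-\mathfrak{d}^{k-2}(2m,n).$$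
   Context: For a homogeneous element, $|x|\in\mathbb{Z}_2$ denotes its parity and $\|x\|\in\mathbb{Z}$ its $\mathbb{Z}$-degree. For a superspace $V$, the super-exterior algebra is $\bigwedge V=T(V)/J(V)$, where $T(V)$ is the tensor algebra (with $\mathbb{Z}_2$-grading induced from $V$ and $\mathbb{Z}$-grading $\|v\|=1$ for $v\in V$) and $J(V)$ is the two-sided ideal generated by $u\otimes v+(-1)^{|u||v|}v\otimes u$ for homogeneous $u,v\in V$. It is graded-supercommutative: $ab=(-1)^{\|a\|\|b\|}(-1)^{|a||b|}ba$. For integers $r,s$ with $r\ge 0$, $s\ge 1$, $\mathfrak{d}^k(r,s)$ is the dimension of the degree-$k$ component of the super-exterior algebra on $r$ even and $s$ odd generators: $\mathfrak{d}^k(r,s)=\sum_{i=0}^k\binom{r}{k-i}\binom{s+i-1}{i}$ for $k\ge 0$, and $\mathfrak{d}^k(r,s)=0$ for $k<0$. Cohomology with trivial coefficients: for a finite-dimensional Lie superalgebra $\mathfrak{g}$ over $\mathbb{F}$ of characteristic $0$, $H^\bullet(\mathfrak{g})$ is the cohomology of the cochain complex $(\bigwedge^\bullet\mathfrak{g}^*,\mathrm{d})$, where $\mathrm{d}:\bigwedge^1\mathfrak{g}^*\to\bigwedge^2\mathfrak{g}^*$ is induced by the dual of the bracket and $\mathrm{d}$ is extended by $\mathrm{d}(ab)=\mathrm{d}(a)b+(-1)^{\|a\|}a\,\mathrm{d}(b)$. For $\mathfrak{h}_{2m,n}$, with dual basis marked by $*$, $\mathrm{d}x_i^*=0$, $\mathrm{d}y_j^*=0$,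 and $\mathrm{d}z^*=\sum_{i=1}^m x_i^*\wedge x_{m+i}^*-\frac12\sum_{i=1}^n y_i^*\wedge y_i^*$. The product on $H^\bullet(\mathfrak{g})$ is induced by the product of $\bigwedge^\bullet\mathfrak{g}^*$, with the $\mathbb{Z}$-grading by cohomological degree and the induced $\mathbb{Z}_2$-grading. *)

theory Defs
  imports
    "HOL-Library.Poly_Mapping"
    "HOL-Library.Z2"
    "HOL-Algebra.QuotRing"
    "HOL-Computational_Algebra.Polynomial"
    "Jordan_Normal_Form.VS_Connect"
begin

hide_const (open) Polynomial.smult Polynomial.degree Polynomial.order Modules.module

section \<open>Free associative algebras\<close>

text \<open>
  Lists are made the free monoid under concatenation.  The library's convolution product then turns
  \<open>'b list \<Rightarrow>\<^sub>0 'a\<close> into the algebra of noncommutative polynomials over \<open>'a\<close> in the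
  letters of type \<open>'b\<close>.
\<close>

instantiation list :: (type) monoid_add
begin

definition zero_list :: "'a list" where "zero_list = []"

definition plus_list :: "'a list \<Rightarrow> 'a list \<Rightarrow> 'a list" where "plus_list = (@)"

instance
  by standard (simp_all add: zero_list_def plus_list_def)

end

definition scale :: "'a::field \<Rightarrow> ('b \<Rightarrow>\<^sub>0 'a) \<Rightarrow> ('b \<Rightarrow>\<^sub>0 'a)" where
  "scale c p = Poly_Mapping.map ((*) c) p"

definition gen :: "'b \<Rightarrow> ('b list \<Rightarrow>\<^sub>0 'a::field)" where
  "gen b = Poly_Mapping.single [b] 1"

definition koszul :: "bit \<Rightarrow> bit \<Rightarrow> 'a::field" where
  "koszul p q = (if p = 1 \<and> q = 1 then - 1 else 1)"


section \<open>Graded superalgebras\<close>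

text \<open>
  \<open>hcomp A k p\<close> is the subspace of the elements of \<open>\<int>\<close>-degree \<open>k\<close> and parity \<open>p\<close>
  (together with 0).
\<close>

record ('a, 'b) gsalg = "('a, 'b) Module.module" +
  hcomp :: "int \<Rightarrow> bit \<Rightarrow> 'b set"

text \<open>
  The free superalgebra on the letters in \<open>B\<close>, all of degree 1; this is also the tensor algebra of
  the superspace with homogeneous basis \<open>B\<close>.
\<close>

definition free_alg :: "'b set \<Rightarrow> ('b \<Rightarrow> bit) \<Rightarrow> ('a::field, 'b list \<Rightarrow>\<^sub>0 'a) gsalg" where
  "free_alg B par =
    \<lparr>carrier = {p. \<forall>w\<in>Poly_Mapping.keys p. set w \<subseteq> B},
     mult = (*), one = 1, zero = 0, add = (+),
     smult = scale,
     hcomp = (\<lambda>k q. {p. \<forall>w\<in>Poly_Mapping.keys p. set w \<subseteq> B \<and> int (length w) = k \<and>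
                                sum_list (map par w) = q})\<rparr>"

text \<open>The quotient by a two-sided ideal; scalars act on cosets as \<^const>\<open>rcoset_mult\<close> multiplies them.\<close>

definition quot_alg :: "('a, 'b) gsalg \<Rightarrow> 'b set \<Rightarrow> ('a, 'b set) gsalg" where
  "quot_alg A I =
    \<lparr>carrier = carrier (A Quot I),
     mult = mult (A Quot I), one = one (A Quot I), zero = zero (A Quot I), add = add (A Quot I),
     smult = (\<lambda>c X. \<Union>x\<in>X. I +>\<^bsub>A\<^esub> (c \<odot>\<^bsub>A\<^esub> x)),
     hcomp = (\<lambda>k q. (\<lambda>x. I +>\<^bsub>A\<^esub> x) ` hcomp A k q)\<rparr>"

definition presented_alg ::
  "'b set \<Rightarrow> ('b \<Rightarrow> bit) \<Rightarrow> ('b list \<Rightarrow>\<^sub>0 'a::field) set \<Rightarrow> ('a, ('b list \<Rightarrow>\<^sub>0 'a) set) gsalg" where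
  "presented_alg B par R = quot_alg (free_alg B par) (Idl\<^bsub>free_alg B par\<^esub> R)"

definition gsalg_iso :: "('a, 'b) gsalg \<Rightarrow> ('a, 'c) gsalg \<Rightarrow> bool" where
  "gsalg_iso A B \<longleftrightarrow>
    (\<exists>f\<in>ring_iso A B.
       (\<forall>c. \<forall>x\<in>carrier A. f (c \<odot>\<^bsub>A\<^esub> x) = c \<odot>\<^bsub>B\<^esub> f x) \<and>
       (\<forall>k q. f ` hcomp A k q = hcomp B k q))"

text \<open>The vector space of all elements of \<open>\<int>\<close>-degree \<open>k\<close>.\<close>

definition degree_part :: "('a, 'b) gsalg \<Rightarrow> int \<Rightarrow> ('a, 'b) gsalg" where
  "degree_part A k = A\<lparr>carrier := hcomp A k 0 <+>\<^bsub>A\<^esub> hcomp A k 1\<rparr>"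


section \<open>The super-exterior algebra\<close>

definition ext_rels :: "'b set \<Rightarrow> ('b \<Rightarrow> bit) \<Rightarrow> ('b list \<Rightarrow>\<^sub>0 'a::field) set" where
  "ext_rels B par =
    {u * v + scale (koszul p q) (v * u) | u v p q.
       u \<in> hcomp (free_alg B par) 1 p \<and> v \<in> hcomp (free_alg B par) 1 q}"

definition ext_alg :: "'b set \<Rightarrow> ('b \<Rightarrow> bit) \<Rightarrow> ('a::field, ('b list \<Rightarrow>\<^sub>0 'a) set) gsalg" where
  "ext_alg B par = presented_alg B par (ext_rels B par)"

definition frakd :: "int \<Rightarrow> nat \<Rightarrow> nat \<Rightarrow> int" where
  "frakd k r s =
    (if k < 0 then 0
     else (\<Sum>i = 0..nat k. int (r choose (nat k - i)) * int ((s + i - 1) choose i)))"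


section \<open>Lie superalgebras and their cohomology\<close>

text \<open>
  A finite-dimensional Lie superalgebra is given by a homogeneous basis and the brackets of the
  basis elements; its elements are the linear combinations \<open>'b \<Rightarrow>\<^sub>0 'a\<close> of the basis.
\<close>

record (overloaded) ('a, 'b) sla =
  basis :: "'b set"
  parity :: "'b \<Rightarrow> bit"
  brk :: "'b \<Rightarrow> 'b \<Rightarrow> ('b \<Rightarrow>\<^sub>0 'a)"

definition lie_bracket ::
  "('a::field, 'b) sla \<Rightarrow> ('b \<Rightarrow>\<^sub>0 'a) \<Rightarrow> ('b \<Rightarrow>\<^sub>0 'a) \<Rightarrow> ('b \<Rightarrow>\<^sub>0 'a)" where
  "lie_bracket L u v =
    (\<Sum>a\<in>Poly_Mapping.keys u. \<Sum>b\<in>Poly_Mapping.keys v. scale (Poly_Mapping.lookup u a * Poly_Mapping.lookup v b) (brk L a b))"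

text \<open>By multilinearity the axioms need to be stated on the basis only.\<close>

definition lie_superalgebra :: "('a::field, 'b) sla \<Rightarrow> bool" where
  "lie_superalgebra L \<longleftrightarrow>
    finite (basis L) \<and>
    (\<forall>a\<in>basis L. \<forall>b\<in>basis L.
       Poly_Mapping.keys (brk L a b) \<subseteq> {c\<in>basis L. parity L c = parity L a + parity L b} \<and>
       brk L a b = - scale (koszul (parity L a) (parity L b)) (brk L b a)) \<and>
    (\<forall>a\<in>basis L. \<forall>b\<in>basis L. \<forall>c\<in>basis L.
       lie_bracket L (Poly_Mapping.single a 1) (brk L b c) =
         lie_bracket L (brk L a b) (Poly_Mapping.single c 1) +
         scale (koszul (parity L a) (parity L b))
           (lie_bracket L (Poly_Mapping.single b 1) (brk L a c)))"

text \<open>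
  Below, the letter \<open>c\<close> stands for the element \<open>c*\<close> of the dual basis, which has the parity
  of \<open>c\<close>.  Let \<open>[a, b] = (\<Sum>c. \<gamma> a b c \<cdot> c)\<close>.  Under the pairing
  \<open>\<langle>f \<otimes> g, u \<otimes> v\<rangle> = (-1)^(|g||u|) f(u) g(v)\<close> the transpose of the bracket sends \<open>c*\<close> to
  \<open>\<Sum>a b. (-1)^(|a||b|) \<gamma> a b c \<cdot> a* \<otimes> b*\<close>.  The factor 1/2 identifies the
  super-alternating tensors of degree 2 with the second exterior power, an unordered pair of
  distinct basis elements occurring twice in the sum.
\<close>

definition diff1 :: "('a::field, 'b) sla \<Rightarrow> 'b \<Rightarrow> ('b list \<Rightarrow>\<^sub>0 'a)" where
  "diff1 L c =
    (\<Sum>a\<in>basis L. \<Sum>b\<in>basis L.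
       scale (1 / 2 * koszul (parity L a) (parity L b) * Poly_Mapping.lookup (brk L a b) c) (gen a * gen b))"

text \<open>The extension to a derivation of the tensor algebra: on words, then linearly.\<close>

primrec diff_word :: "('a::field, 'b) sla \<Rightarrow> 'b list \<Rightarrow> ('b list \<Rightarrow>\<^sub>0 'a)" where
  "diff_word L [] = 0"
| "diff_word L (c # w) = diff1 L c * Poly_Mapping.single w 1 - gen c * diff_word L w"

definition diff_tensor :: "('a::field, 'b) sla \<Rightarrow> ('b list \<Rightarrow>\<^sub>0 'a) \<Rightarrow> ('b list \<Rightarrow>\<^sub>0 'a)" where
  "diff_tensor L p = (\<Sum>w\<in>Poly_Mapping.keys p. scale (Poly_Mapping.lookup p w) (diff_word L w))"

definition cochains :: "('a::field, 'b) sla \<Rightarrow> ('a, ('b list \<Rightarrow>\<^sub>0 'a) set) gsalg" where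
  "cochains L = ext_alg (basis L) (parity L)"

definition ce_diff :: "('a::field, 'b) sla \<Rightarrow> ('b list \<Rightarrow>\<^sub>0 'a) set \<Rightarrow> ('b list \<Rightarrow>\<^sub>0 'a) set" where
  "ce_diff L X =
    (\<Union>x\<in>X. (Idl\<^bsub>free_alg (basis L) (parity L)\<^esub> (ext_rels (basis L) (parity L)))
              +>\<^bsub>free_alg (basis L) (parity L)\<^esub> diff_tensor L x)"

definition cocycles :: "('a::field, 'b) sla \<Rightarrow> ('a, ('b list \<Rightarrow>\<^sub>0 'a) set) gsalg" where
  "cocycles L =
    (let A = cochains L; Z = {X \<in> carrier A. ce_diff L X = \<zero>\<^bsub>A\<^esub>}
     in A\<lparr>carrier := Z, hcomp := (\<lambda>k q. hcomp A k q \<inter> Z)\<rparr>)"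

definition cohomology :: "('a::field, 'b) sla \<Rightarrow> ('a, ('b list \<Rightarrow>\<^sub>0 'a) set set) gsalg" where
  "cohomology L = quot_alg (cocycles L) (ce_diff L ` carrier (cochains L))"


section \<open>The Heisenberg Lie superalgebra\<close>

datatype hbasis = Bz | Bx nat | By nat

definition heis :: "nat \<Rightarrow> nat \<Rightarrow> ('a::field, hbasis) sla" where
  "heis m n =
    \<lparr>basis = {Bz} \<union> Bx ` {1..2 * m} \<union> By ` {1..n},
     parity = (\<lambda>b. case b of By _ \<Rightarrow> 1 | _ \<Rightarrow> 0),
     brk = (\<lambda>a b. case (a, b) of
         (Bx i, Bx j) \<Rightarrow>
           if i \<in> {1..m} \<and> j = m + i then Poly_Mapping.single Bz 1
           else if j \<in> {1..m} \<and> i = m + j then Poly_Mapping.single Bz (- 1)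
           else 0
       | (By i, By j) \<Rightarrow> if i = j \<and> i \<in> {1..n} then Poly_Mapping.single Bz 1 else 0
       | _ \<Rightarrow> 0)\<rparr>"


section \<open>The algebra given by generators and relations\<close>

datatype ggen = Xi nat | Eta nat

definition G_rels :: "nat \<Rightarrow> nat \<Rightarrow> (ggen list \<Rightarrow>\<^sub>0 'a::field) set" where
  "G_rels m n =
    {gen (Xi i) * gen (Xi j) + gen (Xi j) * gen (Xi i) | i j. i \<in> {1..2 * m} \<and> j \<in> {1..2 * m}} \<union>
    {gen (Xi i) * gen (Eta k) + gen (Eta k) * gen (Xi i) | i k. i \<in> {1..2 * m} \<and> k \<in> {1..n}} \<union>
    {gen (Eta k) * gen (Eta s) - gen (Eta s) * gen (Eta k) | k s. k \<in> {1..n} \<and> s \<in> {1..n}} \<union>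
    {(\<Sum>i = 1..m. gen (Xi i) * gen (Xi (m + i))) -
       scale (1 / 2) (\<Sum>i = 1..n. gen (Eta i) * gen (Eta i))}"

definition G_alg :: "nat \<Rightarrow> nat \<Rightarrow> ('a::field, (ggen list \<Rightarrow>\<^sub>0 'a) set) gsalg" where
  "G_alg m n =
    presented_alg (Xi ` {1..2 * m} \<union> Eta ` {1..n})
      (\<lambda>g. case g of Xi _ \<Rightarrow> 0 | Eta _ \<Rightarrow> 1) (G_rels m n)"


section \<open>Basic facts\<close>

lemma scale_conv_mult: "scale c p = Poly_Mapping.single [] c * p"
  by (simp add: scale_def mult_map_scale_conv_mult zero_list_def)

lemma lookup_scale: "Poly_Mapping.lookup (scale c p) w = c * Poly_Mapping.lookup p w"
  unfolding scale_def by (simp add: Poly_Mapping.map.rep_eq when_def)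

lemma keys_scale: "Poly_Mapping.keys (scale c p) \<subseteq> Poly_Mapping.keys p"
  by (auto simp: in_keys_iff lookup_scale)

lemma scale_simps [simp]:
  "scale c 0 = 0" "scale 0 p = 0" "scale 1 p = p" "scale (- c) p = - scale c p"
  "scale c (- p) = - scale c p"
  "scale c (Poly_Mapping.single w d) = Poly_Mapping.single w (c * d)"
  "scale c (scale d p) = scale (c * d) p"
  by (rule poly_mapping_eqI; simp add: lookup_scale lookup_single when_def)+

lemma scale_distrib:
  "scale c (p + q) = scale c p + scale c q" "scale c (p - q) = scale c p - scale c q"
  "scale (c + d) p = scale c p + scale d p"
  by (rule poly_mapping_eqI; simp add: lookup_scale lookup_add lookup_minus algebra_simps)+

lemma scale_sum: "scale c (sum f A) = (\<Sum>x\<in>A. scale c (f x))"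
  by (rule poly_mapping_eqI) (simp add: lookup_scale lookup_sum sum_distrib_left)

lemma free_alg_ring: "ring (free_alg B par :: ('a::field, _) gsalg)"
proof (rule ringI)
  show "abelian_group (free_alg B par :: ('a, _) gsalg)"
  proof (rule abelian_groupI)
    fix x assume "x \<in> carrier (free_alg B par :: ('a, _) gsalg)"
    then show "\<exists>y\<in>carrier (free_alg B par). y \<oplus>\<^bsub>free_alg B par\<^esub> x = \<zero>\<^bsub>free_alg B par\<^esub>"
      by (intro bexI[of _ "- x"]) (auto simp: free_alg_def in_keys_iff)
  qed (use Poly_Mapping.keys_add in \<open>fastforce simp: free_alg_def ac_simps\<close>)+
  show "Group.monoid (free_alg B par :: ('a, _) gsalg)"
  proof (rule monoidI)
    fix x y assume "x \<in> carrier (free_alg B par :: ('a, _) gsalg)"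
      and "y \<in> carrier (free_alg B par :: ('a, _) gsalg)"
    then show "x \<otimes>\<^bsub>free_alg B par\<^esub> y \<in> carrier (free_alg B par)"
      using Poly_Mapping.keys_mult[of x y] by (fastforce simp: free_alg_def plus_list_def)
  qed (auto simp: free_alg_def algebra_simps zero_list_def in_keys_iff lookup_one when_def split: if_splits)
qed (simp_all add: free_alg_def algebra_simps)

lemma scale_mult_left: "scale d p * q = scale d (p * q)" for p q :: "'b list \<Rightarrow>\<^sub>0 'a::field"
  by (simp add: scale_conv_mult mult.assoc)

lemma scale_mult_right: "p * scale d q = scale d (p * q)" for p q :: "'b list \<Rightarrow>\<^sub>0 'a::field"
proof -
  have c: "p * Poly_Mapping.single [] d = Poly_Mapping.single [] d * p"
  proof (induction p rule: update_induct)
    case const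
    show ?case by simp
  next
    case (update p w e)
    have "Poly_Mapping.update w e p = p + Poly_Mapping.single w e"
      using update(1) by (intro poly_mapping_eqI)
        (auto simp: lookup_update lookup_add lookup_single in_keys_iff when_def)
    then show ?case
      using update(3) by (simp add: mult_single plus_list_def mult.commute distrib_left distrib_right)
  qed
  have "p * scale d q = (p * Poly_Mapping.single [] d) * q"
    by (simp add: scale_conv_mult mult.assoc)
  also have "\<dots> = scale d (p * q)"
    by (simp add: c scale_conv_mult mult.assoc)
  finally show ?thesis .
qed

text \<open>The Leibniz rule on words; the sign is governed by the \<open>\<int>\<close>-degree only.\<close>

lemma diff_word_append:
  "diff_word L (u @ v) = diff_word L u * Poly_Mapping.single v 1 +
     scale ((- 1) ^ length u) (Poly_Mapping.single u 1 * diff_word L v)"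
proof (induction u)
  case Nil
  have "Poly_Mapping.single [] 1 = (1 :: 'a list \<Rightarrow>\<^sub>0 'b)"
    by (metis single_one zero_list_def)
  then show ?case by simp
next
  case (Cons c u)
  have 1: "Poly_Mapping.single (u @ v) 1 = Poly_Mapping.single u 1 * Poly_Mapping.single v (1::'b)"
    by (simp add: mult_single plus_list_def)
  have 2: "Poly_Mapping.single (c # u) 1 = gen c * Poly_Mapping.single u (1::'b)"
    by (simp add: gen_def mult_single plus_list_def)
  show ?case
    by (simp add: Cons 1 2 algebra_simps scale_mult_right)
qed

lemma heis_lie_superalgebra: "lie_superalgebra (heis m n :: ('a::field, hbasis) sla)"
proof -
  have z: "brk (heis m n :: ('a, _) sla) a Bz = 0" "brk (heis m n :: ('a, _) sla) Bz a = 0" for a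
    by (auto simp: heis_def split: hbasis.splits)
  have k: "Poly_Mapping.keys (brk (heis m n :: ('a, _) sla) a b) \<subseteq> {Bz}" for a b
    by (auto simp: heis_def split: hbasis.splits if_splits)
  have l: "lie_bracket (heis m n) u (brk (heis m n) a b) = 0" for a b and u :: "hbasis \<Rightarrow>\<^sub>0 'a"
    unfolding lie_bracket_def using k[of a b] z by (intro sum.neutral ballI) (metis scale_simps(1) singletonD subsetD)
  have r: "lie_bracket (heis m n) (brk (heis m n) a b) u = 0" for a b and u :: "hbasis \<Rightarrow>\<^sub>0 'a"
    unfolding lie_bracket_def using k[of a b] z by (intro sum.neutral ballI) (metis scale_simps(1) singletonD subsetD)
  show ?thesis
    unfolding lie_superalgebra_def l r
  proof (intro conjI ballI)
    fix a b assume ab: "a \<in> basis (heis m n :: ('a, _) sla)" "b \<in> basis (heis m n :: ('a, _) sla)"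
    show "Poly_Mapping.keys (brk (heis m n :: ('a, _) sla) a b) \<subseteq>
      {c \<in> basis (heis m n :: ('a, _) sla). parity (heis m n :: ('a, _) sla) c =
         parity (heis m n :: ('a, _) sla) a + parity (heis m n :: ('a, _) sla) b}"
      by (cases a; cases b) (auto simp: heis_def)
    show "brk (heis m n :: ('a, _) sla) a b = - scale (koszul (parity (heis m n :: ('a, _) sla) a)
      (parity (heis m n :: ('a, _) sla) b)) (brk (heis m n :: ('a, _) sla) b a)"
      by (cases a; cases b) (auto simp: heis_def koszul_def single_uminus)
  qed (simp_all add: heis_def)
qed

text \<open>
  The differential on the dual basis: \<open>dx\<^sub>i* = dy\<^sub>j* = 0\<close>, and in the exterior algebra
  \<open>dz* = (\<Sum>i. x\<^sub>i* x\<^sub>m\<^sub>+\<^sub>i*) - 1/2 (\<Sum>j. y\<^sub>j* y\<^sub>j*)\<close>.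
\<close>

lemma heis_diff1_xy: "diff1 (heis m n) (Bx i) = 0" "diff1 (heis m n) (By j) = 0"
proof -
  have k: "Poly_Mapping.lookup (brk (heis m n) a b) c = 0" if "c \<noteq> Bz" for a b c
    using that by (auto simp: heis_def lookup_single when_def split: hbasis.splits)
  show "diff1 (heis m n) (Bx i) = 0" "diff1 (heis m n) (By j) = 0"
    by (simp_all add: diff1_def k)
qed

lemma heis_diff1_z_tensor:
  "diff1 (heis m n) Bz =
     (\<Sum>i = 1..m. scale (1 / 2) (gen (Bx i) * gen (Bx (m + i)) - gen (Bx (m + i)) * gen (Bx i))) -
     scale (1 / 2) (\<Sum>j = 1..n. gen (By j) * gen (By j) :: _ \<Rightarrow>\<^sub>0 'a::field)"
proof -
  define t :: "hbasis \<Rightarrow> hbasis \<Rightarrow> hbasis list \<Rightarrow>\<^sub>0 'a" where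
    "t a b = scale (1 / 2 * koszul (parity (heis m n :: ('a, _) sla) a) (parity (heis m n :: ('a, _) sla) b) *
                    Poly_Mapping.lookup (brk (heis m n) a b) Bz) (gen a * gen b)" for a b
  have t0: "t Bz b = 0" "t a Bz = 0" "t (Bx i) (By j) = 0" "t (By j) (Bx i) = 0" for a b i j
    by (auto simp: t_def heis_def split: hbasis.splits)
  have ty: "t (By i) (By j) = (if i = j then - scale (1 / 2) (gen (By i) * gen (By i)) else 0)"
    if "i \<in> {1..n}" for i j
    using that by (auto simp: t_def heis_def koszul_def)
  have tx: "t (Bx i) (Bx j) =
      (if i \<in> {1..m} \<and> j = m + i then scale (1 / 2) (gen (Bx i) * gen (Bx j)) else 0) -
      (if j \<in> {1..m} \<and> i = m + j then scale (1 / 2) (gen (Bx i) * gen (Bx j)) else 0)" for i j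
    by (auto simp: t_def heis_def koszul_def)
  let ?B = "basis (heis m n :: ('a, _) sla)"
  have sB: "(\<Sum>a\<in>?B. f a) = f Bz + (\<Sum>i = 1..2 * m. f (Bx i)) + (\<Sum>j = 1..n. f (By j))"
    for f :: "hbasis \<Rightarrow> hbasis list \<Rightarrow>\<^sub>0 'a"
  proof -
    have "(\<Sum>a\<in>?B. f a) = f Bz + ((\<Sum>a\<in>Bx ` {1..2 * m}. f a) + (\<Sum>a\<in>By ` {1..n}. f a))"
    proof -
      have "?B = insert Bz (Bx ` {1..2 * m} \<union> By ` {1..n})" by (simp add: heis_def)
      then show ?thesis by (simp only:) (subst sum.insert sum.union_disjoint; auto)+
    qed
    then show ?thesis by (simp add: sum.reindex inj_on_def add.assoc)
  qed
  have x1: "(\<Sum>i = 1..2 * m. \<Sum>j = 1..2 * m.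
        if i \<in> {1..m} \<and> j = m + i then g i j else 0) = (\<Sum>i = 1..m. g i (m + i))"
    for g :: "nat \<Rightarrow> nat \<Rightarrow> hbasis list \<Rightarrow>\<^sub>0 'a"
  proof -
    have "(\<Sum>i = 1..2 * m. \<Sum>j = 1..2 * m. if i \<in> {1..m} \<and> j = m + i then g i j else 0) =
          (\<Sum>i = 1..2 * m. if i \<in> {1..m} then g i (m + i) else 0)"
    proof (intro sum.cong refl)
      fix i assume "i \<in> {1..2 * m}"
      have "(\<Sum>j = 1..2 * m. if i \<in> {1..m} \<and> j = m + i then g i j else 0) =
            (\<Sum>j = 1..2 * m. if j = m + i then (if i \<in> {1..m} then g i j else 0) else 0)"
        by (intro sum.cong) auto
      then show "(\<Sum>j = 1..2 * m. if i \<in> {1..m} \<and> j = m + i then g i j else 0) =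
            (if i \<in> {1..m} then g i (m + i) else 0)"
        by (auto simp: sum.delta)
    qed
    also have "\<dots> = (\<Sum>i = 1..m. g i (m + i))"
      by (intro sum.mono_neutral_cong_right) auto
    finally show ?thesis .
  qed
  have "diff1 (heis m n) Bz = (\<Sum>a\<in>?B. \<Sum>b\<in>?B. t a b)"
    by (simp add: diff1_def t_def)
  also have "\<dots> = (\<Sum>i = 1..2 * m. \<Sum>j = 1..2 * m. t (Bx i) (Bx j)) +
                  (\<Sum>i = 1..n. \<Sum>j = 1..n. t (By i) (By j))"
    by (simp add: sB t0 sum.distrib)
  also have "(\<Sum>i = 1..n. \<Sum>j = 1..n. t (By i) (By j)) =
             - scale (1 / 2) (\<Sum>j = 1..n. gen (By j) * gen (By j))"
  proof -
    have "(\<Sum>j = 1..n. t (By i) (By j)) = - scale (1 / 2) (gen (By i) * gen (By i))"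
      if "i \<in> {1..n}" for i
    proof -
      have "(\<Sum>j = 1..n. t (By i) (By j)) =
            (\<Sum>j = 1..n. if i = j then - scale (1 / 2) (gen (By i) * gen (By i)) else 0)"
        by (intro sum.cong refl ty that)
      then show ?thesis using that by (simp add: sum.delta)
    qed
    then show ?thesis by (simp add: scale_sum sum_negf)
  qed
  also have "(\<Sum>i = 1..2 * m. \<Sum>j = 1..2 * m. t (Bx i) (Bx j)) =
      (\<Sum>i = 1..2 * m. \<Sum>j = 1..2 * m.
         if i \<in> {1..m} \<and> j = m + i then scale (1 / 2) (gen (Bx i) * gen (Bx j)) else 0) -
      (\<Sum>j = 1..2 * m. \<Sum>i = 1..2 * m.
         if j \<in> {1..m} \<and> i = m + j then scale (1 / 2) (gen (Bx i) * gen (Bx j)) else 0)"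
    unfolding tx sum_subtractf
    by (rule arg_cong[where f = "minus _"], rule sum.swap)
  also have "\<dots> = (\<Sum>i = 1..m. scale (1 / 2) (gen (Bx i) * gen (Bx (m + i)))) -
                  (\<Sum>i = 1..m. scale (1 / 2) (gen (Bx (m + i)) * gen (Bx i)))"
    by (simp only: x1 x1[of "\<lambda>j i. scale (1 / 2) (gen (Bx i) * gen (Bx j))"])
  finally show ?thesis
    by (simp add: scale_distrib sum_subtractf)
qed

lemma heis_diff1_z:
  fixes m n :: nat
  defines "B \<equiv> basis (heis m n :: ('a::field_char_0, _) sla)"
    and "par \<equiv> parity (heis m n :: ('a, _) sla)"
  shows "diff1 (heis m n) Bz -
     ((\<Sum>i = 1..m. gen (Bx i) * gen (Bx (m + i))) -
      scale (1 / 2) (\<Sum>j = 1..n. gen (By j) * gen (By j)) :: _ \<Rightarrow>\<^sub>0 'a)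
     \<in> Idl\<^bsub>free_alg B par\<^esub> (ext_rels B par)"
proof -
  let ?A = "free_alg B par :: ('a, _) gsalg"
  let ?I = "Idl\<^bsub>?A\<^esub> (ext_rels B par)"
  interpret ring ?A by (rule free_alg_ring)
  have sub: "ext_rels B par \<subseteq> carrier ?A"
  proof
    fix x :: "hbasis list \<Rightarrow>\<^sub>0 'a" assume "x \<in> ext_rels B par"
    then obtain u v p q where x: "x = u * v + scale (koszul p q) (v * u)"
      and u: "u \<in> hcomp ?A 1 p" and v: "v \<in> hcomp ?A 1 q"
      unfolding ext_rels_def by blast
    have ops: "a \<oplus>\<^bsub>?A\<^esub> b = a + b" "a \<otimes>\<^bsub>?A\<^esub> b = a * b" for a b
      by (simp_all add: free_alg_def)
    have uv: "u \<in> carrier ?A" "v \<in> carrier ?A"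
      using u v by (auto simp: free_alg_def)
    have "scale (koszul p q) (v * u) \<in> carrier ?A"
      using m_closed[OF uv(2,1)] keys_scale[of "koszul p q" "v * u"] by (fastforce simp: free_alg_def)
    from a_closed[OF m_closed[OF uv] this] show "x \<in> carrier ?A"
      unfolding x ops .
  qed
  interpret I: ideal ?I ?A by (rule genideal_ideal[OF sub])
  have r: "scale (- 1 / 2) (gen (Bx i) * gen (Bx (m + i)) + gen (Bx (m + i)) * gen (Bx i)) \<in> ?I"
    if i: "i \<in> {1..m}" for i
  proof -
    have h: "gen (Bx j) \<in> hcomp ?A 1 0" if "j \<in> {1..2 * m}" for j
      using that by (auto simp: free_alg_def gen_def B_def par_def heis_def)
    have "gen (Bx i) * gen (Bx (m + i)) + scale (koszul 0 0) (gen (Bx (m + i)) * gen (Bx i))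
          \<in> (ext_rels B par :: (_ \<Rightarrow>\<^sub>0 'a) set)"
      unfolding ext_rels_def using h[of i] h[of "m + i"] i by fastforce
    then have "gen (Bx i) * gen (Bx (m + i)) + gen (Bx (m + i)) * gen (Bx i) \<in> ?I"
      using genideal_self[OF sub] by (auto simp: koszul_def)
    moreover have "Poly_Mapping.single [] (- 1 / 2) \<in> carrier ?A"
      by (auto simp: free_alg_def)
    ultimately have "Poly_Mapping.single [] (- 1 / 2) \<otimes>\<^bsub>?A\<^esub>
        (gen (Bx i) * gen (Bx (m + i)) + gen (Bx (m + i)) * gen (Bx i)) \<in> ?I"
      by (rule I.I_l_closed)
    then show ?thesis by (simp only: scale_conv_mult) (simp add: free_alg_def)
  qed
  have "(\<Sum>i\<in>S. scale (- 1 / 2) (gen (Bx i) * gen (Bx (m + i)) + gen (Bx (m + i)) * gen (Bx i)))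
        \<in> ?I" if "S \<subseteq> {1..m}" for S
    using finite_subset[OF that finite_atLeastAtMost] that
  proof (induction S)
    case empty
    show ?case using I.zero_closed by (simp add: free_alg_def)
  next
    case (insert i S)
    have "a + b \<in> ?I" if "a \<in> ?I" "b \<in> ?I" for a b
      using I.a_closed[OF that] by (simp add: free_alg_def)
    moreover have "i \<in> {1..m}" "S \<subseteq> {1..m}" using insert.prems by auto
    ultimately show ?case
      unfolding sum.insert[OF insert.hyps] using r insert.IH by blast
  qed
  from this[of "{1..m}"] have "(\<Sum>i = 1..m. scale (- 1 / 2)
      (gen (Bx i) * gen (Bx (m + i)) + gen (Bx (m + i)) * gen (Bx i))) \<in> ?I" by simp
  also have "(\<Sum>i = 1..m. scale (- 1 / 2)
      (gen (Bx i) * gen (Bx (m + i)) + gen (Bx (m + i)) * gen (Bx i))) =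
     diff1 (heis m n) Bz -
     ((\<Sum>i = 1..m. gen (Bx i) * gen (Bx (m + i))) -
      scale (1 / 2) (\<Sum>j = 1..n. gen (By j) * gen (By j)) :: _ \<Rightarrow>\<^sub>0 'a)"
  proof -
    have e: "scale (- 1 / 2) (p + q) = scale (1 / 2) (p - q) - p" for p q :: "hbasis list \<Rightarrow>\<^sub>0 'a"
      by (rule poly_mapping_eqI) (simp add: lookup_scale lookup_add lookup_minus field_simps)
    show ?thesis
      unfolding heis_diff1_z_tensor e by (simp add: sum_subtractf)
  qed
  finally show ?thesis .
qed

end

theory Submission
  imports Defs "HOL-Algebra.Subrings"
begin

text \<open>
  Let \<open>P\<close> be the super-exterior algebra on the \<open>x\<^sub>i\<close> and \<open>y\<^sub>j\<close>, with basis the monomials in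
  which no \<open>x\<^sub>i\<close> is repeated, and let \<open>\<omega> = (\<Sum>i. x\<^sub>i x\<^sub>m\<^sub>+\<^sub>i) - 1/2 (\<Sum>j. y\<^sub>j\<^sup>2)\<close>, a
  central element of \<open>P\<close>.  The algebra of cochains is \<open>P \<oplus> z P\<close>, and as \<open>dz = \<omega>\<close> and \<open>d\<close>
  vanishes on \<open>P\<close>, the differential sends \<open>a + z b\<close> to \<open>\<omega> b\<close>.  Because \<open>n \<ge> 1\<close>, the
  monomial \<open>y\<^sub>1\<^sup>2\<close> occurs in \<open>\<omega>\<close>, and comparing coefficients at multiples of \<open>y\<^sub>1\<^sup>2\<close> shows
  that \<open>\<omega>\<close> is not a zero divisor.  So the cocycles are \<open>P\<close>, the coboundaries are \<open>\<omega> P\<close>, and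
  the cohomology is \<open>P / \<omega> P\<close>, which is the algebra given by the stated generators and relations.
  In degree \<open>k\<close> its dimension is \<open>dim P\<^sub>k - dim P\<^sub>k\<^sub>-\<^sub>2\<close>; a basis is given by the monomials
  that are at most linear in \<open>y\<^sub>1\<close>.

  In the definitions all these algebras are quotients of free algebras, and cochains are cosets of
  noncommutative polynomials.  To compute with them, the free algebra is made to act on the span of
  the sorted monomials, each letter acting by left multiplication followed by sorting with the
  appropriate sign.  The normal form \<open>nf par p\<close> is the result of applying \<open>p\<close> to the empty
  monomial, and the ideal of the super-exterior algebra is exactly the set of elements with normal
  form 0 (\<open>ext_ideal_iff\<close>).  The description of the differential becomes \<open>nf_diff_tensor\<close>, and
  the regularity of \<open>\<omega>\<close> is \<open>omega_regular\<close>.  They yield representatives of cocycles and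
  coboundaries (\<open>cocycle_iff\<close>, \<open>coboundary_form\<close>, \<open>coboundary_of_z\<close>).  Hence mapping a
  noncommutative polynomial in the generators to its cohomology class is a surjective homomorphism
  whose kernel is the ideal of relations (\<open>coho_cls_kernel\<close>), and the homomorphism theorem gives the
  isomorphism.  For the dimension, \<open>basis_words_span\<close> reduces every class to the basis monomials by
  rewriting \<open>y\<^sub>1\<^sup>2\<close>, and \<open>omega_regular\<close> shows that they are independent.
\<close>

(* Here ring_hom is the set of homomorphisms between rings with carriers. *)
hide_const (open) Ring_Hom.ring_hom

section \<open>Linear maps between spaces of formal linear combinations\<close>

abbreviation mon :: "'k \<Rightarrow> ('k \<Rightarrow>\<^sub>0 'a::field)" where
  "mon k \<equiv> Poly_Mapping.single k 1"

text \<open>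
  All spaces in this development consist of formal linear combinations, of words or of multisets.
  An identity between linear maps is therefore checked on basis elements (\<open>linmap_eqI\<close>), and
  membership of \<open>f p\<close> in an ideal on the words of \<open>p\<close> (\<open>ideal_linmap\<close>).
\<close>

definition linmap :: "(('k \<Rightarrow>\<^sub>0 'a::field) \<Rightarrow> ('l \<Rightarrow>\<^sub>0 'a)) \<Rightarrow> bool" where
  "linmap f \<longleftrightarrow> (\<forall>p q. f (p + q) = f p + f q) \<and> (\<forall>c p. f (scale c p) = scale c (f p))"

definition lin_ext :: "('k \<Rightarrow> ('l \<Rightarrow>\<^sub>0 'a::field)) \<Rightarrow> ('k \<Rightarrow>\<^sub>0 'a) \<Rightarrow> ('l \<Rightarrow>\<^sub>0 'a)" where
  "lin_ext f p = (\<Sum>k\<in>Poly_Mapping.keys p. scale (Poly_Mapping.lookup p k) (f k))"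

lemma linmapI:
  "(\<And>p q. f (p + q) = f p + f q) \<Longrightarrow> (\<And>c p. f (scale c p) = scale c (f p)) \<Longrightarrow> linmap f"
  by (simp add: linmap_def)

lemma linmap_add: "linmap f \<Longrightarrow> f (p + q) = f p + f q"
  and linmap_scale: "linmap f \<Longrightarrow> f (scale c p) = scale c (f p)"
  by (auto simp: linmap_def)

lemma linmap_zero: "linmap f \<Longrightarrow> f 0 = 0"
  using linmap_scale[of f 0 0] by simp

lemma linmap_uminus: "linmap f \<Longrightarrow> f (- p) = - f p"
  using linmap_scale[of f "- 1" p] by simp

lemma linmap_diff: "linmap f \<Longrightarrow> f (p - q) = f p - f q"
  using linmap_add[of f p "- q"] linmap_uminus[of f q] by simp

lemma linmap_sum: "linmap f \<Longrightarrow> f (sum g S) = (\<Sum>x\<in>S. f (g x))"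
  by (induction S rule: infinite_finite_induct) (auto simp: linmap_zero linmap_add)

lemma linmap_compose: "linmap f \<Longrightarrow> linmap g \<Longrightarrow> linmap (\<lambda>p. f (g p))"
  by (auto simp: linmap_def)

lemma linmap_plus: "linmap f \<Longrightarrow> linmap g \<Longrightarrow> linmap (\<lambda>p. f p + g p)"
  by (auto simp: linmap_def scale_distrib)

lemma linmap_minus: "linmap f \<Longrightarrow> linmap g \<Longrightarrow> linmap (\<lambda>p. f p - g p)"
  by (auto simp: linmap_def scale_distrib)

lemma linmap_scaled: "linmap f \<Longrightarrow> linmap (\<lambda>p. scale c (f p))"
  by (auto simp: linmap_def scale_distrib mult.commute)

lemma linmap_id: "linmap (\<lambda>p. p)"
  by (simp add: linmap_def)

lemma linmap_const_zero: "linmap (\<lambda>p. 0)"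
  by (simp add: linmap_def)

lemma linmap_mult_left: "linmap (\<lambda>p. q * p)" for q :: "'b list \<Rightarrow>\<^sub>0 'a::field"
  by (simp add: linmap_def algebra_simps scale_mult_right)

lemma linmap_mult_right: "linmap (\<lambda>p. p * q)" for q :: "'b list \<Rightarrow>\<^sub>0 'a::field"
  by (simp add: linmap_def algebra_simps scale_mult_left)

lemma sum_monomials: "p = (\<Sum>k\<in>Poly_Mapping.keys p. scale (Poly_Mapping.lookup p k) (mon k))"
  by (rule poly_mapping_eqI) (auto simp: lookup_sum lookup_single when_def in_keys_iff)

lemma linmap_lin_ext: "linmap (lin_ext f)"
proof (rule linmapI)
  show "lin_ext f (p + q) = lin_ext f p + lin_ext f q" for p q
    unfolding lin_ext_def by (rule setsum_keys_plus_distrib) (simp_all add: scale_distrib)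
  show "lin_ext f (scale c p) = scale c (lin_ext f p)" for c p
  proof (cases "c = 0")
    case False
    then have "Poly_Mapping.keys (scale c p) = Poly_Mapping.keys p"
      by (auto simp: in_keys_iff lookup_scale)
    then show ?thesis by (simp add: lin_ext_def lookup_scale scale_sum)
  qed (simp add: lin_ext_def)
qed

lemma lin_ext_mon [simp]: "lin_ext f (Poly_Mapping.single k c) = scale c (f k)"
  by (cases "c = 0") (simp_all add: lin_ext_def)

lemma linmap_expand:
  assumes "linmap f"
  shows "f p = (\<Sum>k\<in>Poly_Mapping.keys p. scale (Poly_Mapping.lookup p k) (f (mon k)))"
proof -
  have "f p = f (\<Sum>k\<in>Poly_Mapping.keys p. scale (Poly_Mapping.lookup p k) (mon k))"
    using sum_monomials[of p] by (rule arg_cong)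
  also have "\<dots> = (\<Sum>k\<in>Poly_Mapping.keys p. scale (Poly_Mapping.lookup p k) (f (mon k)))"
    unfolding linmap_sum[OF assms] linmap_scale[OF assms] ..
  finally show ?thesis .
qed

lemma keys_linmap:
  assumes "linmap f" "w \<in> Poly_Mapping.keys (f p)"
  shows "\<exists>u\<in>Poly_Mapping.keys p. w \<in> Poly_Mapping.keys (f (mon u))"
proof -
  have "w \<in> Poly_Mapping.keys (\<Sum>u\<in>Poly_Mapping.keys p. scale (Poly_Mapping.lookup p u) (f (mon u)))"
    using assms(2) by (simp only: linmap_expand[OF assms(1), of p])
  then obtain u where "u \<in> Poly_Mapping.keys p" "w \<in> Poly_Mapping.keys (scale (Poly_Mapping.lookup p u) (f (mon u)))"
    using subsetD[OF keys_sum] by fast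
  then show ?thesis using subsetD[OF keys_scale] by metis
qed

lemma linmap_eq_on_keys:
  assumes "linmap f" "linmap g" "\<And>k. k \<in> Poly_Mapping.keys p \<Longrightarrow> f (mon k) = g (mon k)"
  shows "f p = g p"
proof -
  have "f p = (\<Sum>k\<in>Poly_Mapping.keys p. scale (Poly_Mapping.lookup p k) (f (mon k)))"
    by (rule linmap_expand[OF assms(1)])
  also have "\<dots> = (\<Sum>k\<in>Poly_Mapping.keys p. scale (Poly_Mapping.lookup p k) (g (mon k)))"
    using assms(3) by simp
  also have "\<dots> = g p"
    by (rule linmap_expand[OF assms(2), symmetric])
  finally show ?thesis .
qed

lemma linmap_eqI: "linmap f \<Longrightarrow> linmap g \<Longrightarrow> (\<And>k. f (mon k) = g (mon k)) \<Longrightarrow> f p = g p"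
  by (rule linmap_eq_on_keys)

lemma gen_mult_single: "gen c * Poly_Mapping.single w d = Poly_Mapping.single (c # w) d"
  by (simp add: gen_def mult_single plus_list_def)

lemma mon_append: "mon (u @ v) = (mon u * mon v :: 'b list \<Rightarrow>\<^sub>0 'a::field)"
  by (simp add: mult_single plus_list_def)

lemma mon_Cons: "mon (c # w) = (gen c * mon w :: 'b list \<Rightarrow>\<^sub>0 'a::field)"
  by (simp add: gen_def mult_single plus_list_def)

lemma mon_Nil: "mon [] = (1 :: 'b list \<Rightarrow>\<^sub>0 'a::field)"
  by (metis single_one zero_list_def)

lemma keys_gen_mult:
  "w \<in> Poly_Mapping.keys (gen g * q) \<Longrightarrow> \<exists>v\<in>Poly_Mapping.keys q. w = g # v"
  using subsetD[OF keys_mult, of w "gen g" q] by (auto simp: gen_def plus_list_def)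

section \<open>The free algebra and its ideals\<close>

lemma free_alg_sel [simp]:
  "mult (free_alg B par) = (*)" "one (free_alg B par) = 1" "zero (free_alg B par) = 0"
  "add (free_alg B par) = (+)" "smult (free_alg B par) = scale"
  by (simp_all add: free_alg_def)

lemma in_free_alg: "p \<in> carrier (free_alg B par) \<longleftrightarrow> (\<forall>w\<in>Poly_Mapping.keys p. set w \<subseteq> B)"
  by (simp add: free_alg_def)

lemma in_hcomp_free_alg:
  "p \<in> hcomp (free_alg B par) k q \<longleftrightarrow> (\<forall>w\<in>Poly_Mapping.keys p.
     set w \<subseteq> B \<and> int (length w) = k \<and> sum_list (map par w) = q)"
  by (simp add: free_alg_def)

lemma hcomp_free_alg_carrier: "p \<in> hcomp (free_alg B par) k q \<Longrightarrow> p \<in> carrier (free_alg B par)"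
  by (simp add: in_free_alg in_hcomp_free_alg)

lemma free_alg_mon: "set w \<subseteq> B \<Longrightarrow> mon w \<in> carrier (free_alg B par)"
  by (simp add: in_free_alg)

lemma free_alg_gen: "b \<in> B \<Longrightarrow> gen b \<in> carrier (free_alg B par)"
  by (simp add: in_free_alg gen_def)

lemma free_alg_closed:
  assumes "p \<in> carrier (free_alg B par)" "q \<in> carrier (free_alg B par)"
  shows "p + q \<in> carrier (free_alg B par)" "p * q \<in> carrier (free_alg B par)"
    "p - q \<in> carrier (free_alg B par)"
proof -
  interpret ring "free_alg B par" by (rule free_alg_ring)
  show "p + q \<in> carrier (free_alg B par)" "p * q \<in> carrier (free_alg B par)"
    using a_closed[OF assms] m_closed[OF assms] by simp_all
  show "p - q \<in> carrier (free_alg B par)"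
    using assms keys_diff[of p q] by (auto simp: in_free_alg)
qed

lemma free_alg_zero_one: "0 \<in> carrier (free_alg B par)" "1 \<in> carrier (free_alg B par)"
  using free_alg_mon[of "[]" B par] by (simp_all add: in_free_alg mon_Nil)

lemma free_alg_uminus: "p \<in> carrier (free_alg B par) \<Longrightarrow> - p \<in> carrier (free_alg B par)"
  by (simp add: in_free_alg)

lemma free_alg_scale: "p \<in> carrier (free_alg B par) \<Longrightarrow> scale c p \<in> carrier (free_alg B par)"
  using keys_scale[of c p] by (auto simp: in_free_alg)

lemma free_alg_sum:
  "(\<And>x. x \<in> S \<Longrightarrow> f x \<in> carrier (free_alg B par)) \<Longrightarrow> sum f S \<in> carrier (free_alg B par)"
  by (induction S rule: infinite_finite_induct) (auto simp: free_alg_zero_one free_alg_closed)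

lemma linmap_in:
  assumes "linmap f" "\<And>w. w \<in> Poly_Mapping.keys p \<Longrightarrow> f (mon w) \<in> carrier (free_alg B par)"
  shows "f p \<in> carrier (free_alg B par)"
  by (subst linmap_expand[OF assms(1)]) (intro free_alg_sum free_alg_scale assms(2))

lemma free_alg_minus: "a_minus (free_alg B par) p q = p - q"
  if "p \<in> carrier (free_alg B par)" "q \<in> carrier (free_alg B par)"
proof -
  interpret ring "free_alg B par" by (rule free_alg_ring)
  have "q + a_inv (free_alg B par) q = 0" using r_neg[OF that(2)] by simp
  then show ?thesis by (simp add: a_minus_def eq_neg_iff_add_eq_0 add.commute)
qed

text \<open>
  Closure under negation follows from absorption, as \<open>- x = (- 1) x\<close>.
\<close>

lemma ideal_free_algI:
  fixes K :: "('b list \<Rightarrow>\<^sub>0 'a::field) set"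
  assumes sub: "K \<subseteq> carrier (free_alg B par)" and z: "0 \<in> K"
    and add: "\<And>x y. x \<in> K \<Longrightarrow> y \<in> K \<Longrightarrow> x + y \<in> K"
    and l: "\<And>x p. x \<in> K \<Longrightarrow> p \<in> carrier (free_alg B par) \<Longrightarrow> p * x \<in> K"
    and r: "\<And>x p. x \<in> K \<Longrightarrow> p \<in> carrier (free_alg B par) \<Longrightarrow> x * p \<in> K"
  shows "ideal K (free_alg B par)"
proof (rule idealI)
  interpret ring "free_alg B par :: ('a, _) gsalg" by (rule free_alg_ring)
  show "ring (free_alg B par :: ('a, _) gsalg)" by (rule free_alg_ring)
  show "subgroup K (add_monoid (free_alg B par))"
  proof (rule add.subgroupI)
    show "K \<subseteq> carrier (free_alg B par)" "K \<noteq> {}" using sub z by auto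
    show "\<ominus>\<^bsub>free_alg B par\<^esub> x \<in> K" if "x \<in> K" for x
    proof -
      have "\<ominus>\<^bsub>free_alg B par\<^esub> x = (\<ominus>\<^bsub>free_alg B par\<^esub> \<one>\<^bsub>free_alg B par\<^esub>) * x"
        using l_minus[OF one_closed subsetD[OF sub that]] by simp
      then show ?thesis using l[OF that a_inv_closed[OF one_closed]] by simp
    qed
    show "x \<oplus>\<^bsub>free_alg B par\<^esub> y \<in> K" if "x \<in> K" "y \<in> K" for x y using add that by simp
  qed
qed (use l r in auto)

context
  fixes K :: "('b list \<Rightarrow>\<^sub>0 'a::field) set" and B par
  assumes K: "ideal K (free_alg B par)"
begin

lemma ideal_sub: "x \<in> K \<Longrightarrow> x \<in> carrier (free_alg B par)"
  using additive_subgroup.a_Hcarr[OF ideal.axioms(1)[OF K]] by blast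

lemma ideal_zero: "0 \<in> K"
  using additive_subgroup.zero_closed[OF ideal.axioms(1)[OF K]] by simp

lemma ideal_add: "x \<in> K \<Longrightarrow> y \<in> K \<Longrightarrow> x + y \<in> K"
  using additive_subgroup.a_closed[OF ideal.axioms(1)[OF K]] by simp

lemma ideal_l: "x \<in> K \<Longrightarrow> p \<in> carrier (free_alg B par) \<Longrightarrow> p * x \<in> K"
  and ideal_r: "x \<in> K \<Longrightarrow> p \<in> carrier (free_alg B par) \<Longrightarrow> x * p \<in> K"
  using ideal.I_l_closed[OF K] ideal.I_r_closed[OF K] by simp_all

lemma ideal_scale: "x \<in> K \<Longrightarrow> scale c x \<in> K"
  unfolding scale_conv_mult by (rule ideal_l) (auto simp: in_free_alg)

lemma ideal_uminus: "x \<in> K \<Longrightarrow> - x \<in> K"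
  using ideal_scale[of x "- 1"] by simp

lemma ideal_diff: "x \<in> K \<Longrightarrow> y \<in> K \<Longrightarrow> x - y \<in> K"
  using ideal_add[of x "- y"] ideal_uminus[of y] by simp

lemma ideal_sum: "(\<And>i. i \<in> S \<Longrightarrow> f i \<in> K) \<Longrightarrow> sum f S \<in> K"
  by (induction S rule: infinite_finite_induct) (auto simp: ideal_zero ideal_add)

lemma ideal_linmap:
  assumes "linmap f" "\<And>w. w \<in> Poly_Mapping.keys p \<Longrightarrow> f (mon w) \<in> K"
  shows "f p \<in> K"
  by (subst linmap_expand[OF assms(1)]) (intro ideal_sum ideal_scale assms(2))

lemma coset_eq_iff:
  assumes "x \<in> carrier (free_alg B par)" "y \<in> carrier (free_alg B par)"
  shows "K +>\<^bsub>free_alg B par\<^esub> x = K +>\<^bsub>free_alg B par\<^esub> y \<longleftrightarrow> x - y \<in> K"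
proof -
  interpret ring "free_alg B par :: ('a, _) gsalg" by (rule free_alg_ring)
  show ?thesis
    using quotient_eq_iff_same_a_r_cos[OF K assms] free_alg_minus[OF assms] by auto
qed

end

text \<open>
  The substitution homomorphism of the free algebra that sends the letter \<open>b\<close> to \<open>f b\<close>.
\<close>

definition lift :: "('b \<Rightarrow> ('c list \<Rightarrow>\<^sub>0 'a)) \<Rightarrow> ('b list \<Rightarrow>\<^sub>0 'a) \<Rightarrow> ('c list \<Rightarrow>\<^sub>0 'a::field)" where
  "lift f = lin_ext (\<lambda>w. prod_list (map f w))"

lemma linmap_lift: "linmap (lift f)"
  unfolding lift_def by (rule linmap_lin_ext)

lemma lift_mon: "lift f (mon w) = prod_list (map f w)"
  by (simp add: lift_def)

lemma lift_gen: "lift f (gen b) = f b"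
  by (simp add: gen_def lift_mon)

lemma lift_one: "lift f 1 = 1"
  using lift_mon[of f "[]"] by (simp add: mon_Nil)

lemma lift_mult: "lift f (p * q) = lift f p * lift f q"
proof -
  have "lift f (mon u * mon v) = lift f (mon u) * lift f (mon v)" for u v
    by (simp add: lift_mon flip: mon_append)
  then have "lift f (mon u * q) = lift f (mon u) * lift f q" for u
    by (rule linmap_eqI[OF linmap_compose[OF linmap_lift linmap_mult_left]
          linmap_compose[OF linmap_mult_left linmap_lift]])
  then show ?thesis
    by (rule linmap_eqI[OF linmap_compose[OF linmap_lift linmap_mult_right]
          linmap_compose[OF linmap_mult_right linmap_lift]])
qed

lemma lift_in: 
  assumes "p \<in> carrier (free_alg B par)" "\<And>b. b \<in> B \<Longrightarrow> f b \<in> carrier (free_alg B' par')"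
  shows "lift f p \<in> carrier (free_alg B' par')"
proof (rule linmap_in[OF linmap_lift])
  fix w assume "w \<in> Poly_Mapping.keys p"
  then have "set w \<subseteq> B" using assms(1) by (auto simp: in_free_alg)
  then show "lift f (mon w) \<in> carrier (free_alg B' par')"
    unfolding lift_mon
    by (induction w) (simp_all add: free_alg_zero_one assms(2) free_alg_closed)
qed

lemma lift_ring_hom:
  assumes "\<And>b. b \<in> B \<Longrightarrow> f b \<in> carrier (free_alg B' par')"
  shows "lift f \<in> ring_hom (free_alg B par) (free_alg B' par')"
  by (rule ring_hom_memI)
    (auto simp: lift_mult lift_one linmap_add[OF linmap_lift] intro!: lift_in assms)

section \<open>The operators of left multiplication on sorted monomials\<close>

text \<open>
  A multiset of letters stands for the product of its letters in increasing order.  Moving a new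
  letter \<open>a\<close> from the front to its place passes all smaller letters; each passage costs a sign
  unless both letters are odd.  The result is 0 if \<open>a\<close> is even and occurs already.
\<close>

definition lmult_sign :: "('b::linorder \<Rightarrow> bit) \<Rightarrow> 'b \<Rightarrow> 'b multiset \<Rightarrow> 'a::field" where
  "lmult_sign par a M = (if par a = 0 \<and> a \<in># M then 0
     else (- 1) ^ size {#b \<in># M. b < a \<and> \<not> (par a = 1 \<and> par b = 1)#})"

definition lmult :: "('b::linorder \<Rightarrow> bit) \<Rightarrow> 'b \<Rightarrow> ('b multiset \<Rightarrow>\<^sub>0 'a) \<Rightarrow> ('b multiset \<Rightarrow>\<^sub>0 'a::field)" where
  "lmult par a = lin_ext (\<lambda>M. Poly_Mapping.single (add_mset a M) (lmult_sign par a M))"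

text \<open>
  A word acts letter by letter, so this is the action of the free algebra on the span of the sorted
  monomials.  The normal form \<open>nf par p\<close> below is the value of \<open>p\<close> on the empty monomial.
\<close>

definition act :: "('b::linorder \<Rightarrow> bit) \<Rightarrow> ('b list \<Rightarrow>\<^sub>0 'a) \<Rightarrow> ('b multiset \<Rightarrow>\<^sub>0 'a) \<Rightarrow> ('b multiset \<Rightarrow>\<^sub>0 'a::field)"
  where "act par p v = lin_ext (\<lambda>w. foldr (lmult par) w v) p"

definition nf :: "('b::linorder \<Rightarrow> bit) \<Rightarrow> ('b list \<Rightarrow>\<^sub>0 'a) \<Rightarrow> ('b multiset \<Rightarrow>\<^sub>0 'a::field)" where
  "nf par p = act par p (mon {#})"

primrec word_sign :: "('b::linorder \<Rightarrow> bit) \<Rightarrow> 'b list \<Rightarrow> 'a::field" where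
  "word_sign par [] = 1"
| "word_sign par (c # w) = lmult_sign par c (mset w) * word_sign par w"

text \<open>
  The monomials that survive: an even letter squares to 0.
\<close>

definition normal :: "('b \<Rightarrow> bit) \<Rightarrow> 'b multiset \<Rightarrow> bool" where
  "normal par M \<longleftrightarrow> (\<forall>a. par a = 0 \<longrightarrow> count M a \<le> 1)"

lemma linmap_lmult: "linmap (lmult par a)"
  unfolding lmult_def by (rule linmap_lin_ext)

lemma lmult_single: "lmult par a (Poly_Mapping.single M c) =
    Poly_Mapping.single (add_mset a M) (lmult_sign par a M * c)"
  by (simp add: lmult_def mult.commute)

lemma linmap_act_left: "linmap (\<lambda>p. act par p v)"
  unfolding act_def by (rule linmap_lin_ext)

lemma linmap_act: "linmap (act par p)"
proof (rule linmapI)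
  have f: "linmap (foldr (lmult par) w)" for w :: "'a list"
    by (induction w) (simp_all add: linmap_compose linmap_lmult linmap_id id_def o_def)
  show "act par p (u + v) = act par p u + act par p v" for u v
    by (rule linmap_eqI[OF linmap_act_left linmap_plus[OF linmap_act_left linmap_act_left]])
      (simp add: act_def linmap_add[OF f])
  show "act par p (scale c v) = scale c (act par p v)" for c v
    by (rule linmap_eqI[OF linmap_act_left linmap_scaled[OF linmap_act_left]])
      (simp add: act_def linmap_scale[OF f])
qed

lemma act_mon: "act par (mon w) v = foldr (lmult par) w v"
  by (simp add: act_def)

lemma act_gen: "act par (gen a) v = lmult par a v"
  by (simp add: act_mon gen_def)

lemma act_mult: "act par (p * q) v = act par p (act par q v)"
proof -
  have "act par (mon u * mon w) v = act par (mon u) (act par (mon w) v)" for u w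
    by (simp add: act_mon flip: mon_append)
  then have "act par (mon u * q) v = act par (mon u) (act par q v)" for u
    by (rule linmap_eqI[OF linmap_compose[OF linmap_act_left linmap_mult_left]
          linmap_compose[OF linmap_act linmap_act_left]])
  then show ?thesis
    by (rule linmap_eqI[OF linmap_compose[OF linmap_act_left linmap_mult_right] linmap_act_left])
qed

lemma linmap_nf: "linmap (nf par)"
  unfolding nf_def by (rule linmap_act_left)

lemma nf_mult: "nf par (p * q) = act par p (nf par q)"
  by (simp add: nf_def act_mult)

lemma nf_mon: "nf par (mon w) = Poly_Mapping.single (mset w) (word_sign par w)"
  by (induction w) (simp_all add: nf_def act_mon lmult_single)

lemma lmult_sign_neq_0: "lmult_sign par a M \<noteq> (0::'a::field) \<longleftrightarrow> \<not> (par a = 0 \<and> a \<in># M)"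
  by (simp add: lmult_sign_def)

lemma normal_add_mset: "normal par (add_mset c M) \<longleftrightarrow> \<not> (par c = 0 \<and> c \<in># M) \<and> normal par M"
proof
  assume n: "normal par (add_mset c M)"
  have "count M a \<le> 1" if "par a = 0" for a
    using n[unfolded normal_def, rule_format, OF that] by (simp split: if_splits)
  moreover have "count M c = 0" if "par c = 0"
    using n[unfolded normal_def, rule_format, OF that] by simp
  ultimately show "\<not> (par c = 0 \<and> c \<in># M) \<and> normal par M"
    unfolding normal_def by (metis not_in_iff)
next
  assume "\<not> (par c = 0 \<and> c \<in># M) \<and> normal par M"
  then show "normal par (add_mset c M)"
    by (auto simp: normal_def not_in_iff)
qed

lemma word_sign_neq_0: "word_sign par w \<noteq> (0::'a::field) \<longleftrightarrow> normal par (mset w)"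
proof (induction w)
  case (Cons c w)
  have "word_sign par (c # w) \<noteq> (0::'a) \<longleftrightarrow>
      \<not> (par c = 0 \<and> c \<in># mset w) \<and> normal par (mset w)"
    using Cons lmult_sign_neq_0[of par c "mset w", where 'a='a] by auto
  also have "\<dots> \<longleftrightarrow> normal par (mset (c # w))"
    by (simp add: normal_add_mset)
  finally show ?case .
qed (simp add: normal_def)

text \<open>
  Only the relative order of \<open>a\<close> and \<open>b\<close> matters.  The larger of the two letters sees one more
  smaller letter when it is inserted second, and that passage contributes exactly
  \<open>- koszul (par a) (par b)\<close>.
\<close>

lemma lmult_sign_swap:
  assumes "a \<noteq> b"
  shows "lmult_sign par a (add_mset b M) * lmult_sign par b M =
    - koszul (par a) (par b) * (lmult_sign par b (add_mset a M) * (lmult_sign par a M :: 'a::field))"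
proof -
  have "b < a \<or> a < b" using assms by auto
  then show ?thesis
    using assms by (auto simp: lmult_sign_def koszul_def)
qed

text \<open>
  The operators of left multiplication satisfy the defining relations of the super-exterior algebra.
\<close>

lemma lmult_anticommute:
  "lmult par a (lmult par b v) = - scale (koszul (par a) (par b)) (lmult par b (lmult par a (v :: _ \<Rightarrow>\<^sub>0 'a::field)))"
proof (rule linmap_eqI[where p = v])
  show "linmap (\<lambda>v. lmult par a (lmult par b v))"
    by (intro linmap_compose[OF linmap_lmult] linmap_lmult)
  show "linmap (\<lambda>v. - scale (koszul (par a) (par b)) (lmult par b (lmult par a v)))"
    using linmap_scaled[OF linmap_compose[OF linmap_lmult linmap_lmult], of "- koszul (par a) (par b)"] by simp
  show "lmult par a (lmult par b (mon M)) =
    - scale (koszul (par a) (par b)) (lmult par b (lmult par a (mon M :: _ \<Rightarrow>\<^sub>0 'a)))" for M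
  proof (cases "a = b")
    case True
    then show ?thesis by (auto simp: lmult_single lmult_sign_def koszul_def single_uminus)
  next
    case False
    then show ?thesis
      using lmult_sign_swap[OF False, of par M, where 'a='a]
      by (simp add: lmult_single single_uminus add_mset_commute)
  qed
qed

lemma lmult_sign_le:
  assumes "\<And>b. b \<in># M \<Longrightarrow> c \<le> b" "par c = 0 \<Longrightarrow> c \<notin># M"
  shows "lmult_sign par c M = 1"
proof -
  have "{#b \<in># M. b < c \<and> \<not> (par c = 1 \<and> par b = 1)#} = {#}"
    using leD[OF assms(1)] by (auto simp: filter_mset_eq_conv)
  then show ?thesis using assms(2) unfolding lmult_sign_def by (metis power_0 size_empty)
qed

section \<open>The ideal of the super-exterior algebra\<close>

abbreviation ext_ideal :: "'b set \<Rightarrow> ('b \<Rightarrow> bit) \<Rightarrow> ('b list \<Rightarrow>\<^sub>0 'a::field) set" where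
  "ext_ideal B par \<equiv> Idl\<^bsub>free_alg B par\<^esub> (ext_rels B par)"

lemma degree_1_keys:
  assumes "u \<in> hcomp (free_alg B par) 1 p" "w \<in> Poly_Mapping.keys u"
  obtains a where "w = [a]" "a \<in> B" "par a = p"
proof -
  have "set w \<subseteq> B" "length w = 1" "sum_list (map par w) = p"
    using assms by (auto simp: in_hcomp_free_alg)
  then show ?thesis using that by (cases w) auto
qed

lemma ext_rels_sub: "ext_rels B par \<subseteq> carrier (free_alg B par)"
  by (auto simp: ext_rels_def intro!: free_alg_closed free_alg_scale dest: hcomp_free_alg_carrier)

lemma ideal_ext_ideal: "ideal (ext_ideal B par) (free_alg B par)"
  by (rule ring.genideal_ideal[OF free_alg_ring ext_rels_sub])

lemma ext_ideal_letters:
  assumes "a \<in> B" "b \<in> B"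
  shows "gen a * gen b + scale (koszul (par a) (par b)) (gen b * gen a) \<in> ext_ideal B par"
proof -
  have "gen c \<in> hcomp (free_alg B par) 1 (par c)" if "c \<in> B" for c
    using that by (simp add: in_hcomp_free_alg gen_def)
  then have "gen a * gen b + scale (koszul (par a) (par b)) (gen b * gen a) \<in> ext_rels B par"
    unfolding ext_rels_def using assms by blast
  then show ?thesis using ring.genideal_self[OF free_alg_ring ext_rels_sub] by blast
qed

text \<open>
  The defining relations are bilinear, hence it suffices to check them on letters.
\<close>

lemma ext_ideal_minimal:
  fixes K :: "('b list \<Rightarrow>\<^sub>0 'a::field) set"
  assumes K: "ideal K (free_alg B par)"
    and r: "\<And>a b. a \<in> B \<Longrightarrow> b \<in> B \<Longrightarrow>
      gen a * gen b + scale (koszul (par a) (par b)) (gen b * gen a) \<in> K"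
  shows "ext_ideal B par \<subseteq> K"
proof (rule ring.genideal_minimal[OF free_alg_ring K], rule subsetI)
  fix x :: "'b list \<Rightarrow>\<^sub>0 'a" assume "x \<in> ext_rels B par"
  then obtain u v p q where x: "x = u * v + scale (koszul p q) (v * u)"
    and u: "u \<in> hcomp (free_alg B par) 1 p" and v: "v \<in> hcomp (free_alg B par) 1 q"
    unfolding ext_rels_def by blast
  show "x \<in> K"
    unfolding x
  proof (rule ideal_linmap[OF K, where p = u])
    show "linmap (\<lambda>u. u * v + scale (koszul p q) (v * u))"
      by (intro linmap_plus linmap_mult_right linmap_scaled linmap_mult_left)
    fix w assume "w \<in> Poly_Mapping.keys u"
    then obtain a where a: "w = [a]" "a \<in> B" "par a = p" by (rule degree_1_keys[OF u])
    show "mon w * v + scale (koszul p q) (v * mon w) \<in> K"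
    proof (rule ideal_linmap[OF K, where p = v])
      show "linmap (\<lambda>v. mon w * v + scale (koszul p q) (v * mon w))"
        by (intro linmap_plus linmap_mult_right linmap_scaled linmap_mult_left)
      fix w' assume "w' \<in> Poly_Mapping.keys v"
      then obtain b where b: "w' = [b]" "b \<in> B" "par b = q" by (rule degree_1_keys[OF v])
      show "mon w * mon w' + scale (koszul p q) (mon w' * mon w) \<in> K"
        using r[OF a(2) b(2)] a b by (simp add: gen_def)
    qed
  qed
qed

lemma act_ext_ideal:
  fixes p :: "'b::linorder list \<Rightarrow>\<^sub>0 'a::field"
  assumes "p \<in> ext_ideal B par"
  shows "act par p v = 0"
proof -
  let ?K = "{p \<in> carrier (free_alg B par). \<forall>v. act par p v = (0 :: _ \<Rightarrow>\<^sub>0 'a)}"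
  have "ext_ideal B par \<subseteq> ?K"
  proof (rule ext_ideal_minimal)
    show "ideal ?K (free_alg B par)"
      by (rule ideal_free_algI) (auto simp: free_alg_zero_one free_alg_closed act_mult
          linmap_add[OF linmap_act_left] linmap_zero[OF linmap_act_left] linmap_zero[OF linmap_act])
    show "gen a * gen b + scale (koszul (par a) (par b)) (gen b * gen a) \<in> ?K"
      if "a \<in> B" "b \<in> B" for a b
      using that
      by (auto intro!: free_alg_closed free_alg_scale free_alg_gen simp: act_mult act_gen
          linmap_add[OF linmap_act_left] linmap_scale[OF linmap_act_left] lmult_anticommute[of par a b])
  qed
  with assms show ?thesis by blast
qed

text \<open>
  One pass of insertion sort, carried out modulo the ideal.  A repeated even letter disappears
  because the ideal contains twice its square, and 2 is invertible.
\<close>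

lemma insert_sorted:
  fixes c :: "'b::linorder"
  assumes "c \<in> B" "set t \<subseteq> B" "sorted t"
  shows "mon (c # t) - scale (lmult_sign par c (mset t)) (mon (insort c t))
     \<in> (ext_ideal B par :: (_ \<Rightarrow>\<^sub>0 'a::field_char_0) set)"
  using assms(2,3)
proof (induction t)
  case Nil
  then show ?case by (simp add: lmult_sign_def ideal_zero[OF ideal_ext_ideal])
next
  case (Cons b t)
  note K = ideal_ext_ideal[of B par, where 'b='a]
  have b: "b \<in> B" "set t \<subseteq> B" "sorted t" "\<forall>x\<in>set t. b \<le> x" using Cons.prems by auto
  have r: "gen c * gen b + scale (koszul (par c) (par b)) (gen b * gen c)
      \<in> (ext_ideal B par :: (_ \<Rightarrow>\<^sub>0 'a) set)"
    by (rule ext_ideal_letters) fact+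
  have m: "mon t \<in> carrier (free_alg B par :: ('a, _) gsalg)" by (rule free_alg_mon) fact
  consider "c < b" | "c = b" "par c = 1" | "c = b" "par c = 0" | "b < c"
    by (metis bit_not_one_iff linorder_neqE)
  then show ?case
  proof cases
    case 1
    then have "lmult_sign par c (mset (b # t)) = (1::'a)"
      using b(4) by (intro lmult_sign_le) auto
    with 1 show ?thesis by (simp add: ideal_zero[OF K] less_imp_le)
  next
    case 2
    then have "lmult_sign par c (mset (b # t)) = (1::'a)"
      using b(4) 2 by (intro lmult_sign_le) auto
    with 2 show ?thesis by (simp add: ideal_zero[OF K])
  next
    case 3
    have "scale (1 / 2) (gen c * gen b + scale (koszul (par c) (par b)) (gen b * gen c)) * mon t
        \<in> (ext_ideal B par :: (_ \<Rightarrow>\<^sub>0 'a) set)"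
      by (intro ideal_r[OF K] ideal_scale[OF K] r m)
    with 3 show ?thesis
      by (simp add: lmult_sign_def koszul_def scale_distrib mult.assoc gen_mult_single distrib_right scale_mult_left
          flip: single_add)
  next
    case 4
    let ?k = "koszul (par c) (par b) :: 'a" and ?s = "lmult_sign par c (mset t) :: 'a"
    have nle: "\<not> c \<le> b" using 4 by simp
    have s: "lmult_sign par c (mset (b # t)) = - ?k * ?s"
      using 4 by (auto simp: lmult_sign_def koszul_def)
    have 1: "(gen c * gen b + scale ?k (gen b * gen c)) * mon t \<in> ext_ideal B par"
      by (intro ideal_r[OF K] r m)
    have 2: "scale ?k (gen b * (mon (c # t) - scale ?s (mon (insort c t)))) \<in> ext_ideal B par"
      by (intro ideal_scale[OF K] ideal_l[OF K] Cons.IH b free_alg_gen)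
    \<comment> \<open>Exchange the letters c and b by the relation, then insert c into the tail.\<close>
    have "mon (c # b # t) - scale (lmult_sign par c (mset (b # t))) (mon (insort c (b # t))) =
       (gen c * gen b + scale ?k (gen b * gen c)) * mon t -
       scale ?k (gen b * (mon (c # t) - scale ?s (mon (insort c t))))"
      unfolding s by (simp add: nle gen_mult_single algebra_simps scale_mult_left scale_mult_right scale_distrib single_uminus)
    then show ?thesis using ideal_diff[OF K 1 2] by simp
  qed
qed

lemma word_reduce:
  fixes w :: "'b::linorder list"
  assumes "set w \<subseteq> B"
  shows "mon w - scale (word_sign par w) (mon (sorted_list_of_multiset (mset w)))
     \<in> (ext_ideal B par :: (_ \<Rightarrow>\<^sub>0 'a::field_char_0) set)"
  using assms
proof (induction w)
  case Nil
  then show ?case by (simp add: ideal_zero[OF ideal_ext_ideal])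
next
  case (Cons c w)
  note K = ideal_ext_ideal[of B par, where 'b='a]
  let ?t = "sorted_list_of_multiset (mset w)"
  let ?s = "lmult_sign par c (mset w) :: 'a" and ?e = "word_sign par w :: 'a"
  have t: "mset ?t = mset w" by simp
  have st: "set ?t = set w" by (metis t set_mset_mset)
  have 1: "gen c * (mon w - scale ?e (mon ?t)) \<in> ext_ideal B par"
    by (intro ideal_l[OF K] Cons.IH free_alg_gen) (use Cons.prems in auto)
  have "mon (c # ?t) - scale (lmult_sign par c (mset ?t)) (mon (insort c ?t))
      \<in> (ext_ideal B par :: (_ \<Rightarrow>\<^sub>0 'a) set)"
    by (rule insert_sorted) (use Cons.prems st in \<open>auto simp: sorted_sorted_list_of_multiset\<close>)
  then have 2: "scale ?e (mon (c # ?t) - scale ?s (mon (insort c ?t))) \<in> ext_ideal B par"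
    unfolding t by (rule ideal_scale[OF K])
  have "mon (c # w) - scale (word_sign par (c # w)) (mon (sorted_list_of_multiset (mset (c # w)))) =
     gen c * (mon w - scale ?e (mon ?t)) + scale ?e (mon (c # ?t) - scale ?s (mon (insort c ?t)))"
    by (simp add: gen_mult_single algebra_simps scale_mult_right scale_distrib)
  then show ?case using ideal_add[OF K 1 2] by simp
qed

text \<open>
  The key to all computations: the normal form decides membership in the ideal.  Elements of the
  ideal act as zero, so their normal form vanishes; conversely every \<open>p\<close> is congruent to the
  combination of sorted words that has the coefficients of \<open>nf par p\<close>.
\<close>

theorem ext_ideal_iff:
  fixes p :: "'b::linorder list \<Rightarrow>\<^sub>0 'a::field_char_0"
  shows "p \<in> ext_ideal B par \<longleftrightarrow> p \<in> carrier (free_alg B par) \<and> nf par p = 0"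
proof
  show "p \<in> carrier (free_alg B par) \<and> nf par p = 0" if "p \<in> ext_ideal B par"
    using act_ext_ideal[OF that] ideal_sub[OF ideal_ext_ideal that] by (simp add: nf_def)
next
  assume p: "p \<in> carrier (free_alg B par) \<and> nf par p = 0"
  note K = ideal_ext_ideal[of B par, where 'b='a]
  define std where "std = lin_ext (\<lambda>M. mon (sorted_list_of_multiset M) :: 'b list \<Rightarrow>\<^sub>0 'a)"
  have "p - std (nf par p) \<in> ext_ideal B par"
  proof (rule ideal_linmap[OF K, where p = p])
    show "linmap (\<lambda>p. p - std (nf par p))"
      unfolding std_def by (intro linmap_minus linmap_id linmap_compose[OF linmap_lin_ext] linmap_nf)
    fix w assume "w \<in> Poly_Mapping.keys p"
    then have "set w \<subseteq> B" using p by (auto simp: in_free_alg)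
    then show "mon w - std (nf par (mon w)) \<in> ext_ideal B par"
      using word_reduce[of w B par] by (simp add: nf_mon std_def)
  qed
  then show "p \<in> ext_ideal B par" using p by (simp add: std_def linmap_zero[OF linmap_lin_ext])
qed

section \<open>The Heisenberg differential on normal forms\<close>

text \<open>
  An order on the letters in which \<open>z\<close> comes first, so that multiplication by \<open>z\<close> and removal
  of \<open>z\<close> involve no sign.
\<close>

primrec hbasis_rank :: "hbasis \<Rightarrow> nat" where
  "hbasis_rank Bz = 0"
| "hbasis_rank (Bx i) = 2 * i + 2"
| "hbasis_rank (By j) = 2 * j + 1"

lemma hbasis_rank_inj: "hbasis_rank a = hbasis_rank b \<Longrightarrow> a = b"
  by (cases a; cases b; simp; presburger)

instantiation hbasis :: linorder
begin

definition less_eq_hbasis :: "hbasis \<Rightarrow> hbasis \<Rightarrow> bool" where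
  "a \<le> b \<longleftrightarrow> hbasis_rank a \<le> hbasis_rank b"

definition less_hbasis :: "hbasis \<Rightarrow> hbasis \<Rightarrow> bool" where
  "a < b \<longleftrightarrow> hbasis_rank a < hbasis_rank b"

instance
  by standard (auto simp: less_eq_hbasis_def less_hbasis_def intro: hbasis_rank_inj)

end

definition hbasis_set :: "nat \<Rightarrow> nat \<Rightarrow> hbasis set" where
  "hbasis_set m n = {Bz} \<union> Bx ` {1..2 * m} \<union> By ` {1..n}"

definition hpar :: "hbasis \<Rightarrow> bit" where
  "hpar b = (case b of By _ \<Rightarrow> 1 | _ \<Rightarrow> 0)"

lemma hpar_simps [simp]: "hpar Bz = 0" "hpar (Bx i) = 0" "hpar (By j) = 1"
  by (simp_all add: hpar_def)

lemma heis_simps [simp]: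
  "basis (heis m n) = hbasis_set m n" "parity (heis m n) = hpar"
  by (auto simp: heis_def hbasis_set_def hpar_def fun_eq_iff)

abbreviation tens :: "nat \<Rightarrow> nat \<Rightarrow> ('a::field, hbasis list \<Rightarrow>\<^sub>0 'a) gsalg" where
  "tens m n \<equiv> free_alg (hbasis_set m n) hpar"

abbreviation tens_ideal :: "nat \<Rightarrow> nat \<Rightarrow> (hbasis list \<Rightarrow>\<^sub>0 'a::field) set" where
  "tens_ideal m n \<equiv> ext_ideal (hbasis_set m n) hpar"

text \<open>
  The quadratic element that represents \<open>dz*\<close> in the exterior algebra.
\<close>

definition omega :: "nat \<Rightarrow> nat \<Rightarrow> (hbasis list \<Rightarrow>\<^sub>0 'a::field)" where
  "omega m n = (\<Sum>i = 1..m. gen (Bx i) * gen (Bx (m + i))) -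
     scale (1 / 2) (\<Sum>j = 1..n. gen (By j) * gen (By j))"

text \<open>
  The contraction with \<open>z\<close>.
\<close>

definition del_z :: "(hbasis multiset \<Rightarrow>\<^sub>0 'a) \<Rightarrow> (hbasis multiset \<Rightarrow>\<^sub>0 'a::field)" where
  "del_z = lin_ext (\<lambda>M. if Bz \<in># M then mon (M - {#Bz#}) else 0)"

lemma linmap_del_z: "linmap del_z"
  unfolding del_z_def by (rule linmap_lin_ext)

lemma Bz_least: "Bz \<le> b" "b \<noteq> Bz \<longleftrightarrow> Bz < b"
  by (cases b; simp add: less_eq_hbasis_def less_hbasis_def)+

lemma lmult_sign_Bz: "lmult_sign hpar Bz M = (if Bz \<in># M then 0 else 1)"
  using lmult_sign_le[of M Bz hpar] Bz_least(1) by (auto simp: lmult_sign_def)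

lemma lmult_sign_add_Bz: "c \<noteq> Bz \<Longrightarrow> lmult_sign hpar c (add_mset Bz M) = - lmult_sign hpar c M"
  by (simp add: lmult_sign_def Bz_least(2))

lemma del_z_lmult:
  fixes v :: "hbasis multiset \<Rightarrow>\<^sub>0 'a::field"
  assumes "c \<noteq> Bz"
  shows "del_z (lmult hpar c v) = - lmult hpar c (del_z v)"
proof (rule linmap_eqI[where p = v])
  show "linmap (\<lambda>v. del_z (lmult hpar c v))" by (rule linmap_compose[OF linmap_del_z linmap_lmult])
  show "linmap (\<lambda>v. - lmult hpar c (del_z v))"
    using linmap_scaled[OF linmap_compose[OF linmap_lmult linmap_del_z], of "- 1"] by simp
  show "del_z (lmult hpar c (mon M)) = - lmult hpar c (del_z (mon M :: _ \<Rightarrow>\<^sub>0 'a))" for M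
  proof (cases "Bz \<in># M")
    case True
    then obtain N where N: "M = add_mset Bz N" by (metis insert_DiffM)
    show ?thesis
      using assms by (simp add: del_z_def lmult_single N lmult_sign_add_Bz single_uminus linmap_uminus[OF linmap_lin_ext])
  next
    case False
    then show ?thesis using assms by (auto simp: del_z_def lmult_single linmap_zero[OF linmap_lmult])
  qed
qed

text \<open>
  The usual homotopy formula for multiplication by \<open>z\<close> and contraction with \<open>z\<close>.  It fails on
  multisets containing \<open>z\<close> more than once, which normal forms do not involve.
\<close>

lemma del_z_lmult_Bz:
  "lmult hpar Bz (del_z (nf hpar (mon u))) + del_z (lmult hpar Bz (nf hpar (mon u))) = nf hpar (mon u :: _ \<Rightarrow>\<^sub>0 'a::field)"
proof (cases "word_sign hpar u = (0::'a)")
  case True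
  then show ?thesis by (simp add: nf_mon linmap_zero[OF linmap_del_z] linmap_zero[OF linmap_lmult])
next
  case False
  then have "normal hpar (mset u)" by (simp add: word_sign_neq_0)
  then have "count (mset u) Bz \<le> 1" by (simp add: normal_def)
  then have "Bz \<notin># mset u - {#Bz#}" by (simp add: not_in_iff)
  then show ?thesis by (simp add: nf_mon del_z_def lmult_single lmult_sign_Bz linmap_zero[OF linmap_lmult])
qed

lemma act_omega:
  "act hpar (omega m n) v = (\<Sum>i = 1..m. lmult hpar (Bx i) (lmult hpar (Bx (m + i)) v)) -
     scale (1 / 2) (\<Sum>j = 1..n. lmult hpar (By j) (lmult hpar (By j) v))"
  by (simp add: omega_def linmap_diff[OF linmap_act_left] linmap_scale[OF linmap_act_left]
      linmap_sum[OF linmap_act_left] act_mult act_gen)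

text \<open>
  Both factors of a summand of \<open>omega\<close> have the same parity, so a letter that passes them picks
  up the same sign twice.
\<close>

lemma act_omega_lmult: "act hpar (omega m n) (lmult hpar c v) = lmult hpar c (act hpar (omega m n) v)"
proof -
  have "lmult hpar a (lmult hpar b (lmult hpar c v)) = lmult hpar c (lmult hpar a (lmult hpar b v))"
    if "hpar a = hpar b" for a b
    using that
    by (simp add: lmult_anticommute[of hpar b c] lmult_anticommute[of hpar a c] koszul_def
        linmap_uminus[OF linmap_lmult] linmap_scale[OF linmap_lmult])
  then show ?thesis
    by (simp add: act_omega linmap_diff[OF linmap_lmult] linmap_scale[OF linmap_lmult]
        linmap_sum[OF linmap_lmult])
qed

lemma act_omega_act: "act hpar (omega m n) (act hpar p v) = act hpar p (act hpar (omega m n) v)"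
proof (rule linmap_eqI[where p = p])
  show "linmap (\<lambda>p. act hpar (omega m n) (act hpar p v))"
    by (rule linmap_compose[OF linmap_act linmap_act_left])
  show "linmap (\<lambda>p. act hpar p (act hpar (omega m n) v))" by (rule linmap_act_left)
  show "act hpar (omega m n) (act hpar (mon w) v) = act hpar (mon w) (act hpar (omega m n) v)" for w
    by (induction w) (simp_all add: act_mon act_omega_lmult)
qed

lemma diff_tensor_lin_ext: "diff_tensor L = lin_ext (diff_word L)"
  by (simp add: fun_eq_iff diff_tensor_def lin_ext_def)

text \<open>
  Contraction anticommutes with every letter other than \<open>z\<close>, while \<open>omega\<close> commutes with all
  letters; so the Leibniz rule passes to normal forms.  For a cochain \<open>a + z b\<close> with \<open>a\<close> and \<open>b\<close>
  free of \<open>z\<close>, the right-hand side is \<open>omega b\<close>.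
\<close>

lemma nf_diff_word:
  fixes u :: "hbasis list"
  shows "nf hpar (diff_word (heis m n) u) =
    act hpar (omega m n) (del_z (nf hpar (mon u :: _ \<Rightarrow>\<^sub>0 'a::field_char_0)))"
proof (induction u)
  case Nil
  show ?case
    by (simp add: nf_mon del_z_def linmap_zero[OF linmap_nf] linmap_zero[OF linmap_act] del: single_one)
next
  case (Cons c u)
  let ?L = "heis m n :: ('a, _) sla" and ?o = "act hpar (omega m n)"
  let ?v = "nf hpar (mon u :: _ \<Rightarrow>\<^sub>0 'a)"
  have v: "nf hpar (mon (c # u)) = lmult hpar c ?v"
    by (simp add: nf_def act_mon)
  have "nf hpar (diff_word ?L (c # u)) = act hpar (diff1 ?L c) ?v - lmult hpar c (?o (del_z ?v))"
    by (simp add: linmap_diff[OF linmap_nf] nf_mult act_gen Cons)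
  also have "\<dots> = ?o (del_z (lmult hpar c ?v))"
  proof (cases "c = Bz")
    case True
    have "act hpar (diff1 ?L Bz - omega m n) ?v = 0"
      using heis_diff1_z[where m = m and n = n and 'a='a]
      by (intro act_ext_ideal[of _ "hbasis_set m n"]) (simp add: omega_def)
    then have "act hpar (diff1 ?L Bz) ?v = ?o ?v"
      by (simp add: linmap_diff[OF linmap_act_left])
    also have "\<dots> = ?o (lmult hpar Bz (del_z ?v)) + ?o (del_z (lmult hpar Bz ?v))"
      using del_z_lmult_Bz[of u, where 'a='a] by (simp flip: linmap_add[OF linmap_act])
    finally show ?thesis using True by (simp add: act_omega_lmult)
  next
    case False
    then have "diff1 ?L c = 0" by (cases c) (simp_all add: heis_diff1_xy)
    then show ?thesis
      using False by (simp add: del_z_lmult linmap_uminus[OF linmap_act] act_omega_lmult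
          linmap_zero[OF linmap_act_left])
  qed
  finally show ?case by (simp only: v)
qed

lemma nf_diff_tensor:
  "nf hpar (diff_tensor (heis m n) p) =
    act hpar (omega m n) (del_z (nf hpar (p :: _ \<Rightarrow>\<^sub>0 'a::field_char_0)))"
proof (rule linmap_eqI[where p = p])
  show "linmap (\<lambda>p. nf hpar (diff_tensor (heis m n) p))"
    unfolding diff_tensor_lin_ext by (rule linmap_compose[OF linmap_nf linmap_lin_ext])
  show "linmap (\<lambda>p. act hpar (omega m n) (del_z (nf hpar p)))"
    by (rule linmap_compose[OF linmap_act linmap_compose[OF linmap_del_z linmap_nf]])
qed (simp add: diff_tensor_lin_ext nf_diff_word)

section \<open>The quadratic relation is not a zero divisor\<close>

lemma lookup_lmult:
  "Poly_Mapping.lookup (lmult par a v) M =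
     (if a \<in># M then lmult_sign par a (M - {#a#}) * Poly_Mapping.lookup v (M - {#a#}) else 0)"
proof -
  have e: "add_mset a N = M \<longleftrightarrow> a \<in># M \<and> N = M - {#a#}" for N
    by (metis add_mset_remove_trivial insert_DiffM union_single_eq_member)
  have "Poly_Mapping.lookup (lmult par a v) M =
    (\<Sum>N\<in>Poly_Mapping.keys v. if N = M - {#a#} then
      (if a \<in># M then lmult_sign par a N * Poly_Mapping.lookup v N else 0) else 0)"
    unfolding lmult_def lin_ext_def lookup_sum
    by (intro sum.cong) (auto simp: lookup_scale lookup_single when_def e mult.commute)
  then show ?thesis by (auto simp: sum.delta in_keys_iff)
qed

text \<open>
  The coefficient of \<open>omega v\<close> at \<open>y\<^sub>1\<^sup>2 M\<close> is \<open>- 1/2\<close> times that of \<open>v\<close> at \<open>M\<close>, plus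
  contributions of monomials with two fewer letters different from \<open>y\<^sub>1\<close>.  Hence the coefficients
  of \<open>v\<close> vanish by induction on the number of those letters.  Since only the coefficients at
  multiples of \<open>y\<^sub>1\<^sup>2\<close> enter, this is more than injectivity of multiplication by \<open>omega\<close>; the
  stronger form yields the linear independence of the monomial basis.
\<close>

lemma omega_regular:
  fixes v :: "hbasis multiset \<Rightarrow>\<^sub>0 'a::field_char_0"
  assumes "n \<ge> 1"
    and top: "\<And>M. Poly_Mapping.lookup (act hpar (omega m n) v) (add_mset (By 1) (add_mset (By 1) M)) = 0"
  shows "v = 0"
proof -
  define y where "y = By 1"
  define r where "r M = size {#b \<in># M. b \<noteq> y#}" for M
  have "Poly_Mapping.lookup v M = 0" for M
  proof (induction "r M" arbitrary: M rule: less_induct)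
    case less
    let ?M = "add_mset y (add_mset y M)"
    have r: "r (N - {#a#}) < r N" if "a \<in># N" "a \<noteq> y" for N a
      using that multi_member_split[OF that(1)] by (auto simp: r_def)
    have other: "Poly_Mapping.lookup (lmult hpar a (lmult hpar b v)) ?M = 0"
      if "a \<noteq> y" "b \<noteq> y" for a b
    proof (cases "a \<in># ?M \<and> b \<in># ?M - {#a#}")
      case True
      have "r (?M - {#a#} - {#b#}) < r M"
        using r[of a ?M] r[of b "?M - {#a#}"] True that by (simp add: r_def)
      then have "Poly_Mapping.lookup v (?M - {#a#} - {#b#}) = 0" by (rule less)
      with True show ?thesis by (simp only: lookup_lmult if_True simp_thms mult_zero_right)
    qed (auto simp: lookup_lmult)
    have ne: "Bx i \<noteq> y" for i by (simp add: y_def)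
    have "hpar y = 1" by (simp add: y_def)
    \<comment> \<open>Both insertions of y pass the same smaller letters, so their signs cancel.\<close>
    then have same: "Poly_Mapping.lookup (lmult hpar y (lmult hpar y v)) ?M = Poly_Mapping.lookup v M"
      by (simp add: lookup_lmult lmult_sign_def flip: power_add mult_2)
    have "(\<Sum>j = 1..n. Poly_Mapping.lookup (lmult hpar (By j) (lmult hpar (By j) v)) ?M) =
      (\<Sum>j = 1..n. if j = 1 then Poly_Mapping.lookup v M else 0)"
      using same other by (intro sum.cong) (auto simp: y_def)
    also have "\<dots> = Poly_Mapping.lookup v M" using assms(1) by simp
    finally have "Poly_Mapping.lookup (act hpar (omega m n) v) ?M = - (1 / 2) * Poly_Mapping.lookup v M"
      by (simp add: act_omega lookup_minus lookup_sum lookup_scale other ne)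
    then show ?case using top[of M] by (simp add: y_def)
  qed
  then show ?thesis by (intro poly_mapping_eqI) simp
qed

section \<open>Substituting letters\<close>

primrec embed_letter :: "ggen \<Rightarrow> hbasis" where
  "embed_letter (Xi i) = Bx i"
| "embed_letter (Eta j) = By j"

definition ggen_set :: "nat \<Rightarrow> nat \<Rightarrow> ggen set" where
  "ggen_set m n = Xi ` {1..2 * m} \<union> Eta ` {1..n}"

definition gpar :: "ggen \<Rightarrow> bit" where
  "gpar g = (case g of Xi _ \<Rightarrow> 0 | Eta _ \<Rightarrow> 1)"

lemma gpar_embed_letter: "hpar (embed_letter g) = gpar g"
  by (cases g) (simp_all add: gpar_def)

lemma embed_letter_in: "embed_letter g \<in> hbasis_set m n \<longleftrightarrow> g \<in> ggen_set m n"
  by (cases g) (auto simp: hbasis_set_def ggen_set_def)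

abbreviation gtens :: "nat \<Rightarrow> nat \<Rightarrow> ('a::field, ggen list \<Rightarrow>\<^sub>0 'a) gsalg" where
  "gtens m n \<equiv> free_alg (ggen_set m n) gpar"

text \<open>
  The algebra on the \<open>\<xi>\<close> and \<open>\<eta>\<close> is identified with the subalgebra of the tensor algebra
  on the \<open>x\<close> and \<open>y\<close>; \<open>kill_z\<close> is the retraction that sends \<open>z\<close> to 0.
\<close>

definition embed :: "(ggen list \<Rightarrow>\<^sub>0 'a) \<Rightarrow> (hbasis list \<Rightarrow>\<^sub>0 'a::field)" where
  "embed = lift (\<lambda>g. gen (embed_letter g))"

definition kill_z :: "(hbasis list \<Rightarrow>\<^sub>0 'a) \<Rightarrow> (ggen list \<Rightarrow>\<^sub>0 'a::field)" where
  "kill_z = lift (\<lambda>b. case b of Bz \<Rightarrow> 0 | Bx i \<Rightarrow> gen (Xi i) | By j \<Rightarrow> gen (Eta j))"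

lemma linmap_embed: "linmap embed" and linmap_kill_z: "linmap kill_z"
  unfolding embed_def kill_z_def by (rule linmap_lift)+

lemma embed_mult: "embed (p * q) = embed p * embed q" and kill_z_mult: "kill_z (r * s) = kill_z r * kill_z s"
  unfolding embed_def kill_z_def by (rule lift_mult)+

lemma embed_gen: "embed (gen g) = gen (embed_letter g)"
  by (simp add: embed_def lift_gen)

lemma kill_z_gen: "kill_z (gen b) = (case b of Bz \<Rightarrow> 0 | Bx i \<Rightarrow> gen (Xi i) | By j \<Rightarrow> gen (Eta j))"
  by (simp add: kill_z_def lift_gen)

lemma embed_one: "embed 1 = 1" and kill_z_one: "kill_z 1 = 1"
  unfolding embed_def kill_z_def by (rule lift_one)+

lemma embed_mon: "embed (mon w) = mon (map embed_letter w)"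
  by (induction w) (simp_all add: mon_Cons embed_mult embed_gen embed_one mon_Nil del: single_one)

lemma embed_in: "q \<in> carrier (gtens m n) \<Longrightarrow> embed q \<in> carrier (tens m n)"
  unfolding embed_def by (rule lift_in) (auto intro!: free_alg_gen simp: embed_letter_in)

lemma kill_z_in: "p \<in> carrier (tens m n) \<Longrightarrow> kill_z p \<in> carrier (gtens m n)"
  unfolding kill_z_def
  by (rule lift_in)
    (auto simp: hbasis_set_def ggen_set_def free_alg_zero_one intro!: free_alg_gen split: hbasis.splits)

lemma embed_letter_word:
  "set (map embed_letter w) \<subseteq> hbasis_set m n \<longleftrightarrow> set w \<subseteq> ggen_set m n"
  "sum_list (map hpar (map embed_letter w)) = sum_list (map gpar w)"
  by (induction w) (simp_all add: embed_letter_in gpar_embed_letter)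

lemma embed_hcomp:
  assumes "q \<in> hcomp (gtens m n) k p"
  shows "embed q \<in> hcomp (tens m n) k p"
  unfolding in_hcomp_free_alg
proof
  fix w assume "w \<in> Poly_Mapping.keys (embed q)"
  from keys_linmap[OF linmap_embed this]
  obtain u where "u \<in> Poly_Mapping.keys q" "w = map embed_letter u" by (auto simp: embed_mon)
  then show "set w \<subseteq> hbasis_set m n \<and> int (length w) = k \<and> sum_list (map hpar w) = p"
    using assms by (simp only: in_hcomp_free_alg embed_letter_word length_map)
qed

lemma kill_z_embed: "kill_z (embed q) = q"
proof (rule linmap_eqI[where p = q, OF linmap_compose[OF linmap_kill_z linmap_embed] linmap_id])
  show "kill_z (embed (mon w)) = mon w" for w
  proof (induction w)
    case Nil
    show ?case by (simp add: mon_Nil embed_one kill_z_one del: single_one)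
  next
    case (Cons g w)
    then show ?case
      by (cases g) (simp_all only: mon_Cons embed_mult kill_z_mult embed_gen kill_z_gen embed_letter.simps hbasis.case)
  qed
qed

lemma embed_kill_z_gen: "embed (kill_z (gen b)) = (if b = Bz then 0 else gen b)"
  by (cases b) (simp_all add: kill_z_gen embed_gen linmap_zero[OF linmap_embed])

lemma embed_kill_z_mon: "embed (kill_z (mon w)) = (if Bz \<in> set w then 0 else mon w :: _ \<Rightarrow>\<^sub>0 'a::field)"
proof (induction w)
  case Nil
  show ?case by (simp add: mon_Nil embed_one kill_z_one del: single_one)
next
  case (Cons b w)
  have "embed (kill_z (mon (b # w))) = embed (kill_z (gen b)) * embed (kill_z (mon w :: _ \<Rightarrow>\<^sub>0 'a))"
    by (simp only: mon_Cons embed_mult kill_z_mult)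
  also have "\<dots> = (if Bz \<in> set (b # w) then 0 else gen b * mon w)"
    unfolding Cons embed_kill_z_gen by auto
  finally show ?case by (simp only: mon_Cons)
qed

lemma kill_z_hcomp:
  fixes p :: "_ \<Rightarrow>\<^sub>0 'a::field"
  assumes "p \<in> hcomp (tens m n) k q"
  shows "kill_z p \<in> hcomp (gtens m n) k q"
  unfolding in_hcomp_free_alg
proof
  fix w assume "w \<in> Poly_Mapping.keys (kill_z p)"
  from keys_linmap[OF linmap_kill_z this]
  obtain u where u: "u \<in> Poly_Mapping.keys p" "w \<in> Poly_Mapping.keys (kill_z (mon u :: _ \<Rightarrow>\<^sub>0 'a))" ..
  have "u = map embed_letter w"
    using u(2)
  proof (induction u arbitrary: w)
    case Nil
    then show ?case by (simp add: mon_Nil kill_z_one zero_list_def del: single_one)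
  next
    case (Cons b u)
    have g: "w \<in> Poly_Mapping.keys (kill_z (gen b) * kill_z (mon u :: _ \<Rightarrow>\<^sub>0 'a))"
      using Cons.prems by (simp only: mon_Cons kill_z_mult)
    have "\<exists>g v. embed_letter g = b \<and> w = g # v \<and> v \<in> Poly_Mapping.keys (kill_z (mon u :: _ \<Rightarrow>\<^sub>0 'a))"
      using g keys_gen_mult[of w] by (cases b) (fastforce simp: kill_z_gen)+
    then show ?case using Cons.IH by auto
  qed
  then show "set w \<subseteq> ggen_set m n \<and> int (length w) = k \<and> sum_list (map gpar w) = q"
    using bspec[OF assms[unfolded in_hcomp_free_alg] u(1)] embed_letter_word[of w] by auto
qed

section \<open>Cocycles and coboundaries up to the ideal\<close>

text \<open>
  The effect of the retraction on normal forms.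
\<close>

definition drop_z :: "(hbasis multiset \<Rightarrow>\<^sub>0 'a) \<Rightarrow> (hbasis multiset \<Rightarrow>\<^sub>0 'a::field)" where
  "drop_z = lin_ext (\<lambda>M. if Bz \<in># M then 0 else mon M)"

lemma linmap_drop_z: "linmap drop_z"
  unfolding drop_z_def by (rule linmap_lin_ext)

lemma nf_embed_kill_z: "nf hpar (embed (kill_z p)) = drop_z (nf hpar p)"
proof (rule linmap_eqI[where p = p])
  show "linmap (\<lambda>p. nf hpar (embed (kill_z p)))"
    by (rule linmap_compose[OF linmap_nf linmap_compose[OF linmap_embed linmap_kill_z]])
  show "linmap (\<lambda>p. drop_z (nf hpar p))" by (rule linmap_compose[OF linmap_drop_z linmap_nf])
qed (simp add: embed_kill_z_mon nf_mon drop_z_def linmap_zero[OF linmap_nf])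

lemma lookup_del_z: "Poly_Mapping.lookup (del_z v) M = Poly_Mapping.lookup v (add_mset Bz M)"
proof -
  have e: "N - {#Bz#} = M \<longleftrightarrow> N = add_mset Bz M" if "Bz \<in># N" for N
    using that by auto
  have "Poly_Mapping.lookup (del_z v) M =
    (\<Sum>N\<in>Poly_Mapping.keys v. if N = add_mset Bz M then Poly_Mapping.lookup v N else 0)"
    unfolding del_z_def lin_ext_def lookup_sum
    by (intro sum.cong) (auto simp: lookup_single when_def e)
  then show ?thesis by (auto simp: sum.delta in_keys_iff)
qed

lemma drop_z_eq:
  assumes "del_z v = 0"
  shows "drop_z v = v"
proof (rule linmap_eq_on_keys[OF linmap_drop_z linmap_id])
  fix M assume "M \<in> Poly_Mapping.keys v"
  moreover have "Poly_Mapping.lookup v M = 0" if "Bz \<in># M"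
    using lookup_del_z[of v "M - {#Bz#}"] that assms by simp
  ultimately show "drop_z (mon M) = mon M" by (auto simp: drop_z_def in_keys_iff)
qed

lemma del_z_drop_z: "del_z (drop_z v) = 0"
proof (rule linmap_eqI[where p = v, OF linmap_compose[OF linmap_del_z linmap_drop_z] linmap_const_zero])
  show "del_z (drop_z (mon M)) = 0" for M
    by (cases "Bz \<in># M") (simp_all add: drop_z_def del_z_def linmap_zero[OF linmap_lin_ext])
qed

lemma del_z_lmult_Bz_drop: "del_z (lmult hpar Bz v) = drop_z v"
proof (rule linmap_eqI[where p = v, OF linmap_compose[OF linmap_del_z linmap_lmult] linmap_drop_z])
  show "del_z (lmult hpar Bz (mon M)) = drop_z (mon M)" for M
    by (simp add: drop_z_def lmult_single lmult_sign_Bz del_z_def linmap_zero[OF linmap_lin_ext])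
qed

lemma diff_tensor_in:
  fixes p :: "hbasis list \<Rightarrow>\<^sub>0 'a::field"
  assumes "p \<in> carrier (tens m n)"
  shows "diff_tensor (heis m n) p \<in> carrier (tens m n)"
proof (rule linmap_in[where p = p])
  show "linmap (diff_tensor (heis m n :: ('a, _) sla))"
    unfolding diff_tensor_lin_ext by (rule linmap_lin_ext)
  fix w assume "w \<in> Poly_Mapping.keys p"
  then have "set w \<subseteq> hbasis_set m n" using assms by (auto simp: in_free_alg)
  then have "diff_word (heis m n :: ('a, _) sla) w \<in> carrier (tens m n)"
    by (induction w) (auto simp: free_alg_zero_one diff1_def
        intro!: free_alg_closed free_alg_sum free_alg_scale free_alg_gen free_alg_mon)
  then show "diff_tensor (heis m n :: ('a, _) sla) (mon w) \<in> carrier (tens m n)"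
    by (simp add: diff_tensor_lin_ext)
qed

lemma diff_tensor_ideal:
  fixes p :: "hbasis list \<Rightarrow>\<^sub>0 'a::field_char_0"
  assumes "p \<in> tens_ideal m n"
  shows "diff_tensor (heis m n) p \<in> tens_ideal m n"
  using assms by (simp add: ext_ideal_iff diff_tensor_in nf_diff_tensor
      linmap_zero[OF linmap_act] linmap_zero[OF linmap_del_z])

text \<open>
  Since \<open>omega\<close> is regular, \<open>p\<close> represents a cocycle iff the contraction of its normal form with
  \<open>z\<close> vanishes, that is, iff \<open>p\<close> is congruent to a polynomial in the letters \<open>x\<close> and \<open>y\<close>.
\<close>

lemma cocycle_iff:
  fixes p :: "hbasis list \<Rightarrow>\<^sub>0 'a::field_char_0"
  assumes n: "n \<ge> 1" and p: "p \<in> carrier (tens m n)"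
  shows "diff_tensor (heis m n) p \<in> tens_ideal m n \<longleftrightarrow> p - embed (kill_z p) \<in> tens_ideal m n"
proof -
  let ?v = "nf hpar p"
  have "diff_tensor (heis m n) p \<in> tens_ideal m n \<longleftrightarrow> act hpar (omega m n) (del_z ?v) = 0"
    by (simp add: ext_ideal_iff diff_tensor_in[OF p] nf_diff_tensor)
  also have "\<dots> \<longleftrightarrow> del_z ?v = 0"
    using omega_regular[OF n, of m "del_z ?v"] by (auto simp: linmap_zero[OF linmap_act])
  also have "\<dots> \<longleftrightarrow> drop_z ?v = ?v"
    using drop_z_eq[of ?v] del_z_drop_z[of ?v] by auto
  also have "\<dots> \<longleftrightarrow> p - embed (kill_z p) \<in> tens_ideal m n"
    using p by (auto simp: ext_ideal_iff linmap_diff[OF linmap_nf] nf_embed_kill_z free_alg_closed embed_in kill_z_in)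
  finally show ?thesis .
qed

definition omega_G :: "nat \<Rightarrow> nat \<Rightarrow> (ggen list \<Rightarrow>\<^sub>0 'a::field)" where
  "omega_G m n = (\<Sum>i = 1..m. gen (Xi i) * gen (Xi (m + i))) -
       scale (1 / 2) (\<Sum>i = 1..n. gen (Eta i) * gen (Eta i))"

lemma embed_omega: "embed (omega_G m n) = omega m n"
  by (simp add: omega_G_def omega_def linmap_diff[OF linmap_embed] linmap_scale[OF linmap_embed]
      linmap_sum[OF linmap_embed] embed_mult embed_gen)

lemma omega_G_in: "omega_G m n \<in> carrier (gtens m n)"
  unfolding omega_G_def
  by (intro free_alg_closed free_alg_sum free_alg_scale free_alg_gen) (auto simp: ggen_set_def)

lemma omega_in: "omega m n \<in> carrier (tens m n)"
  using embed_in[OF omega_G_in] by (simp add: embed_omega)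

text \<open>
  A lift of the contraction with \<open>z\<close> from normal forms to words.  At the first \<open>z\<close> the rest of the
  word may be projected by \<open>kill_z\<close>, since a second \<open>z\<close> gives 0 in the exterior algebra.
\<close>

primrec cut_z :: "hbasis list \<Rightarrow> (ggen list \<Rightarrow>\<^sub>0 'a::field)" where
  "cut_z [] = 0"
| "cut_z (c # u) = (if c = Bz then kill_z (mon u) else - (kill_z (gen c) * cut_z u))"

lemma nf_cut_z: "nf hpar (embed (cut_z w)) = del_z (nf hpar (mon w :: _ \<Rightarrow>\<^sub>0 'a::field))"
proof (induction w)
  case Nil
  show ?case
    by (simp add: linmap_zero[OF linmap_embed] linmap_zero[OF linmap_nf] nf_mon del_z_def del: single_one)
next
  case (Cons c u)
  have v: "nf hpar (mon (c # u)) = lmult hpar c (nf hpar (mon u :: _ \<Rightarrow>\<^sub>0 'a))" for c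
    by (simp add: nf_def act_mon)
  show ?case
  proof (cases "c = Bz")
    case True
    then show ?thesis by (simp only: v cut_z.simps if_True simp_thms nf_embed_kill_z del_z_lmult_Bz_drop)
  next
    case False
    then have "embed (kill_z (gen c)) = (gen c :: _ \<Rightarrow>\<^sub>0 'a)" by (simp add: gen_def embed_kill_z_mon)
    then show ?thesis
      using False Cons by (simp only: v cut_z.simps if_False linmap_uminus[OF linmap_embed]
          linmap_uminus[OF linmap_nf] embed_mult nf_mult act_gen del_z_lmult[OF False])
  qed
qed

text \<open>
  Together with the next lemma: up to the ideal, the coboundaries are the multiples of \<open>omega\<close> by
  polynomials in \<open>x\<close> and \<open>y\<close>.
\<close>

lemma coboundary_form:
  fixes r :: "hbasis list \<Rightarrow>\<^sub>0 'a::field_char_0"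
  assumes r: "r \<in> carrier (tens m n)"
  obtains q where "q \<in> carrier (gtens m n)"
    "diff_tensor (heis m n) r - embed (omega_G m n * q) \<in> tens_ideal m n"
proof
  let ?q = "lin_ext cut_z r :: ggen list \<Rightarrow>\<^sub>0 'a"
  show q: "?q \<in> carrier (gtens m n)"
  proof (rule linmap_in[OF linmap_lin_ext])
    fix w assume "w \<in> Poly_Mapping.keys r"
    then have "set w \<subseteq> hbasis_set m n" using r by (auto simp: in_free_alg)
    then have "(cut_z w :: _ \<Rightarrow>\<^sub>0 'a) \<in> carrier (gtens m n)"
    proof (induction w)
      case (Cons c w)
      then have "(kill_z (mon w) :: _ \<Rightarrow>\<^sub>0 'a) \<in> carrier (gtens m n)"
        "(kill_z (gen c) :: _ \<Rightarrow>\<^sub>0 'a) \<in> carrier (gtens m n)"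
        by (auto intro!: kill_z_in free_alg_mon free_alg_gen)
      then show ?case using Cons by (auto simp: free_alg_closed free_alg_uminus)
    qed (simp add: free_alg_zero_one)
    then show "lin_ext cut_z (mon w :: _ \<Rightarrow>\<^sub>0 'a) \<in> carrier (gtens m n)" by simp
  qed
  have "nf hpar (embed ?q) = del_z (nf hpar r)"
    by (rule linmap_eqI[where p = r, OF linmap_compose[OF linmap_nf linmap_compose[OF linmap_embed linmap_lin_ext]]
          linmap_compose[OF linmap_del_z linmap_nf]]) (simp add: nf_cut_z)
  then show "diff_tensor (heis m n) r - embed (omega_G m n * ?q) \<in> tens_ideal m n"
    by (simp add: ext_ideal_iff diff_tensor_in r free_alg_closed embed_in omega_G_in omega_in q nf_diff_tensor
        linmap_diff[OF linmap_nf] embed_mult nf_mult embed_omega)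
qed

lemma coboundary_of_z:
  fixes q :: "ggen list \<Rightarrow>\<^sub>0 'a::field_char_0"
  assumes q: "q \<in> carrier (gtens m n)"
  shows "diff_tensor (heis m n) (gen Bz * embed q) - embed (omega_G m n * q) \<in> tens_ideal m n"
proof -
  have "gen Bz * embed q \<in> carrier (tens m n)"
    using q by (intro free_alg_closed free_alg_gen embed_in) (auto simp: hbasis_set_def)
  moreover have "del_z (lmult hpar Bz (nf hpar (embed q))) = nf hpar (embed q)"
    using nf_embed_kill_z[of "embed q"] by (simp add: del_z_lmult_Bz_drop kill_z_embed)
  ultimately show ?thesis
    by (simp add: ext_ideal_iff diff_tensor_in q free_alg_closed embed_in omega_G_in omega_in nf_diff_tensor
        linmap_diff[OF linmap_nf] embed_mult nf_mult embed_omega act_gen)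
qed

lemma omega_central:
  fixes q :: "ggen list \<Rightarrow>\<^sub>0 'a::field_char_0"
  assumes "q \<in> carrier (gtens m n)"
  shows "embed (q * omega_G m n - omega_G m n * q) \<in> tens_ideal m n"
proof -
  have "nf hpar (embed q * omega m n) = nf hpar (omega m n * embed q)"
    by (simp only: nf_def act_mult act_omega_act)
  then have "nf hpar (embed (q * omega_G m n - omega_G m n * q)) = 0"
    by (simp add: linmap_diff[OF linmap_embed] linmap_diff[OF linmap_nf] embed_mult embed_omega)
  then show ?thesis using assms by (simp add: ext_ideal_iff free_alg_closed embed_in omega_G_in omega_in)
qed

section \<open>The ideal of the quadratic algebra\<close>

abbreviation G_ideal :: "nat \<Rightarrow> nat \<Rightarrow> (ggen list \<Rightarrow>\<^sub>0 'a::field) set" where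
  "G_ideal m n \<equiv> Idl\<^bsub>gtens m n\<^esub> (G_rels m n)"

lemma G_rels_sub: "G_rels m n \<subseteq> carrier (gtens m n)"
proof -
  have "omega_G m n \<in> carrier (gtens m n :: ('a::field, _) gsalg)" by (rule omega_G_in)
  then show ?thesis
    unfolding G_rels_def
    by (auto simp: omega_G_def ggen_set_def intro!: free_alg_closed free_alg_gen)
qed

lemma ideal_G_ideal: "ideal (G_ideal m n) (gtens m n)"
  by (rule ring.genideal_ideal[OF free_alg_ring G_rels_sub])

lemma G_rels_G_ideal: "x \<in> G_rels m n \<Longrightarrow> x \<in> G_ideal m n"
  using ring.genideal_self[OF free_alg_ring G_rels_sub] by blast

lemma omega_G_ideal: "omega_G m n \<in> G_ideal m n"
  by (rule G_rels_G_ideal) (simp add: G_rels_def omega_G_def)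

text \<open>
  On letters, the retraction maps the exterior relations to the first three families of relations
  of the quadratic algebra, or to 0 when they involve \<open>z\<close>.
\<close>

lemma kill_z_ideal:
  fixes p :: "hbasis list \<Rightarrow>\<^sub>0 'a::field"
  assumes "p \<in> tens_ideal m n"
  shows "kill_z p \<in> G_ideal m n"
proof -
  note K = ideal_G_ideal[of m n, where 'a='a]
  let ?K = "{p \<in> carrier (tens m n). kill_z p \<in> (G_ideal m n :: (_ \<Rightarrow>\<^sub>0 'a) set)}"
  have "tens_ideal m n \<subseteq> ?K"
  proof (rule ext_ideal_minimal)
    show "ideal ?K (tens m n)"
      by (rule ideal_free_algI)
        (auto simp: free_alg_zero_one free_alg_closed linmap_zero[OF linmap_kill_z] ideal_zero[OF K]
          linmap_add[OF linmap_kill_z] ideal_add[OF K] kill_z_mult ideal_l[OF K] ideal_r[OF K] kill_z_in)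
    show "gen a * gen b + scale (koszul (hpar a) (hpar b)) (gen b * gen a) \<in> ?K"
      if ab: "a \<in> hbasis_set m n" "b \<in> hbasis_set m n" for a b
    proof -
      have "kill_z (gen a * gen b + scale (koszul (hpar a) (hpar b) :: 'a) (gen b * gen a)) =
        kill_z (gen a) * kill_z (gen b) + scale (koszul (hpar a) (hpar b)) (kill_z (gen b) * kill_z (gen a))"
        by (simp only: linmap_add[OF linmap_kill_z] linmap_scale[OF linmap_kill_z] kill_z_mult)
      also have "\<dots> \<in> G_ideal m n"
      proof (cases "a = Bz \<or> b = Bz")
        case True
        then show ?thesis by (auto simp: kill_z_gen ideal_zero[OF K])
      next
        case False
        have xx: "gen (Xi i) * gen (Xi j) + gen (Xi j) * gen (Xi i) \<in> (G_ideal m n :: (_ \<Rightarrow>\<^sub>0 'a) set)"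
          if "i \<in> {1..2 * m}" "j \<in> {1..2 * m}" for i j
          using that by (intro G_rels_G_ideal) (unfold G_rels_def, blast)
        have xe: "gen (Xi i) * gen (Eta k) + gen (Eta k) * gen (Xi i) \<in> (G_ideal m n :: (_ \<Rightarrow>\<^sub>0 'a) set)"
          if "i \<in> {1..2 * m}" "k \<in> {1..n}" for i k
          using that by (intro G_rels_G_ideal) (unfold G_rels_def, blast)
        have ex: "gen (Eta k) * gen (Xi i) + gen (Xi i) * gen (Eta k) \<in> (G_ideal m n :: (_ \<Rightarrow>\<^sub>0 'a) set)"
          if "i \<in> {1..2 * m}" "k \<in> {1..n}" for i k
          using xe[OF that] by (subst add.commute)
        have ee: "gen (Eta k) * gen (Eta s) - gen (Eta s) * gen (Eta k) \<in> (G_ideal m n :: (_ \<Rightarrow>\<^sub>0 'a) set)"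
          if "k \<in> {1..n}" "s \<in> {1..n}" for k s
          using that by (intro G_rels_G_ideal) (unfold G_rels_def, blast)
        consider i j where "a = Bx i" "b = Bx j" "i \<in> {1..2 * m}" "j \<in> {1..2 * m}"
          | i k where "a = Bx i" "b = By k" "i \<in> {1..2 * m}" "k \<in> {1..n}"
          | i k where "a = By k" "b = Bx i" "i \<in> {1..2 * m}" "k \<in> {1..n}"
          | k s where "a = By k" "b = By s" "k \<in> {1..n}" "s \<in> {1..n}"
          using ab False by (auto simp: hbasis_set_def)
        then show ?thesis
        proof cases
          case 1
          then show ?thesis using xx[OF 1(3,4)] by (simp add: kill_z_gen koszul_def)
        next
          case 2
          then show ?thesis using xe[OF 2(3,4)] by (simp add: kill_z_gen koszul_def)
        next
          case 3
          then show ?thesis using ex[OF 3(3,4)] by (simp add: kill_z_gen koszul_def)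
        next
          case 4
          then show ?thesis using ee[OF 4(3,4)] by (simp add: kill_z_gen koszul_def)
        qed
      qed
      finally show ?thesis using ab by (auto intro!: free_alg_closed free_alg_scale free_alg_gen)
    qed
  qed
  with assms show ?thesis by blast
qed

text \<open>
  This gives the inclusion of the kernel in the ideal of relations: apply the retraction to the
  hypothesis and note that \<open>omega_G\<close> itself is a relation.
\<close>

lemma in_G_ideal:
  fixes q :: "ggen list \<Rightarrow>\<^sub>0 'a::field"
  assumes "q' \<in> carrier (gtens m n)" "embed (q - omega_G m n * q') \<in> tens_ideal m n"
  shows "q \<in> G_ideal m n"
proof -
  note K = ideal_G_ideal[of m n, where 'a='a]
  have "q - omega_G m n * q' \<in> G_ideal m n" using kill_z_ideal[OF assms(2)] by (simp add: kill_z_embed)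
  from ideal_add[OF K this ideal_r[OF K omega_G_ideal assms(1)]] show ?thesis by simp
qed

section \<open>Quotients of graded superalgebras\<close>

lemma ring_cong:
  assumes "ring R" "carrier S = carrier R" "mult S = mult R" "one S = one R" "zero S = zero R" "add S = add R"
  shows "ring S"
proof -
  interpret R: ring R by fact
  show ?thesis
  proof (rule ringI)
    have "\<exists>y\<in>carrier R. y \<oplus>\<^bsub>R\<^esub> x = \<zero>\<^bsub>R\<^esub>" if "x \<in> carrier R" for x
      using R.a_inv_closed R.l_neg that by blast
    then show "abelian_group S"
      by (intro abelian_groupI) (simp_all add: assms R.a_assoc R.a_comm R.a_lcomm)
    show "Group.monoid S" by (rule monoidI) (simp_all add: assms R.m_assoc)
  qed (simp_all add: assms R.l_distr R.r_distr)
qed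

lemma quot_alg_sel [simp]:
  "carrier (quot_alg A I) = carrier (A Quot I)" "mult (quot_alg A I) = mult (A Quot I)"
  "one (quot_alg A I) = one (A Quot I)" "zero (quot_alg A I) = zero (A Quot I)"
  "add (quot_alg A I) = add (A Quot I)"
  "hcomp (quot_alg A I) k q = (\<lambda>x. I +>\<^bsub>A\<^esub> x) ` hcomp A k q"
  by (simp_all add: quot_alg_def)

context
  fixes A :: "('a, 'b) gsalg" and I
  assumes I: "ideal I A"
begin

lemma quot_alg_ring: "ring (quot_alg A I)"
  by (rule ring_cong[OF ideal.quotient_is_ring[OF I]]) simp_all

lemma quot_alg_hom: "(\<lambda>x. I +>\<^bsub>A\<^esub> x) \<in> ring_hom A (quot_alg A I)"
  using ideal.rcos_ring_hom[OF I] by (simp add: Ring.ring_hom_def)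

lemma quot_alg_carrier: "carrier (quot_alg A I) = (\<lambda>x. I +>\<^bsub>A\<^esub> x) ` carrier A"
  by (auto simp: FactRing_simps)

lemma quot_alg_zero: "zero (quot_alg A I) = I"
  by (simp add: FactRing_def)

lemma coset_memD:
  assumes "x \<in> carrier A" "y \<in> I +>\<^bsub>A\<^esub> x"
  shows "y \<in> carrier A" "I +>\<^bsub>A\<^esub> y = I +>\<^bsub>A\<^esub> x"
proof -
  interpret ideal I A by (rule I)
  show "y \<in> carrier A" using assms a_elemrcos_carrier by blast
  show "I +>\<^bsub>A\<^esub> y = I +>\<^bsub>A\<^esub> x"
    using a_repr_independence[OF assms(2,1) a_subgroup] by simp
qed

lemma coset_self: "x \<in> carrier A \<Longrightarrow> x \<in> I +>\<^bsub>A\<^esub> x"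
proof -
  interpret ideal I A by (rule I)
  show "x \<in> carrier A \<Longrightarrow> x \<in> I +>\<^bsub>A\<^esub> x" by (rule a_rcos_self)
qed

text \<open>
  The scalar multiple of a coset is defined as a union over its elements; all members of that union
  coincide as soon as the scalar action respects congruence.
\<close>

lemma quot_alg_smult:
  assumes "x \<in> carrier A"
    and "\<And>y. y \<in> carrier A \<Longrightarrow> I +>\<^bsub>A\<^esub> y = I +>\<^bsub>A\<^esub> x \<Longrightarrow> I +>\<^bsub>A\<^esub> (c \<odot>\<^bsub>A\<^esub> y) = I +>\<^bsub>A\<^esub> (c \<odot>\<^bsub>A\<^esub> x)"
  shows "c \<odot>\<^bsub>quot_alg A I\<^esub> (I +>\<^bsub>A\<^esub> x) = I +>\<^bsub>A\<^esub> (c \<odot>\<^bsub>A\<^esub> x)"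
proof -
  have "(\<Union>y\<in>I +>\<^bsub>A\<^esub> x. I +>\<^bsub>A\<^esub> (c \<odot>\<^bsub>A\<^esub> y)) = I +>\<^bsub>A\<^esub> (c \<odot>\<^bsub>A\<^esub> x)"
    by (rule UN_constant_eq[OF coset_self[OF assms(1)]]) (use coset_memD[OF assms(1)] assms(2) in blast)
  then show ?thesis by (simp add: quot_alg_def)
qed

end

lemma presented_smult:
  fixes x :: "'b list \<Rightarrow>\<^sub>0 'a::field"
  assumes K: "ideal K (free_alg B par)" and x: "x \<in> carrier (free_alg B par)"
  shows "c \<odot>\<^bsub>quot_alg (free_alg B par) K\<^esub> (K +>\<^bsub>free_alg B par\<^esub> x) = K +>\<^bsub>free_alg B par\<^esub> (scale c x)"
proof -
  have "K +>\<^bsub>free_alg B par\<^esub> (scale c y) = K +>\<^bsub>free_alg B par\<^esub> (scale c x)"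
    if "y \<in> carrier (free_alg B par)" "K +>\<^bsub>free_alg B par\<^esub> y = K +>\<^bsub>free_alg B par\<^esub> x" for y
    using that x ideal_scale[OF K, of "y - x" c]
    by (simp add: coset_eq_iff[OF K] free_alg_scale scale_distrib)
  then show ?thesis using quot_alg_smult[OF K x, of c] by simp
qed

section \<open>The cohomology as a quotient of the free algebra\<close>

abbreviation cls :: "nat \<Rightarrow> nat \<Rightarrow> (hbasis list \<Rightarrow>\<^sub>0 'a::field) \<Rightarrow> (hbasis list \<Rightarrow>\<^sub>0 'a) set" where
  "cls m n p \<equiv> tens_ideal m n +>\<^bsub>tens m n\<^esub> p"

definition xy_cls :: "nat \<Rightarrow> nat \<Rightarrow> (ggen list \<Rightarrow>\<^sub>0 'a::field) \<Rightarrow> (hbasis list \<Rightarrow>\<^sub>0 'a) set" where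
  "xy_cls m n q = cls m n (embed q)"

abbreviation heis_cochains :: "nat \<Rightarrow> nat \<Rightarrow> ('a::field, (hbasis list \<Rightarrow>\<^sub>0 'a) set) gsalg" where
  "heis_cochains m n \<equiv> cochains (heis m n)"

abbreviation heis_cocycles :: "nat \<Rightarrow> nat \<Rightarrow> ('a::field, (hbasis list \<Rightarrow>\<^sub>0 'a) set) gsalg" where
  "heis_cocycles m n \<equiv> cocycles (heis m n)"

abbreviation heis_cohomology :: "nat \<Rightarrow> nat \<Rightarrow> ('a::field, (hbasis list \<Rightarrow>\<^sub>0 'a) set set) gsalg" where
  "heis_cohomology m n \<equiv> cohomology (heis m n)"

definition heis_coboundaries :: "nat \<Rightarrow> nat \<Rightarrow> (hbasis list \<Rightarrow>\<^sub>0 'a::field) set set" where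
  "heis_coboundaries m n = ce_diff (heis m n) ` carrier (heis_cochains m n)"

text \<open>
  The cohomology class of a polynomial in the letters \<open>x\<close> and \<open>y\<close>, viewed as a map on the free
  algebra on the \<open>\<xi>\<close> and \<open>\<eta>\<close>.
\<close>

definition coho_cls :: "nat \<Rightarrow> nat \<Rightarrow> (ggen list \<Rightarrow>\<^sub>0 'a::field) \<Rightarrow> (hbasis list \<Rightarrow>\<^sub>0 'a) set set" where
  "coho_cls m n q = heis_coboundaries m n +>\<^bsub>heis_cocycles m n\<^esub> (xy_cls m n q)"

lemma cochains_quot: "heis_cochains m n = quot_alg (tens m n) (tens_ideal m n)"
  by (simp add: cochains_def ext_alg_def presented_alg_def)

lemma cochains_ring: "ring (heis_cochains m n)"
  unfolding cochains_quot by (rule quot_alg_ring[OF ideal_ext_ideal])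

lemma cochains_carrier: "carrier (heis_cochains m n) = cls m n ` carrier (tens m n)"
  unfolding cochains_quot by (rule quot_alg_carrier[OF ideal_ext_ideal])

lemma cochains_zero: "zero (heis_cochains m n) = cls m n 0"
proof -
  have "cls m n 0 = tens_ideal m n"
    using ring.a_rcos_zero[OF free_alg_ring ideal_ext_ideal ideal_zero[OF ideal_ext_ideal]] .
  then show ?thesis
    unfolding cochains_quot quot_alg_zero[OF ideal_ext_ideal] by (rule sym)
qed

lemma cls_hom: "cls m n \<in> ring_hom (tens m n) (heis_cochains m n)"
  unfolding cochains_quot by (rule quot_alg_hom[OF ideal_ext_ideal])

lemma cls_eq: "p \<in> carrier (tens m n) \<Longrightarrow> q \<in> carrier (tens m n) \<Longrightarrow> cls m n p = cls m n q \<longleftrightarrow> p - q \<in> tens_ideal m n"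
  by (rule coset_eq_iff[OF ideal_ext_ideal])

lemma ce_diff_cls:
  fixes p :: "hbasis list \<Rightarrow>\<^sub>0 'a::field_char_0"
  assumes p: "p \<in> carrier (tens m n)"
  shows "ce_diff (heis m n) (cls m n p) = cls m n (diff_tensor (heis m n) p)"
proof -
  note K = ideal_ext_ideal[of "hbasis_set m n" hpar, where 'b='a]
  have lin: "linmap (diff_tensor (heis m n :: ('a, _) sla))"
    unfolding diff_tensor_lin_ext by (rule linmap_lin_ext)
  have "cls m n (diff_tensor (heis m n) x) = cls m n (diff_tensor (heis m n) p)"
    if "x \<in> cls m n p" for x
    using coset_memD[OF K p that] p diff_tensor_ideal[of "x - p" m n]
    by (simp add: cls_eq diff_tensor_in linmap_diff[OF lin])
  then show ?thesis
    unfolding ce_diff_def heis_simps by (intro UN_constant_eq[OF coset_self[OF K p]]) blast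
qed

lemma xy_cls_hom: "xy_cls m n \<in> ring_hom (gtens m n) (heis_cochains m n)"
proof -
  have "embed \<in> ring_hom (gtens m n) (tens m n)"
    unfolding embed_def by (rule lift_ring_hom) (auto intro!: free_alg_gen simp: embed_letter_in)
  from ring_hom_trans[OF this cls_hom] show ?thesis
    by (simp add: xy_cls_def[abs_def] o_def)
qed

lemma cocycles_sel [simp]:
  "mult (cocycles L) = mult (cochains L)" "one (cocycles L) = one (cochains L)"
  "zero (cocycles L) = zero (cochains L)" "add (cocycles L) = add (cochains L)"
  "smult (cocycles L) = smult (cochains L)"
  "hcomp (cocycles L) k q = hcomp (cochains L) k q \<inter> carrier (cocycles L)"
  by (simp_all add: cocycles_def Let_def)

\<comment> \<open>The parameter \<open>F\<close> fixes the coefficient field for the whole block.\<close>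
context
  fixes m n :: nat and F :: "'a::field_char_0 itself"
  assumes n: "n \<ge> 1"
begin

lemma cocycle_iff_cls:
  fixes p :: "hbasis list \<Rightarrow>\<^sub>0 'a"
  assumes "p \<in> carrier (tens m n)"
  shows "cls m n p \<in> carrier (heis_cocycles m n) \<longleftrightarrow> cls m n p = xy_cls m n (kill_z p)"
  using assms cocycle_iff[OF n assms]
  by (simp add: cocycles_def Let_def ce_diff_cls cochains_zero cls_eq diff_tensor_in free_alg_zero_one
      xy_cls_def embed_in kill_z_in) (simp add: cochains_carrier)

lemma cocycles_carrier:
  "carrier (heis_cocycles m n) = xy_cls m n ` carrier (gtens m n :: ('a, _) gsalg)"
proof
  show "carrier (heis_cocycles m n) \<subseteq> xy_cls m n ` carrier (gtens m n :: ('a, _) gsalg)"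
  proof
    fix X assume X: "X \<in> carrier (heis_cocycles m n :: ('a, _) gsalg)"
    then have "X \<in> carrier (heis_cochains m n)" by (simp add: cocycles_def Let_def)
    then obtain p where "p \<in> carrier (tens m n)" "X = cls m n p" by (auto simp: cochains_carrier)
    then show "X \<in> xy_cls m n ` carrier (gtens m n)" using X by (simp add: cocycle_iff_cls kill_z_in)
  qed
  show "xy_cls m n ` carrier (gtens m n :: ('a, _) gsalg) \<subseteq> carrier (heis_cocycles m n)"
    by (auto simp: xy_cls_def cocycle_iff_cls embed_in kill_z_embed)
qed

lemma cocycles_ring: "ring (heis_cocycles m n :: ('a, _) gsalg)"
proof -
  interpret h: ring_hom_ring "gtens m n :: ('a, _) gsalg" "heis_cochains m n" "xy_cls m n"
    by (rule ring_hom_ringI2[OF free_alg_ring cochains_ring xy_cls_hom])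
  have "ring (heis_cochains m n\<lparr>carrier := xy_cls m n ` carrier (gtens m n :: ('a, _) gsalg)\<rparr>)"
    by (rule ring.subring_is_ring[OF cochains_ring h.img_is_subring[OF h.R.carrier_is_subring]])
  then show ?thesis by (rule ring_cong) (simp_all add: cocycles_carrier)
qed

lemma xy_cls_hom_cocycles: "xy_cls m n \<in> ring_hom (gtens m n) (heis_cocycles m n :: ('a, _) gsalg)"
  using xy_cls_hom[of m n, where 'a='a] by (simp add: Ring.ring_hom_def cocycles_carrier)

lemma xy_cls_eq:
  fixes q :: "ggen list \<Rightarrow>\<^sub>0 'a"
  shows "q \<in> carrier (gtens m n) \<Longrightarrow> q' \<in> carrier (gtens m n) \<Longrightarrow>
    xy_cls m n q = xy_cls m n q' \<longleftrightarrow> embed (q - q') \<in> tens_ideal m n"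
  by (simp add: xy_cls_def cls_eq embed_in linmap_diff[OF linmap_embed])

lemma coboundaries_eq:
  "heis_coboundaries m n = (\<lambda>q. xy_cls m n (omega_G m n * q)) ` carrier (gtens m n :: ('a, _) gsalg)"
proof
  show "heis_coboundaries m n \<subseteq> (\<lambda>q. xy_cls m n (omega_G m n * q)) ` carrier (gtens m n :: ('a, _) gsalg)"
  proof
    fix X assume "X \<in> (heis_coboundaries m n :: (hbasis list \<Rightarrow>\<^sub>0 'a) set set)"
    then obtain r where r: "r \<in> carrier (tens m n)" and X: "X = cls m n (diff_tensor (heis m n) r)"
      by (auto simp: heis_coboundaries_def cochains_carrier ce_diff_cls)
    obtain q where q: "q \<in> carrier (gtens m n)"
      "diff_tensor (heis m n) r - embed (omega_G m n * q) \<in> tens_ideal m n"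
      by (rule coboundary_form[OF r])
    then have "X = xy_cls m n (omega_G m n * q)"
      using r by (simp add: X xy_cls_def cls_eq diff_tensor_in embed_in free_alg_closed omega_G_in)
    with q(1) show "X \<in> (\<lambda>q. xy_cls m n (omega_G m n * q)) ` carrier (gtens m n)" by blast
  qed
  show "(\<lambda>q. xy_cls m n (omega_G m n * q)) ` carrier (gtens m n :: ('a, _) gsalg) \<subseteq> heis_coboundaries m n"
  proof
    fix X :: "(hbasis list \<Rightarrow>\<^sub>0 'a) set"
    assume "X \<in> (\<lambda>q. xy_cls m n (omega_G m n * q)) ` carrier (gtens m n)"
    then obtain q where q: "q \<in> carrier (gtens m n)" and X: "X = xy_cls m n (omega_G m n * q)" by blast
    have r: "gen Bz * embed q \<in> carrier (tens m n)"
      using q by (intro free_alg_closed free_alg_gen embed_in) (auto simp: hbasis_set_def)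
    have "X = ce_diff (heis m n) (cls m n (gen Bz * embed q))"
      using coboundary_of_z[OF q] r q
      by (simp add: X ce_diff_cls xy_cls_def cls_eq[symmetric] diff_tensor_in embed_in free_alg_closed omega_G_in)
    then show "X \<in> heis_coboundaries m n"
      using r by (auto simp: heis_coboundaries_def cochains_carrier)
  qed
qed

text \<open>
  The coboundaries are the multiples of the class of \<open>omega_G\<close>, which is central.
\<close>

lemma coboundaries_ideal: "ideal (heis_coboundaries m n) (heis_cocycles m n :: ('a, _) gsalg)"
proof -
  interpret h: ring_hom_ring "gtens m n :: ('a, _) gsalg" "heis_cocycles m n" "xy_cls m n"
    by (rule ring_hom_ringI2[OF free_alg_ring cocycles_ring xy_cls_hom_cocycles])
  let ?F = "gtens m n :: ('a, ggen list \<Rightarrow>\<^sub>0 'a) gsalg" and ?Z = "heis_cocycles m n :: ('a, _) gsalg"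
  let ?b = "\<lambda>q. xy_cls m n (omega_G m n * q) :: (hbasis list \<Rightarrow>\<^sub>0 'a) set"
  have c: "omega_G m n * q \<in> carrier ?F" if "q \<in> carrier ?F" for q
    using that by (simp add: free_alg_closed omega_G_in)
  have b: "?b q \<in> heis_coboundaries m n" if "q \<in> carrier ?F" for q
    using that by (auto simp: coboundaries_eq)
  have add: "xy_cls m n (p + q) = xy_cls m n p \<oplus>\<^bsub>?Z\<^esub> xy_cls m n q"
    and mult: "xy_cls m n (p * q) = xy_cls m n p \<otimes>\<^bsub>?Z\<^esub> xy_cls m n q"
    if "p \<in> carrier ?F" "q \<in> carrier ?F" for p q
    using h.hom_add[OF that] h.hom_mult[OF that] by simp_all
  show ?thesis
  proof (rule idealI[OF cocycles_ring])
    show "subgroup (heis_coboundaries m n) (add_monoid ?Z)"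
    proof (rule h.S.add.subgroupI)
      show "heis_coboundaries m n \<subseteq> carrier ?Z"
        using c by (auto simp: coboundaries_eq cocycles_carrier)
      show "heis_coboundaries m n \<noteq> ({} :: (hbasis list \<Rightarrow>\<^sub>0 'a) set set)"
        using b[OF free_alg_zero_one(1)] by blast
      show "\<ominus>\<^bsub>?Z\<^esub> X \<in> heis_coboundaries m n" if X: "X \<in> heis_coboundaries m n" for X
      proof -
        obtain q where q: "q \<in> carrier ?F" "X = ?b q" using X by (auto simp: coboundaries_eq)
        have "?b (- q) \<oplus>\<^bsub>?Z\<^esub> ?b q = xy_cls m n (omega_G m n * (- q) + omega_G m n * q)"
          using q by (intro add[symmetric] c free_alg_uminus)
        also have "\<dots> = \<zero>\<^bsub>?Z\<^esub>" using h.hom_zero by simp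
        finally have "\<ominus>\<^bsub>?Z\<^esub> X = ?b (- q)"
          using q by (intro h.S.minus_equality) (auto intro!: h.hom_closed c free_alg_uminus)
        then show ?thesis using b[OF free_alg_uminus[OF q(1)]] by (simp only:)
      qed
      show "X \<oplus>\<^bsub>?Z\<^esub> Y \<in> heis_coboundaries m n"
        if XY: "X \<in> heis_coboundaries m n" "Y \<in> heis_coboundaries m n" for X Y
      proof -
        obtain p q where q: "p \<in> carrier ?F" "X = ?b p" "q \<in> carrier ?F" "Y = ?b q"
          using XY by (auto simp: coboundaries_eq)
        have "X \<oplus>\<^bsub>?Z\<^esub> Y = ?b (p + q)"
          using q by (simp only: distrib_left add[OF c c])
        then show ?thesis using b free_alg_closed(1)[OF q(1,3)] by simp
      qed
    qed
    show "Y \<otimes>\<^bsub>?Z\<^esub> X \<in> heis_coboundaries m n" "X \<otimes>\<^bsub>?Z\<^esub> Y \<in> heis_coboundaries m n"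
      if XY: "X \<in> heis_coboundaries m n" "Y \<in> carrier ?Z" for X Y
    proof -
      obtain q r where q: "q \<in> carrier ?F" "X = ?b q" and r: "r \<in> carrier ?F" "Y = xy_cls m n r"
        using XY by (auto simp: coboundaries_eq cocycles_carrier)
      have "X \<otimes>\<^bsub>?Z\<^esub> Y = ?b (q * r)"
        using q r by (simp only: mult[OF c, symmetric] mult.assoc)
      then show "X \<otimes>\<^bsub>?Z\<^esub> Y \<in> heis_coboundaries m n" using b free_alg_closed(2)[OF q(1) r(1)] by simp
      have "xy_cls m n (r * omega_G m n) = xy_cls m n (omega_G m n * r)"
        using omega_central[OF r(1)] r(1) by (simp add: xy_cls_eq free_alg_closed omega_G_in)
      then have "Y \<otimes>\<^bsub>?Z\<^esub> xy_cls m n (omega_G m n) = xy_cls m n (omega_G m n) \<otimes>\<^bsub>?Z\<^esub> Y"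
        using r by (simp only: mult omega_G_in)
      then have "Y \<otimes>\<^bsub>?Z\<^esub> X = xy_cls m n (omega_G m n) \<otimes>\<^bsub>?Z\<^esub> (Y \<otimes>\<^bsub>?Z\<^esub> xy_cls m n q)"
        using q r by (simp only: mult omega_G_in h.S.m_assoc[symmetric] h.hom_closed)
      also have "\<dots> = ?b (r * q)"
        using q r by (simp only: mult[symmetric] omega_G_in free_alg_closed)
      finally show "Y \<otimes>\<^bsub>?Z\<^esub> X \<in> heis_coboundaries m n" using b free_alg_closed(2)[OF r(1) q(1)] by simp
    qed
  qed
qed

lemma cohomology_quot: "heis_cohomology m n = quot_alg (heis_cocycles m n) (heis_coboundaries m n)"
  by (simp add: cohomology_def heis_coboundaries_def)

lemma cohomology_ring: "ring (heis_cohomology m n :: ('a, _) gsalg)"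
  unfolding cohomology_quot by (rule quot_alg_ring[OF coboundaries_ideal])

lemma coho_cls_hom: "coho_cls m n \<in> ring_hom (gtens m n) (heis_cohomology m n :: ('a, _) gsalg)"
  using ring_hom_trans[OF xy_cls_hom_cocycles quot_alg_hom[OF coboundaries_ideal]]
  by (simp add: coho_cls_def[abs_def] o_def cohomology_quot)

lemma cohomology_carrier:
  "carrier (heis_cohomology m n) = coho_cls m n ` carrier (gtens m n :: ('a, _) gsalg)"
  using quot_alg_carrier[OF coboundaries_ideal]
  by (simp add: cohomology_quot cocycles_carrier image_image coho_cls_def del: quot_alg_sel)

lemma coho_cls_zero_iff:
  fixes q :: "ggen list \<Rightarrow>\<^sub>0 'a"
  assumes q: "q \<in> carrier (gtens m n)"
  shows "coho_cls m n q = \<zero>\<^bsub>heis_cohomology m n\<^esub> \<longleftrightarrow>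
    (\<exists>q'\<in>carrier (gtens m n). embed (q - omega_G m n * q') \<in> tens_ideal m n)"
proof -
  interpret h: ring_hom_ring "gtens m n :: ('a, _) gsalg" "heis_cocycles m n" "xy_cls m n"
    by (rule ring_hom_ringI2[OF free_alg_ring cocycles_ring xy_cls_hom_cocycles])
  have X: "xy_cls m n q \<in> carrier (heis_cocycles m n :: ('a, _) gsalg)"
    using q by (auto simp: cocycles_carrier)
  have "\<zero>\<^bsub>heis_cohomology m n\<^esub> = (heis_coboundaries m n :: (hbasis list \<Rightarrow>\<^sub>0 'a) set set)"
    unfolding cohomology_quot by (rule quot_alg_zero[OF coboundaries_ideal])
  then have "coho_cls m n q = \<zero>\<^bsub>heis_cohomology m n\<^esub> \<longleftrightarrow> xy_cls m n q \<in> heis_coboundaries m n"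
    using ring.a_rcos_zero[OF cocycles_ring coboundaries_ideal, of "xy_cls m n q"]
      coset_self[OF coboundaries_ideal X]
    by (auto simp: coho_cls_def)
  also have "\<dots> \<longleftrightarrow> (\<exists>q'\<in>carrier (gtens m n). embed (q - omega_G m n * q') \<in> tens_ideal m n)"
    using q by (auto simp: coboundaries_eq image_iff xy_cls_eq free_alg_closed omega_G_in)
  finally show ?thesis .
qed

text \<open>
  The kernel is an ideal.  It contains the (anti)commutation relations because they hold among
  cochains, and \<open>omega_G\<close> because its class is the coboundary of \<open>z\<close>.
\<close>

lemma coho_cls_kernel:
  "a_kernel (gtens m n) (heis_cohomology m n) (coho_cls m n) = (G_ideal m n :: (_ \<Rightarrow>\<^sub>0 'a) set)"
proof
  interpret g: ring_hom_ring "gtens m n :: ('a, _) gsalg" "heis_cohomology m n" "coho_cls m n"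
    by (rule ring_hom_ringI2[OF free_alg_ring cohomology_ring coho_cls_hom])
  let ?K = "a_kernel (gtens m n) (heis_cohomology m n) (coho_cls m n) :: (_ \<Rightarrow>\<^sub>0 'a) set"
  have K: "q \<in> ?K \<longleftrightarrow> q \<in> carrier (gtens m n) \<and>
      (\<exists>q'\<in>carrier (gtens m n). embed (q - omega_G m n * q') \<in> tens_ideal m n)" for q
    unfolding a_kernel_def' mem_Collect_eq by (rule conj_cong[OF refl coho_cls_zero_iff])
  show "?K \<subseteq> G_ideal m n"
    using K in_G_ideal by blast
  show "G_ideal m n \<subseteq> ?K"
  proof (rule ring.genideal_minimal[OF free_alg_ring g.kernel_is_ideal], rule subsetI)
    fix x :: "ggen list \<Rightarrow>\<^sub>0 'a" assume x: "x \<in> G_rels m n"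
    then have xF: "x \<in> carrier (gtens m n)" using G_rels_sub by blast
    have r: "gen (embed_letter a) * gen (embed_letter b) + scale (koszul (gpar a) (gpar b)) (gen (embed_letter b) * gen (embed_letter a))
        \<in> (tens_ideal m n :: (_ \<Rightarrow>\<^sub>0 'a) set)" if "a \<in> ggen_set m n" "b \<in> ggen_set m n" for a b
      using ext_ideal_letters[of "embed_letter a" "hbasis_set m n" "embed_letter b" hpar] that
      by (simp add: embed_letter_in gpar_embed_letter)
    have "embed x \<in> tens_ideal m n \<or> x = omega_G m n"
      using x unfolding G_rels_def
    proof (elim UnE)
      assume "x \<in> {gen (Xi i) * gen (Xi j) + gen (Xi j) * gen (Xi i) | i j. i \<in> {1..2 * m} \<and> j \<in> {1..2 * m}}"
      then obtain i j where ij: "i \<in> {1..2 * m}" "j \<in> {1..2 * m}"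
        and x: "x = gen (Xi i) * gen (Xi j) + gen (Xi j) * gen (Xi i)" by blast
      show ?thesis using r[of "Xi i" "Xi j"] ij
        by (simp add: x linmap_add[OF linmap_embed] embed_mult embed_gen ggen_set_def koszul_def gpar_def)
    next
      assume "x \<in> {gen (Xi i) * gen (Eta k) + gen (Eta k) * gen (Xi i) | i k. i \<in> {1..2 * m} \<and> k \<in> {1..n}}"
      then obtain i j where ij: "i \<in> {1..2 * m}" "j \<in> {1..n}"
        and x: "x = gen (Xi i) * gen (Eta j) + gen (Eta j) * gen (Xi i)" by blast
      show ?thesis using r[of "Xi i" "Eta j"] ij
        by (simp add: x linmap_add[OF linmap_embed] embed_mult embed_gen ggen_set_def koszul_def gpar_def)
    next
      assume "x \<in> {gen (Eta k) * gen (Eta s) - gen (Eta s) * gen (Eta k) | k s. k \<in> {1..n} \<and> s \<in> {1..n}}"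
      then obtain i j where ij: "i \<in> {1..n}" "j \<in> {1..n}"
        and x: "x = gen (Eta i) * gen (Eta j) - gen (Eta j) * gen (Eta i)" by blast
      show ?thesis using r[of "Eta i" "Eta j"] ij
        by (simp add: x linmap_diff[OF linmap_embed] embed_mult embed_gen ggen_set_def koszul_def gpar_def)
    qed (simp add: omega_G_def)
    then show "x \<in> ?K"
    proof
      assume "embed x \<in> tens_ideal m n"
      then show ?thesis using xF by (auto simp: K intro!: bexI[of _ 0] free_alg_zero_one)
    next
      assume "x = omega_G m n"
      then show ?thesis using xF
        by (auto simp: K linmap_zero[OF linmap_embed] ideal_zero[OF ideal_ext_ideal]
            intro!: bexI[of _ 1] free_alg_zero_one)
    qed
  qed
qed

lemma coho_cls_eq:
  fixes q :: "ggen list \<Rightarrow>\<^sub>0 'a"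
  assumes "q \<in> carrier (gtens m n)" "q' \<in> carrier (gtens m n)"
  shows "coho_cls m n q = coho_cls m n q' \<longleftrightarrow> q - q' \<in> G_ideal m n"
proof -
  interpret g: ring_hom_ring "gtens m n :: ('a, _) gsalg" "heis_cohomology m n" "coho_cls m n"
    by (rule ring_hom_ringI2[OF free_alg_ring cohomology_ring coho_cls_hom])
  have "coho_cls m n q = coho_cls m n q' \<longleftrightarrow> coho_cls m n (q - q') = \<zero>\<^bsub>heis_cohomology m n\<^esub>"
  proof -
    have "coho_cls m n (q - q') = coho_cls m n q \<ominus>\<^bsub>heis_cohomology m n\<^esub> coho_cls m n q'"
      unfolding free_alg_minus[OF assms, symmetric] a_minus_def
      using assms by (simp only: g.hom_add g.hom_a_inv g.R.a_inv_closed)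
    then show ?thesis using assms by (simp only: g.S.r_right_minus_eq g.hom_closed)
  qed
  also have "\<dots> \<longleftrightarrow> q - q' \<in> G_ideal m n"
    unfolding coho_cls_kernel[symmetric] a_kernel_def' mem_Collect_eq
    using free_alg_closed(3)[OF assms] by blast
  finally show ?thesis .
qed

lemma xy_cls_smult:
  fixes q :: "ggen list \<Rightarrow>\<^sub>0 'a"
  assumes q: "q \<in> carrier (gtens m n)"
  shows "c \<odot>\<^bsub>heis_cocycles m n\<^esub> xy_cls m n q = xy_cls m n (scale c q)"
  using presented_smult[OF ideal_ext_ideal embed_in[OF q]]
  by (simp add: xy_cls_def cochains_quot linmap_scale[OF linmap_embed])

lemma coho_cls_smult:
  fixes q :: "ggen list \<Rightarrow>\<^sub>0 'a"
  assumes q: "q \<in> carrier (gtens m n)"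
  shows "c \<odot>\<^bsub>heis_cohomology m n\<^esub> coho_cls m n q = coho_cls m n (scale c q)"
proof -
  let ?Z = "heis_cocycles m n :: ('a, _) gsalg" and ?B = "heis_coboundaries m n :: (hbasis list \<Rightarrow>\<^sub>0 'a) set set"
  have X: "xy_cls m n q \<in> carrier ?Z" using q by (auto simp: cocycles_carrier)
  have "?B +>\<^bsub>?Z\<^esub> (c \<odot>\<^bsub>?Z\<^esub> Y) = ?B +>\<^bsub>?Z\<^esub> (c \<odot>\<^bsub>?Z\<^esub> xy_cls m n q)"
    if Y: "Y \<in> carrier ?Z" and eq: "?B +>\<^bsub>?Z\<^esub> Y = ?B +>\<^bsub>?Z\<^esub> (xy_cls m n q)" for Y
  proof -
    obtain r where r: "r \<in> carrier (gtens m n)" "Y = xy_cls m n r" using Y by (auto simp: cocycles_carrier)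
    have "r - q \<in> G_ideal m n" using eq r q coho_cls_eq[of r q] by (simp add: coho_cls_def)
    then have "scale c r - scale c q \<in> G_ideal m n"
      using ideal_scale[OF ideal_G_ideal] by (metis scale_distrib(2))
    then have "coho_cls m n (scale c r) = coho_cls m n (scale c q)"
      using r q by (simp add: coho_cls_eq free_alg_scale)
    then show ?thesis by (simp add: r xy_cls_smult q coho_cls_def del: cocycles_sel)
  qed
  then have "c \<odot>\<^bsub>quot_alg ?Z ?B\<^esub> (?B +>\<^bsub>?Z\<^esub> xy_cls m n q) = ?B +>\<^bsub>?Z\<^esub> (c \<odot>\<^bsub>?Z\<^esub> xy_cls m n q)"
    by (rule quot_alg_smult[OF coboundaries_ideal X])
  then show ?thesis by (simp add: cohomology_quot coho_cls_def xy_cls_smult q del: cocycles_sel)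
qed

lemma coho_cls_hcomp:
  "hcomp (heis_cohomology m n) k p = coho_cls m n ` hcomp (gtens m n :: ('a, _) gsalg) k p"
proof -
  have "hcomp (heis_cocycles m n) k p = xy_cls m n ` hcomp (gtens m n :: ('a, _) gsalg) k p"
  proof
    show "hcomp (heis_cocycles m n) k p \<subseteq> xy_cls m n ` hcomp (gtens m n :: ('a, _) gsalg) k p"
    proof
      fix X assume "X \<in> hcomp (heis_cocycles m n :: ('a, _) gsalg) k p"
      then obtain r where r: "r \<in> hcomp (tens m n) k p" "X = cls m n r" "X \<in> carrier (heis_cocycles m n)"
        by (auto simp: cochains_quot)
      then have "X = xy_cls m n (kill_z r)"
        using cocycle_iff_cls[OF hcomp_free_alg_carrier[OF r(1)]] by simp
      then show "X \<in> xy_cls m n ` hcomp (gtens m n :: ('a, _) gsalg) k p" using kill_z_hcomp[OF r(1)] by blast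
    qed
    show "xy_cls m n ` hcomp (gtens m n :: ('a, _) gsalg) k p \<subseteq> hcomp (heis_cocycles m n) k p"
      using embed_hcomp hcomp_free_alg_carrier by (fastforce simp: cochains_quot xy_cls_def cocycles_carrier)
  qed
  then show ?thesis
    unfolding cohomology_quot quot_alg_sel by (simp add: image_image coho_cls_def del: cocycles_sel)
qed

lemma G_alg_quot: "G_alg m n = quot_alg (gtens m n) (G_ideal m n)"
proof -
  have "(\<lambda>g. case g of Xi _ \<Rightarrow> 0 | Eta _ \<Rightarrow> 1) = gpar" by (simp add: fun_eq_iff gpar_def)
  then show ?thesis by (simp add: G_alg_def presented_alg_def ggen_set_def)
qed

text \<open>
  The homomorphism theorem for \<open>coho_cls m n\<close>.  The inverse \<open>f\<close> of the induced map sends the class of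
  \<open>q\<close> to the coset of \<open>q\<close>; scalars and gradings are compared on such representatives.
\<close>

theorem cohomology_iso: "gsalg_iso (heis_cohomology m n :: ('a, _) gsalg) (G_alg m n)"
proof -
  let ?F = "gtens m n :: ('a, ggen list \<Rightarrow>\<^sub>0 'a) gsalg" and ?H = "heis_cohomology m n :: ('a, _) gsalg"
  let ?I = "G_ideal m n :: (ggen list \<Rightarrow>\<^sub>0 'a) set" and ?g = "coho_cls m n :: _ \<Rightarrow> (hbasis list \<Rightarrow>\<^sub>0 'a) set set"
  interpret g: ring_hom_ring ?F ?H ?g
    by (rule ring_hom_ringI2[OF free_alg_ring cohomology_ring coho_cls_hom])
  define \<phi> where "\<phi> X = the_elem (?g ` X)" for X
  have \<phi>: "\<phi> \<in> ring_iso (?F Quot ?I) ?H"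
    using g.FactRing_iso_set[OF cohomology_carrier[symmetric]] by (simp add: \<phi>_def[abs_def] coho_cls_kernel)
  have \<phi>_coset: "\<phi> (?I +>\<^bsub>?F\<^esub> q) = ?g q" if "q \<in> carrier ?F" for q
    using g.the_elem_simp[OF that] by (simp add: \<phi>_def coho_cls_kernel)
  define f where "f = inv_into (carrier (?F Quot ?I)) \<phi>"
  have f: "f \<in> ring_iso ?H (?F Quot ?I)"
    unfolding f_def by (rule ring_iso_set_sym[OF ideal.quotient_is_ring[OF ideal_G_ideal] \<phi>])
  have f_cls: "f (?g q) = ?I +>\<^bsub>?F\<^esub> q" if "q \<in> carrier ?F" for q
  proof -
    have "inj_on \<phi> (carrier (?F Quot ?I))" using \<phi> by (auto simp: ring_iso_def bij_betw_def)
    moreover have "?I +>\<^bsub>?F\<^esub> q \<in> carrier (?F Quot ?I)"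
      unfolding quot_alg_sel(1)[symmetric] quot_alg_carrier[OF ideal_G_ideal]
      using that by (rule imageI)
    ultimately show ?thesis unfolding f_def \<phi>_coset[OF that, symmetric] by (rule inv_into_f_f)
  qed
  show ?thesis
    unfolding gsalg_iso_def G_alg_quot
  proof (intro bexI[of _ f] conjI allI ballI)
    show "f \<in> ring_iso ?H (quot_alg ?F ?I)" using f by (simp add: ring_iso_def Ring.ring_hom_def)
    show "f (c \<odot>\<^bsub>?H\<^esub> x) = c \<odot>\<^bsub>quot_alg ?F ?I\<^esub> f x" if x: "x \<in> carrier ?H" for c x
    proof -
      obtain q where q: "q \<in> carrier ?F" "x = ?g q" using x by (auto simp: cohomology_carrier)
      have "f (c \<odot>\<^bsub>?H\<^esub> x) = ?I +>\<^bsub>?F\<^esub> (scale c q)"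
        unfolding q(2) coho_cls_smult[OF q(1)] by (rule f_cls[OF free_alg_scale[OF q(1)]])
      also have "\<dots> = c \<odot>\<^bsub>quot_alg ?F ?I\<^esub> (?I +>\<^bsub>?F\<^esub> q)"
        by (rule presented_smult[OF ideal_G_ideal q(1), symmetric])
      finally show ?thesis unfolding q(2) f_cls[OF q(1)] .
    qed
    show "f ` hcomp ?H k p = hcomp (quot_alg ?F ?I) k p" for k p
      unfolding coho_cls_hcomp quot_alg_sel image_image
      by (rule image_cong[OF refl f_cls[OF hcomp_free_alg_carrier]])
  qed
qed

end

section \<open>Counting monomials\<close>

text \<open>
  Here \<open>E\<close> are the even letters, which square to 0, and \<open>U\<close> the odd ones.
\<close>

definition monomials :: "'b set \<Rightarrow> 'b set \<Rightarrow> nat \<Rightarrow> 'b multiset set" where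
  "monomials E U k = {M. set_mset M \<subseteq> E \<union> U \<and> (\<forall>e\<in>E. count M e \<le> 1) \<and> size M = k}"

lemma finite_monomials: "finite E \<Longrightarrow> finite U \<Longrightarrow> finite (monomials E U k)"
proof (rule finite_subset)
  show "monomials E U k \<subseteq> mset ` {xs. set xs \<subseteq> E \<union> U \<and> length xs = k}"
  proof
    fix M assume M: "M \<in> monomials E U k"
    obtain xs where "mset xs = M" using ex_mset by blast
    then show "M \<in> mset ` {xs. set xs \<subseteq> E \<union> U \<and> length xs = k}"
      using M by (auto simp: monomials_def intro!: image_eqI[of _ _ xs])
  qed
qed (simp add: finite_lists_length_eq)

lemma monomials_0: "monomials E U 0 = {{#}}"
  by (auto simp: monomials_def)

text \<open>
  The two splitting lemmas separate the monomials without the new letter from the others, and divide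
  the latter by that letter.  They turn into Pascal's rule.
\<close>

lemma monomials_insert_even:
  assumes "e \<notin> E" "e \<notin> U"
  shows "monomials (insert e E) U (Suc k) = monomials E U (Suc k) \<union> add_mset e ` monomials E U k"
proof (intro Set.set_eqI iffI)
  fix M assume M: "M \<in> monomials (insert e E) U (Suc k)"
  show "M \<in> monomials E U (Suc k) \<union> add_mset e ` monomials E U k"
  proof (cases "e \<in># M")
    case True
    then obtain N where N: "M = add_mset e N" by (metis insert_DiffM)
    have "count N e = 0" using M by (simp add: monomials_def N)
    then have "N \<in> monomials E U k"
      using M assms by (auto simp: monomials_def N not_in_iff[symmetric] split: if_splits)
    then show ?thesis by (simp add: N)
  next
    case False
    then show ?thesis using M by (auto simp: monomials_def)
  qed
next
  fix M assume M: "M \<in> monomials E U (Suc k) \<union> add_mset e ` monomials E U k"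
  have "count N e = 0" if "N \<in> monomials E U j" for N j
    using that assms by (auto simp: monomials_def simp flip: not_in_iff)
  then show "M \<in> monomials (insert e E) U (Suc k)"
    using M assms by (auto simp: monomials_def)
qed

lemma monomials_insert_odd:
  assumes "y \<notin> U"
  shows "monomials {} (insert y U) (Suc k) = monomials {} U (Suc k) \<union> add_mset y ` monomials {} (insert y U) k"
proof (intro Set.set_eqI iffI)
  fix M assume M: "M \<in> monomials {} (insert y U) (Suc k)"
  show "M \<in> monomials {} U (Suc k) \<union> add_mset y ` monomials {} (insert y U) k"
  proof (cases "y \<in># M")
    case True
    then obtain N where N: "M = add_mset y N" by (metis insert_DiffM)
    then show ?thesis using M by (auto simp: monomials_def)
  next
    case False
    then show ?thesis using M by (auto simp: monomials_def)
  qed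
qed (auto simp: monomials_def)

lemma card_monomials_odd:
  "finite U \<Longrightarrow> card (monomials {} U k) = (card U + k - 1) choose k"
proof (induction U arbitrary: k rule: finite_induct)
  case empty
  show ?case
  proof (cases k)
    case (Suc j)
    have "monomials {} {} k = ({} :: 'a multiset set)" by (auto simp: monomials_def Suc)
    then show ?thesis by (simp add: Suc)
  qed (simp add: monomials_0)
next
  case (insert y U)
  show ?case
  proof (induction k)
    case 0
    show ?case by (simp add: monomials_0)
  next
    case (Suc k)
    have "card (monomials {} (insert y U) (Suc k)) =
      card (monomials {} U (Suc k)) + card (add_mset y ` monomials {} (insert y U) k)"
      unfolding monomials_insert_odd[OF insert(2)]
    proof (rule card_Un_disjoint)
      show "monomials {} U (Suc k) \<inter> add_mset y ` monomials {} (insert y U) k = {}"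
        using insert(2) by (auto simp: monomials_def)
    qed (simp_all add: insert(1) finite_monomials)
    also have "card (add_mset y ` monomials {} (insert y U) k) = card (monomials {} (insert y U) k)"
      by (rule card_image) (simp add: inj_on_def)
    finally show ?case using Suc insert by simp
  qed
qed

lemma card_monomials:
  assumes "finite E" "finite U" "E \<inter> U = {}"
  shows "card (monomials E U k) = (\<Sum>i = 0..k. (card E choose (k - i)) * ((card U + i - 1) choose i))"
  using assms
proof (induction E arbitrary: k rule: finite_induct)
  case empty
  have "(\<Sum>i = 0..k. (card ({} :: 'a set) choose (k - i)) * ((card U + i - 1) choose i)) =
    (\<Sum>i = 0..k. if i = k then (card U + k - 1) choose k else 0)"
    by (intro sum.cong) auto
  then show ?case using empty by (simp add: card_monomials_odd)
next
  case (insert e E)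
  then have dis: "e \<notin> U" "E \<inter> U = {}" by auto
  show ?case
  proof (cases k)
    case 0
    then show ?thesis by (simp add: monomials_0)
  next
    case (Suc j)
    let ?c = "\<lambda>i. (card U + i - 1) choose i"
    have "card (monomials (insert e E) U (Suc j)) =
      card (monomials E U (Suc j)) + card (add_mset e ` monomials E U j)"
      unfolding monomials_insert_even[OF insert(2) dis(1)]
    proof (rule card_Un_disjoint)
      show "monomials E U (Suc j) \<inter> add_mset e ` monomials E U j = {}"
        using insert(2) dis by (auto simp: monomials_def)
    qed (use insert in \<open>simp_all add: finite_monomials\<close>)
    also have "card (add_mset e ` monomials E U j) = card (monomials E U j)"
      by (rule card_image) (simp add: inj_on_def)
    also have "card (monomials E U (Suc j)) + card (monomials E U j) =
      (\<Sum>i = 0..j. (card E choose (Suc j - i)) * ?c i + (card E choose (j - i)) * ?c i) + ?c (Suc j)"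
      using insert.IH insert.prems dis by (simp add: sum.distrib)
    also have "\<dots> = (\<Sum>i = 0..j. (card (insert e E) choose (Suc j - i)) * ?c i) + ?c (Suc j)"
      using insert by (simp add: Suc_diff_le algebra_simps)
    finally show ?thesis by (simp add: Suc)
  qed
qed

text \<open>
  Multiplication by \<open>y\<^sup>2\<close> maps the monomials of degree \<open>k - 2\<close> bijectively to the monomials of
  degree \<open>k\<close> that are divisible by \<open>y\<^sup>2\<close>.
\<close>

lemma card_monomials_low:
  assumes "finite E" "finite U" "E \<inter> U = {}" "y \<in> U"
  shows "int (card {M \<in> monomials E U k. count M y \<le> 1}) =
    frakd (int k) (card E) (card U) - frakd (int k - 2) (card E) (card U)"
proof -
  have d: "int (card (monomials E U j)) = frakd (int j) (card E) (card U)" for j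
    by (simp add: card_monomials[OF assms(1-3)] frakd_def)
  show ?thesis
  proof (cases "k \<ge> 2")
    case False
    have "count M y \<le> 1" if "M \<in> monomials E U k" for M
    proof -
      have "count M y \<le> size M" by (rule count_le_size)
      then show ?thesis using that False by (simp add: monomials_def)
    qed
    then have "{M \<in> monomials E U k. count M y \<le> 1} = monomials E U k" by auto
    then show ?thesis using False by (simp add: d) (simp add: frakd_def)
  next
    case True
    define j where "j = k - 2"
    have k: "k = Suc (Suc j)" using True by (simp add: j_def)
    have y: "y \<notin> E" using assms by auto
    have "monomials E U k = {M \<in> monomials E U k. count M y \<le> 1} \<union> (\<lambda>M. add_mset y (add_mset y M)) ` monomials E U j"
      (is "_ = ?L \<union> ?R")
    proof (intro Set.set_eqI iffI)
      fix M assume M: "M \<in> monomials E U k"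
      show "M \<in> ?L \<union> ?R"
      proof (cases "count M y \<le> 1")
        case False
        define N where "N = M - {#y, y#}"
        have N: "M = add_mset y (add_mset y N)"
          using False by (intro multiset_eqI) (auto simp: N_def)
        have "N \<in> monomials E U j" using M y by (auto simp: monomials_def k N split: if_splits)
        then show ?thesis using N by auto
      qed (use M in simp)
    next
      fix M assume "M \<in> ?L \<union> ?R"
      then show "M \<in> monomials E U k" using y assms(4) by (auto simp: monomials_def k)
    qed
    moreover have "?L \<inter> ?R = {}" by auto
    moreover have "finite ?L" "finite ?R" using finite_monomials[OF assms(1,2)] by auto
    ultimately have "card (monomials E U k) = card ?L + card ?R" by (metis card_Un_disjoint)
    also have "card ?R = card (monomials E U j)" by (rule card_image) (simp add: inj_on_def)
    finally have "int (card ?L) = int (card (monomials E U k)) - int (card (monomials E U j))" by simp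
    then show ?thesis by (simp add: d k)
  qed
qed

section \<open>Dimension by coordinates\<close>

lemma dim_by_coordinates:
  fixes V :: "('a::field, 'v, 'x) module_scheme"
  assumes V: "vectorspace class_ring V"
    and add: "\<And>u v. u \<in> carrier_vec N \<Longrightarrow> v \<in> carrier_vec N \<Longrightarrow> T (u + v) = T u \<oplus>\<^bsub>V\<^esub> T v"
    and smult: "\<And>c v. v \<in> carrier_vec N \<Longrightarrow> T (c \<cdot>\<^sub>v v) = c \<odot>\<^bsub>V\<^esub> T v"
    and ker: "\<And>v. v \<in> carrier_vec N \<Longrightarrow> T v = \<zero>\<^bsub>V\<^esub> \<Longrightarrow> v = 0\<^sub>v N"
    and im: "T ` carrier_vec N = carrier V"
  shows "vectorspace.fin_dim class_ring V" "vectorspace.dim class_ring V = N"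
proof -
  interpret V: vectorspace class_ring V by (rule V)
  let ?U = "module_vec TYPE('a) N"
  have U: "vectorspace class_ring ?U" by (rule vec_vs)
  interpret T: linear_map class_ring ?U V T
  proof (intro linear_map.intro U V mod_hom.intro mod_hom_axioms.intro)
    show "Module.module class_ring ?U" "Module.module class_ring V"
      using U V by (auto simp: vectorspace_def)
    show "T \<in> LinearCombinations.module_hom class_ring ?U V"
      using add smult im by (auto simp: LinearCombinations.module_hom_def module_vec_simps)
  qed
  have inj: "inj_on T (carrier ?U)"
  proof (rule T.Ke0_imp_inj)
    have "T (0\<^sub>v N) = \<zero>\<^bsub>V\<^esub>" using T.f0_is_0 by (simp add: module_vec_simps)
    then show "carrier (?U\<lparr>carrier := mod_hom.ker ?U V T\<rparr>) = {\<zero>\<^bsub>?U\<^esub>}"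
      using ker by (auto simp: T.ker_def module_vec_simps)
  qed
  have surj: "T ` carrier ?U = carrier V" using im by (simp add: module_vec_simps)
  have fd: "vectorspace.fin_dim class_ring ?U" by (rule vec_space.fin_dim)
  show "vectorspace.fin_dim class_ring V" by (rule T.surj_fin_dim[OF fd surj])
  show "vectorspace.dim class_ring V = N"
    using T.dim_eq[OF fd inj surj] vec_space.dim_is_n[where n = N and 'a = 'a] by simp
qed

section \<open>The homogeneous components of the cohomology\<close>

definition word_of :: "'b multiset \<Rightarrow> 'b list" where
  "word_of M = (SOME w. mset w = M)"

lemma mset_word_of: "mset (word_of M) = M"
  unfolding word_of_def by (rule someI_ex[OF ex_mset])

definition words_of_length :: "nat \<Rightarrow> nat \<Rightarrow> nat \<Rightarrow> (ggen list \<Rightarrow>\<^sub>0 'a::field) set" where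
  "words_of_length m n k =
    {q \<in> carrier (gtens m n). \<forall>w\<in>Poly_Mapping.keys q. length w = k}"

lemma words_of_length_closed:
  "p \<in> words_of_length m n k \<Longrightarrow> q \<in> words_of_length m n k \<Longrightarrow> p + q \<in> words_of_length m n k"
  "p \<in> words_of_length m n k \<Longrightarrow> scale c p \<in> words_of_length m n k"
  "0 \<in> words_of_length m n k"
  using Poly_Mapping.keys_add[of p q] keys_scale[of c p]
  by (auto simp: words_of_length_def free_alg_closed free_alg_scale free_alg_zero_one)

lemma words_of_length_split:
  fixes q :: "ggen list \<Rightarrow>\<^sub>0 'a::field"
  assumes q: "q \<in> words_of_length m n k"
  obtains q0 q1 where "q0 \<in> hcomp (gtens m n) (int k) 0" "q1 \<in> hcomp (gtens m n) (int k) 1" "q = q0 + q1"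
proof
  define part where "part p = lin_ext (\<lambda>w. if sum_list (map gpar w) = p then mon w else 0 :: ggen list \<Rightarrow>\<^sub>0 'a)" for p
  have lin: "linmap (part p)" for p unfolding part_def by (rule linmap_lin_ext)
  have h: "part p q \<in> hcomp (gtens m n) (int k) p" for p
    unfolding in_hcomp_free_alg
  proof
    fix w assume "w \<in> Poly_Mapping.keys (part p q)"
    from keys_linmap[OF lin this] obtain u
      where "u \<in> Poly_Mapping.keys q" "w \<in> Poly_Mapping.keys (part p (mon u))" ..
    then show "set w \<subseteq> ggen_set m n \<and> int (length w) = int k \<and> sum_list (map gpar w) = p"
      using q by (auto simp: words_of_length_def in_free_alg part_def split: if_splits)
  qed
  show "part 0 q \<in> hcomp (gtens m n) (int k) 0" "part 1 q \<in> hcomp (gtens m n) (int k) 1" by (rule h)+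
  show "q = part 0 q + part 1 q"
  proof (rule linmap_eqI[where p = q, OF linmap_id linmap_plus[OF lin lin]])
    show "mon w = part 0 (mon w) + part 1 (mon w)" for w
      by (cases "sum_list (map gpar w)") (simp_all add: part_def)
  qed
qed

lemma hcomp_words_of_length: "hcomp (gtens m n) (int k) p \<subseteq> words_of_length m n k"
  by (fastforce simp: words_of_length_def in_hcomp_free_alg in_free_alg)

\<comment> \<open>The parameter \<open>F\<close> fixes the coefficient field for the whole block.\<close>
context
  fixes m n :: nat and F :: "'a::field_char_0 itself"
  assumes n: "n \<ge> 1"
begin

abbreviation "cohom \<equiv> heis_cohomology m n :: ('a, (hbasis list \<Rightarrow>\<^sub>0 'a) set set) gsalg"
abbreviation "cclass \<equiv> coho_cls m n :: (ggen list \<Rightarrow>\<^sub>0 'a) \<Rightarrow> (hbasis list \<Rightarrow>\<^sub>0 'a) set set"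

lemma cclass_hom: "ring_hom_ring (gtens m n) cohom cclass"
  by (rule ring_hom_ringI2[OF free_alg_ring cohomology_ring[OF n] coho_cls_hom[OF n]])

lemma cclass_add: "p \<in> carrier (gtens m n) \<Longrightarrow> q \<in> carrier (gtens m n) \<Longrightarrow> cclass (p + q) = cclass p \<oplus>\<^bsub>cohom\<^esub> cclass q"
  using ring_hom_add[OF coho_cls_hom[OF n]] by simp

lemma cclass_zero: "cclass 0 = \<zero>\<^bsub>cohom\<^esub>"
proof -
  interpret g: ring_hom_ring "gtens m n :: ('a, _) gsalg" cohom cclass by (rule cclass_hom)
  show ?thesis using g.hom_zero by simp
qed

lemma degree_part_carrier: "carrier (degree_part cohom (int k)) = cclass ` words_of_length m n k"
proof
  show "carrier (degree_part cohom (int k)) \<subseteq> cclass ` words_of_length m n k"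
  proof
    fix X assume "X \<in> carrier (degree_part cohom (int k))"
    then obtain p q where p: "p \<in> hcomp (gtens m n) (int k) 0" and q: "q \<in> hcomp (gtens m n) (int k) 1"
      and X: "X = cclass p \<oplus>\<^bsub>cohom\<^esub> cclass q"
      by (auto simp: degree_part_def set_add_def' coho_cls_hcomp[OF n])
    have "X = cclass (p + q)"
      unfolding X by (rule cclass_add[symmetric]) (rule hcomp_free_alg_carrier, rule p q)+
    moreover have "p + q \<in> words_of_length m n k"
      using p q hcomp_words_of_length by (intro words_of_length_closed) blast+
    ultimately show "X \<in> cclass ` words_of_length m n k" by blast
  qed
  show "cclass ` words_of_length m n k \<subseteq> carrier (degree_part cohom (int k))"
  proof
    fix X assume "X \<in> cclass ` words_of_length m n k"
    then obtain q where q: "q \<in> words_of_length m n k" and X: "X = cclass q" by blast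
    obtain q0 q1 where s: "q0 \<in> hcomp (gtens m n) (int k) 0" "q1 \<in> hcomp (gtens m n) (int k) 1" "q = q0 + q1"
      by (rule words_of_length_split[OF q])
    then have "X = cclass q0 \<oplus>\<^bsub>cohom\<^esub> cclass q1"
      unfolding X s(3) by (intro cclass_add hcomp_free_alg_carrier)
    then show "X \<in> carrier (degree_part cohom (int k))"
      using s(1,2) unfolding degree_part_def set_add_def' coho_cls_hcomp[OF n] by auto
  qed
qed

lemma degree_part_sel:
  "zero (degree_part cohom k) = \<zero>\<^bsub>cohom\<^esub>" "add (degree_part cohom k) = add cohom" "smult (degree_part cohom k) = smult cohom"
  by (simp_all add: degree_part_def)

lemma degree_part_vectorspace: "vectorspace class_ring (degree_part cohom (int k))"
proof (intro vectorspace.intro class_field module_criteria)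
  let ?V = "degree_part cohom (int k)" and ?W = "words_of_length m n k :: (ggen list \<Rightarrow>\<^sub>0 'a) set"
  interpret g: ring_hom_ring "gtens m n :: ('a, _) gsalg" cohom cclass by (rule cclass_hom)
  have W: "q \<in> ?W \<Longrightarrow> q \<in> carrier (gtens m n)" for q by (simp add: words_of_length_def)
  have VH: "X \<in> carrier ?V \<Longrightarrow> X \<in> carrier cohom" for X
    using g.hom_closed W by (auto simp: degree_part_carrier)
  have sm: "c \<odot>\<^bsub>cohom\<^esub> cclass q = cclass (scale c q)" if "q \<in> ?W" for c q
    by (rule coho_cls_smult[OF n W[OF that]])
  show "cring (class_ring :: 'a ring)" by (rule class_cring.cring_axioms)
  show "\<zero>\<^bsub>?V\<^esub> \<in> carrier ?V"
    unfolding degree_part_sel degree_part_carrier cclass_zero[symmetric] by (rule imageI[OF words_of_length_closed(3)])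
  show "\<forall>v w. v \<in> carrier ?V \<and> w \<in> carrier ?V \<longrightarrow> v \<oplus>\<^bsub>?V\<^esub> w \<in> carrier ?V"
    unfolding degree_part_sel degree_part_carrier
    by (auto simp: W cclass_add[symmetric] intro!: imageI words_of_length_closed)
  show "\<forall>v\<in>carrier ?V. \<exists>neg_v\<in>carrier ?V. v \<oplus>\<^bsub>?V\<^esub> neg_v = \<zero>\<^bsub>?V\<^esub>"
  proof
    fix v assume "v \<in> carrier ?V"
    then obtain q where q: "q \<in> ?W" "v = cclass q" by (auto simp: degree_part_carrier)
    have q': "scale (- 1) q \<in> ?W" by (rule words_of_length_closed(2)[OF q(1)])
    have "v \<oplus>\<^bsub>cohom\<^esub> cclass (scale (- 1) q) = cclass (q + scale (- 1) q)"
      unfolding q(2) by (rule cclass_add[OF W[OF q(1)] W[OF q'], symmetric])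
    also have "\<dots> = \<zero>\<^bsub>cohom\<^esub>" using cclass_zero by simp
    finally show "\<exists>neg_v\<in>carrier ?V. v \<oplus>\<^bsub>?V\<^esub> neg_v = \<zero>\<^bsub>?V\<^esub>"
      unfolding degree_part_sel degree_part_carrier using q' by blast
  qed
  show "\<forall>c v. c \<in> carrier class_ring \<and> v \<in> carrier ?V \<longrightarrow> c \<odot>\<^bsub>?V\<^esub> v \<in> carrier ?V"
    unfolding degree_part_sel degree_part_carrier
    by (auto simp: sm intro!: imageI words_of_length_closed)
  show "\<forall>v w. v \<in> carrier ?V \<and> w \<in> carrier ?V \<longrightarrow> v \<oplus>\<^bsub>?V\<^esub> w = w \<oplus>\<^bsub>?V\<^esub> v"
    unfolding degree_part_sel using VH g.S.a_comm by blast
  show "\<forall>v w x. v \<in> carrier ?V \<and> w \<in> carrier ?V \<and> x \<in> carrier ?V \<longrightarrow>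
      v \<oplus>\<^bsub>?V\<^esub> w \<oplus>\<^bsub>?V\<^esub> x = v \<oplus>\<^bsub>?V\<^esub> (w \<oplus>\<^bsub>?V\<^esub> x)"
    unfolding degree_part_sel using VH g.S.a_assoc by blast
  show "\<forall>v\<in>carrier ?V. v \<oplus>\<^bsub>?V\<^esub> \<zero>\<^bsub>?V\<^esub> = v"
    unfolding degree_part_sel using VH g.S.r_zero by blast
  show "\<forall>a b v. a \<in> carrier class_ring \<and> b \<in> carrier class_ring \<and> v \<in> carrier ?V \<longrightarrow>
      (a \<otimes>\<^bsub>class_ring\<^esub> b) \<odot>\<^bsub>?V\<^esub> v = a \<odot>\<^bsub>?V\<^esub> (b \<odot>\<^bsub>?V\<^esub> v)"
    unfolding degree_part_sel degree_part_carrier by (auto simp: sm words_of_length_closed)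
  show "\<forall>v\<in>carrier ?V. \<one>\<^bsub>class_ring\<^esub> \<odot>\<^bsub>?V\<^esub> v = v"
    unfolding degree_part_sel degree_part_carrier by (auto simp: sm)
  show "\<forall>a b v. a \<in> carrier class_ring \<and> b \<in> carrier class_ring \<and> v \<in> carrier ?V \<longrightarrow>
      (a \<oplus>\<^bsub>class_ring\<^esub> b) \<odot>\<^bsub>?V\<^esub> v = a \<odot>\<^bsub>?V\<^esub> v \<oplus>\<^bsub>?V\<^esub> b \<odot>\<^bsub>?V\<^esub> v"
    unfolding degree_part_sel degree_part_carrier
    by (auto simp: sm scale_distrib cclass_add W words_of_length_closed)
  show "\<forall>a v w. a \<in> carrier class_ring \<and> v \<in> carrier ?V \<and> w \<in> carrier ?V \<longrightarrow>
      a \<odot>\<^bsub>?V\<^esub> (v \<oplus>\<^bsub>?V\<^esub> w) = a \<odot>\<^bsub>?V\<^esub> v \<oplus>\<^bsub>?V\<^esub> a \<odot>\<^bsub>?V\<^esub> w"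
    unfolding degree_part_sel degree_part_carrier
    by (auto simp: sm scale_distrib cclass_add[symmetric] W words_of_length_closed)
qed

section \<open>A monomial basis\<close>

lemma embed_letter_inj: "embed_letter a = embed_letter b \<Longrightarrow> a = b"
  by (cases a; cases b) auto

lemma count_image_embed_letter: "count (image_mset embed_letter M) (embed_letter a) = count M a"
  by (induction M) (auto dest: embed_letter_inj)

lemma image_embed_letter_inj: "image_mset embed_letter M = image_mset embed_letter N \<longleftrightarrow> M = N"
proof
  assume "image_mset embed_letter M = image_mset embed_letter N"
  then have "count (image_mset embed_letter M) (embed_letter a) = count (image_mset embed_letter N) (embed_letter a)" for a by simp
  then show "M = N" by (intro multiset_eqI) (simp only: count_image_embed_letter)
qed simp

lemma normal_embed_letter: "normal hpar (image_mset embed_letter M) \<longleftrightarrow> normal gpar M"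
proof
  assume h: "normal hpar (image_mset embed_letter M)"
  have "count M a \<le> 1" if "gpar a = 0" for a
    using h that count_image_embed_letter[of M a] by (metis normal_def gpar_embed_letter)
  then show "normal gpar M" by (simp add: normal_def)
next
  assume h: "normal gpar M"
  have "count (image_mset embed_letter M) b \<le> 1" if "hpar b = 0" for b
  proof (cases "b \<in> range embed_letter")
    case True
    then obtain a where a: "b = embed_letter a" by blast
    then show ?thesis using h that by (simp add: normal_def gpar_embed_letter count_image_embed_letter)
  next
    case False
    then have "count (image_mset embed_letter M) b = 0" by (intro not_in_iff[THEN iffD1]) auto
    then show ?thesis by simp
  qed
  then show "normal hpar (image_mset embed_letter M)" by (simp add: normal_def)
qed

lemma nf_embed_single:
  "nf hpar (embed (Poly_Mapping.single w c)) =
    Poly_Mapping.single (image_mset embed_letter (mset w)) (c * word_sign hpar (map embed_letter w))"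
proof -
  have "nf hpar (embed (scale c (mon w))) =
      scale c (Poly_Mapping.single (image_mset embed_letter (mset w)) (word_sign hpar (map embed_letter w)))"
    unfolding linmap_scale[OF linmap_embed] linmap_scale[OF linmap_nf] embed_mon nf_mon by simp
  then show ?thesis by simp
qed

lemma word_sign_embed_letter: "word_sign hpar (map embed_letter w) \<noteq> (0::'b::field) \<longleftrightarrow> normal gpar (mset w)"
  by (simp add: word_sign_neq_0 normal_embed_letter)

lemma in_G_ideal_nf:
  assumes "q \<in> carrier (gtens m n)" "nf hpar (embed q) = (0 :: _ \<Rightarrow>\<^sub>0 'a)"
  shows "q \<in> G_ideal m n"
proof (rule in_G_ideal)
  show "0 \<in> carrier (gtens m n :: ('a, _) gsalg)" by (rule free_alg_zero_one)
  show "embed (q - omega_G m n * 0) \<in> tens_ideal m n"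
    using assms by (simp add: ext_ideal_iff embed_in)
qed

text \<open>
  Two arrangements of the same normal monomial differ by a sign only.
\<close>

lemma same_monomial:
  assumes w: "set w \<subseteq> ggen_set m n" and u: "mset u = mset w" and norm: "normal gpar (mset w)"
  obtains c where "mon w - scale c (mon u) \<in> (G_ideal m n :: (_ \<Rightarrow>\<^sub>0 'a) set)"
proof
  let ?s = "\<lambda>w. word_sign hpar (map embed_letter w) :: 'a"
  let ?q = "mon w - scale (?s w / ?s u) (mon u) :: _ \<Rightarrow>\<^sub>0 'a"
  have s: "?s u \<noteq> 0" using norm by (simp add: word_sign_embed_letter u)
  have "set u \<subseteq> ggen_set m n" using w u by (metis set_mset_mset)
  then have "?q \<in> carrier (gtens m n)"
    using w by (intro free_alg_closed free_alg_scale free_alg_mon)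
  moreover have "nf hpar (embed ?q) = 0"
    using s by (simp add: linmap_diff[OF linmap_embed] linmap_diff[OF linmap_nf] nf_embed_single u)
  ultimately show "?q \<in> G_ideal m n" by (rule in_G_ideal_nf)
qed

text \<open>
  The quadratic relation expresses \<open>\<eta>\<^sub>1\<^sup>2\<close> through the other letters, so monomials that are at
  most linear in \<open>\<eta>\<^sub>1\<close> suffice to represent all classes of degree \<open>k\<close>.
\<close>

definition basis_monomials :: "nat \<Rightarrow> ggen multiset set" where
  "basis_monomials k =
    {M \<in> monomials (Xi ` {1..2 * m}) (Eta ` {1..n}) k. count M (Eta 1) \<le> 1}"

lemma monomials_normal:
  "M \<in> monomials (Xi ` {1..2 * m}) (Eta ` {1..n}) k \<longleftrightarrow>
    set_mset M \<subseteq> ggen_set m n \<and> normal gpar M \<and> size M = k"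
proof -
  have "(\<forall>e\<in>Xi ` {1..2 * m}. count M e \<le> 1) \<longleftrightarrow> normal gpar M" if M: "set_mset M \<subseteq> ggen_set m n"
  proof
    assume h: "\<forall>e\<in>Xi ` {1..2 * m}. count M e \<le> 1"
    have "count M a \<le> 1" if "gpar a = 0" for a
    proof (cases "a \<in># M")
      case True
      then have "a \<in> Xi ` {1..2 * m}" using M that by (auto simp: ggen_set_def gpar_def)
      then show ?thesis using h by blast
    qed (simp add: not_in_iff)
    then show "normal gpar M" by (simp add: normal_def)
  qed (auto simp: normal_def gpar_def)
  then show ?thesis by (auto simp: monomials_def ggen_set_def)
qed

lemma finite_basis_monomials: "finite (basis_monomials k)"
  by (simp add: basis_monomials_def finite_monomials)

lemma card_basis_monomials:
  "int (card (basis_monomials k)) = frakd (int k) (2 * m) n - frakd (int k - 2) (2 * m) n"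
proof -
  have "card (Xi ` {1..2 * m}) = 2 * m" "card (Eta ` {1..n}) = n"
    by (simp_all add: card_image inj_on_def)
  then show ?thesis
    using card_monomials_low[of "Xi ` {1..2 * m}" "Eta ` {1..n}" "Eta 1" k] n
    by (auto simp: basis_monomials_def)
qed

text \<open>
  Stated for an arbitrary subspace \<open>P\<close> that contains the ideal and the basis words.  A word in which
  \<open>\<eta>\<^sub>1\<close> occurs at least twice is rearranged to start with \<open>\<eta>\<^sub>1\<^sup>2\<close>, which is then replaced by
  means of the quadratic relation; this lowers the number of occurrences of \<open>\<eta>\<^sub>1\<close>.
\<close>

lemma basis_words_span:
  fixes P :: "(ggen list \<Rightarrow>\<^sub>0 'a) set"
  assumes add: "\<And>p q. p \<in> P \<Longrightarrow> q \<in> P \<Longrightarrow> p + q \<in> P"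
    and sc: "\<And>c p. p \<in> P \<Longrightarrow> scale c p \<in> P"
    and I: "G_ideal m n \<subseteq> P"
    and basis: "\<And>M. M \<in> basis_monomials k \<Longrightarrow> mon (word_of M) \<in> P"
    and q: "q \<in> words_of_length m n k"
  shows "q \<in> P"
proof -
  note K = ideal_G_ideal[of m n, where 'a='a]
  have z: "0 \<in> P" using I ideal_zero[OF K] by blast
  have sum: "(\<And>x. x \<in> S \<Longrightarrow> f x \<in> P) \<Longrightarrow> sum f S \<in> P" for S :: "'i set" and f
    by (induction S rule: infinite_finite_induct) (auto simp: z add)
  have I_add: "p \<in> P" if "p - r \<in> G_ideal m n" "r \<in> P" for p r
    using add[of "p - r" r] that I by auto
  define y where "y = Eta 1"
  have word: "mon w \<in> P" if "set w \<subseteq> ggen_set m n" "length w = k" for w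
    using that
  proof (induction "count (mset w) y" arbitrary: w rule: less_induct)
    case less
    show ?case
    proof (cases "normal gpar (mset w)")
      case False
      then have "word_sign hpar (map embed_letter w) = (0::'a)"
        using word_sign_embed_letter[of w, where 'b = 'a] by blast
      then have "nf hpar (embed (mon w)) = (0 :: _ \<Rightarrow>\<^sub>0 'a)" by (simp add: nf_embed_single)
      then show ?thesis using in_G_ideal_nf[OF free_alg_mon[OF less.prems(1)]] I by blast
    next
      case norm: True
      show ?thesis
      proof (cases "count (mset w) y \<le> 1")
        case True
        then have M: "mset w \<in> basis_monomials k"
          using less.prems norm by (simp add: basis_monomials_def monomials_normal y_def del: One_nat_def)
        obtain c where "mon w - scale c (mon (word_of (mset w))) \<in> (G_ideal m n :: (_ \<Rightarrow>\<^sub>0 'a) set)"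
          by (rule same_monomial[OF less.prems(1) mset_word_of norm])
        then show ?thesis by (rule I_add) (rule sc[OF basis[OF M]])
      next
        case False
        define N where "N = mset w - {#y, y#}"
        have N: "mset w = add_mset y (add_mset y N)"
          using False by (intro multiset_eqI) (auto simp: N_def)
        obtain u where u: "mset u = N" using ex_mset by blast
        have set_u: "set u \<subseteq> ggen_set m n" and len: "k = Suc (Suc (length u))"
          and cnt: "count (mset w) y = Suc (Suc (count (mset u) y))"
          using less.prems N u by (auto simp flip: set_mset_mset size_mset)
        obtain c where c: "mon w - scale c (mon (y # y # u)) \<in> (G_ideal m n :: (_ \<Rightarrow>\<^sub>0 'a) set)"
          by (rule same_monomial[OF less.prems(1), of "y # y # u"]) (use N u norm in simp_all)
        let ?X = "\<Sum>i = 1..m. mon (Xi i # Xi (m + i) # u) :: _ \<Rightarrow>\<^sub>0 'a"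
        let ?Y = "\<Sum>j \<in> {1..n} - {1}. mon (Eta j # Eta j # u) :: _ \<Rightarrow>\<^sub>0 'a"
        have X: "?X \<in> P"
          by (intro sum less.hyps) (use cnt set_u len in \<open>auto simp: y_def ggen_set_def\<close>)
        have Y: "?Y \<in> P"
          by (intro sum less.hyps) (use cnt set_u len in \<open>auto simp: y_def ggen_set_def\<close>)
        have "omega_G m n * mon u \<in> (G_ideal m n :: (_ \<Rightarrow>\<^sub>0 'a) set)"
          by (rule ideal_r[OF K omega_G_ideal free_alg_mon[OF set_u]])
        then have o: "scale (- 2) (omega_G m n * mon u) \<in> P" using sc I by blast
        have "omega_G m n * mon u = ?X - scale (1 / 2) (\<Sum>j = 1..n. mon (Eta j # Eta j # u))"
          by (simp add: omega_G_def left_diff_distrib sum_distrib_right scale_mult_left mon_Cons mult.assoc)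
        also have "(\<Sum>j = 1..n. mon (Eta j # Eta j # u)) = mon (y # y # u) + ?Y"
          unfolding y_def by (rule sum.remove) (use n in auto)
        finally have yy: "mon (y # y # u) = scale (- 2) (omega_G m n * mon u) + (scale 2 ?X + scale (- 1) ?Y)"
          by (simp add: scale_distrib single_uminus)
        have "mon (y # y # u) \<in> P"
          unfolding yy by (rule add[OF o add[OF sc[OF X] sc[OF Y]]])
        then show ?thesis by (rule I_add[OF c sc])
      qed
    qed
  qed
  have "q = (\<Sum>w\<in>Poly_Mapping.keys q. scale (Poly_Mapping.lookup q w) (mon w))" by (rule sum_monomials)
  also have "\<dots> \<in> P"
    using q by (intro sum sc word) (auto simp: words_of_length_def in_free_alg)
  finally show ?thesis .
qed

text \<open>
  The basis words span by the preceding lemma.  They are independent: if a combination of them is a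
  coboundary \<open>omega u\<close>, then \<open>omega u\<close> has no term divisible by \<open>y\<^sub>1\<^sup>2\<close>, so \<open>u = 0\<close> by
  \<open>omega_regular\<close> and the combination is trivial.
\<close>

theorem degree_part_dim:
  "vectorspace.fin_dim class_ring (degree_part cohom (int k))"
  "int (vectorspace.dim class_ring (degree_part cohom (int k))) =
    frakd (int k) (2 * m) n - frakd (int k - 2) (2 * m) n"
proof -
  let ?V = "degree_part cohom (int k)"
  from finite_distinct_list[OF finite_basis_monomials[of k]]
  obtain Ms where "set Ms = basis_monomials k \<and> distinct Ms" ..
  then have Ms: "set Ms = basis_monomials k" "distinct Ms" by simp_all
  define N where "N = length Ms"
  define b where "b i = (mon (word_of (Ms ! i)) :: ggen list \<Rightarrow>\<^sub>0 'a)" for i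
  define p where "p v = (\<Sum>i<N. scale (v $ i) (b i))" for v :: "'a vec"
  have M: "Ms ! i \<in> basis_monomials k" if "i < N" for i
    using that unfolding N_def Ms(1)[symmetric] by (rule nth_mem)
  have b: "b i \<in> words_of_length m n k" if "i < N" for i
  proof -
    have "set_mset (Ms ! i) \<subseteq> ggen_set m n" "size (Ms ! i) = k"
      using M[OF that] by (auto simp: basis_monomials_def monomials_normal simp del: One_nat_def)
    moreover have "set (word_of (Ms ! i)) = set_mset (Ms ! i)" "length (word_of (Ms ! i)) = size (Ms ! i)"
      using mset_word_of[of "Ms ! i"] by (metis set_mset_mset, metis size_mset)
    ultimately show ?thesis by (simp add: words_of_length_def in_free_alg b_def)
  qed
  have p: "p v \<in> words_of_length m n k" for v
  proof -
    have "(\<Sum>i<j. scale (v $ i) (b i)) \<in> words_of_length m n k" if "j \<le> N" for j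
      using that
    proof (induction j)
      case (Suc j)
      then show ?case by (simp add: words_of_length_closed(1,2) b)
    qed (simp add: words_of_length_closed(3))
    then show ?thesis by (simp add: p_def)
  qed
  have pF: "p v \<in> carrier (gtens m n)" for v
    using p by (simp add: words_of_length_def)
  have p_add: "p (u + v) = p u + p v" if "u \<in> carrier_vec N" "v \<in> carrier_vec N" for u v
    using that by (simp add: p_def scale_distrib sum.distrib)
  have p_smult: "p (c \<cdot>\<^sub>v v) = scale c (p v)" if "v \<in> carrier_vec N" for c v
    using that by (simp add: p_def scale_sum)
  have p_zero: "p (0\<^sub>v N) = 0" by (simp add: p_def)
  have p_unit: "p (unit_vec N i) = b i" if "i < N" for i
  proof -
    have "p (unit_vec N i) = (\<Sum>j<N. if j = i then b i else 0)"
      unfolding p_def using that by (intro sum.cong) auto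
    then show ?thesis using that by simp
  qed
  have ker: "v = 0\<^sub>v N" if v: "v \<in> carrier_vec N" and "cclass (p v) = \<zero>\<^bsub>cohom\<^esub>" for v
  proof -
    let ?y = "By 1"
    from iffD1[OF coho_cls_zero_iff[OF n pF] that(2)]
    obtain q' where q': "q' \<in> carrier (gtens m n)" "embed (p v - omega_G m n * q') \<in> tens_ideal m n" ..
    have "nf hpar (embed (p v - omega_G m n * q')) = 0" using q'(2) by (simp add: ext_ideal_iff)
    then have e: "nf hpar (embed (p v)) = act hpar (omega m n) (nf hpar (embed q'))"
      by (simp add: linmap_diff[OF linmap_embed] linmap_diff[OF linmap_nf] embed_mult nf_mult embed_omega)
    define s where "s i = (word_sign hpar (map embed_letter (word_of (Ms ! i))) :: 'a)" for i
    have nf_p: "nf hpar (embed (p v)) =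
        (\<Sum>i<N. Poly_Mapping.single (image_mset embed_letter (Ms ! i)) (v $ i * s i))"
      by (simp add: p_def b_def linmap_sum[OF linmap_embed] linmap_sum[OF linmap_nf]
          nf_embed_single mset_word_of s_def)
    have "image_mset embed_letter (Ms ! i) \<noteq> add_mset ?y (add_mset ?y L)" if i: "i < N" for i L
    proof
      assume "image_mset embed_letter (Ms ! i) = add_mset ?y (add_mset ?y L)"
      then have "count (image_mset embed_letter (Ms ! i)) (embed_letter (Eta 1)) \<ge> 2" by simp
      then show False using M[OF i]
        unfolding count_image_embed_letter basis_monomials_def by simp
    qed
    then have "Poly_Mapping.lookup (nf hpar (embed (p v))) (add_mset ?y (add_mset ?y L)) = 0" for L
      by (simp add: nf_p lookup_sum lookup_single when_def)
    then have "nf hpar (embed q') = 0"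
      unfolding e by (rule omega_regular[OF n])
    then have z: "nf hpar (embed (p v)) = 0" by (simp add: e linmap_zero[OF linmap_act])
    have "v $ i = 0" if i: "i < N" for i
    proof -
      have inj: "image_mset embed_letter (Ms ! j) = image_mset embed_letter (Ms ! i) \<longleftrightarrow> j = i" if "j < N" for j
        unfolding image_embed_letter_inj using Ms(2) that i by (simp add: N_def nth_eq_iff_index_eq)
      have "Poly_Mapping.lookup (nf hpar (embed (p v))) (image_mset embed_letter (Ms ! i)) =
          (\<Sum>j<N. if j = i then v $ i * s i else 0)"
        unfolding nf_p lookup_sum by (intro sum.cong) (auto simp: lookup_single when_def inj)
      then have "v $ i * s i = 0" using i by (simp add: z)
      moreover have "s i \<noteq> 0"
        using M[OF i] by (simp add: s_def word_sign_embed_letter mset_word_of basis_monomials_def monomials_normal del: One_nat_def)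
      ultimately show ?thesis by simp
    qed
    then show ?thesis using v by (intro eq_vecI) auto
  qed
  have im: "(\<lambda>v. cclass (p v)) ` carrier_vec N = carrier ?V"
    unfolding degree_part_carrier
  proof
    show "(\<lambda>v. cclass (p v)) ` carrier_vec N \<subseteq> cclass ` words_of_length m n k" using p by blast
    show "cclass ` words_of_length m n k \<subseteq> (\<lambda>v. cclass (p v)) ` carrier_vec N"
    proof
      fix X assume "X \<in> cclass ` words_of_length m n k"
      then obtain q where q: "q \<in> words_of_length m n k" "X = cclass q" by blast
      let ?P = "{q \<in> carrier (gtens m n). cclass q \<in> (\<lambda>v. cclass (p v)) ` carrier_vec N}"
      have "q \<in> ?P"
      proof (rule basis_words_span[OF _ _ _ _ q(1)])
        fix r s assume "r \<in> ?P" "s \<in> ?P"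
        then obtain u v where rs: "r \<in> carrier (gtens m n)" "s \<in> carrier (gtens m n)"
          and uv: "u \<in> carrier_vec N" "v \<in> carrier_vec N" and eq: "cclass r = cclass (p u)" "cclass s = cclass (p v)" by blast
        have "cclass (r + s) = cclass (p (u + v))"
          using rs uv eq by (simp only: cclass_add p_add pF)
        then show "r + s \<in> ?P" using rs uv by (auto intro!: free_alg_closed)
      next
        fix c r assume "r \<in> ?P"
        then obtain u where r: "r \<in> carrier (gtens m n)" "u \<in> carrier_vec N" "cclass r = cclass (p u)" by blast
        have "cclass (scale c r) = cclass (p (c \<cdot>\<^sub>v u))"
          unfolding p_smult[OF r(2)] coho_cls_smult[OF n r(1), symmetric] coho_cls_smult[OF n pF, symmetric] r(3) ..
        then show "scale c r \<in> ?P" using r by (auto intro!: free_alg_scale)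
      next
        show "G_ideal m n \<subseteq> ?P"
        proof
          fix r assume r: "r \<in> (G_ideal m n :: (_ \<Rightarrow>\<^sub>0 'a) set)"
          have rF: "r \<in> carrier (gtens m n)" by (rule ideal_sub[OF ideal_G_ideal r])
          have "cclass r = cclass (p (0\<^sub>v N))"
            unfolding p_zero coho_cls_eq[OF n rF free_alg_zero_one(1)] using r by simp
          then show "r \<in> ?P" using rF by auto
        qed
      next
        fix M assume "M \<in> basis_monomials k"
        then obtain i where i: "i < N" "M = Ms ! i" using Ms by (metis N_def in_set_conv_nth)
        have "cclass (mon (word_of M)) = cclass (p (unit_vec N i))" by (simp only: p_unit[OF i(1)] b_def i(2))
        moreover have "mon (word_of M) \<in> carrier (gtens m n :: ('a, _) gsalg)"
          using b[OF i(1)] by (simp add: b_def i(2) words_of_length_def)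
        ultimately show "mon (word_of M) \<in> ?P" by auto
      qed
      then show "X \<in> (\<lambda>v. cclass (p v)) ` carrier_vec N" using q(2) by blast
    qed
  qed
  have add: "cclass (p (u + v)) = cclass (p u) \<oplus>\<^bsub>?V\<^esub> cclass (p v)" if "u \<in> carrier_vec N" "v \<in> carrier_vec N" for u v
    unfolding p_add[OF that] degree_part_sel by (rule cclass_add[OF pF pF])
  have smult: "cclass (p (c \<cdot>\<^sub>v v)) = c \<odot>\<^bsub>?V\<^esub> cclass (p v)" if "v \<in> carrier_vec N" for c v
    unfolding p_smult[OF that] degree_part_sel by (rule coho_cls_smult[OF n pF, symmetric])
  have ker': "v = 0\<^sub>v N" if "v \<in> carrier_vec N" "cclass (p v) = \<zero>\<^bsub>?V\<^esub>" for v
    using ker that unfolding degree_part_sel by blast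
  note dim = dim_by_coordinates[where T = "\<lambda>v. cclass (p v)", OF degree_part_vectorspace add smult ker' im]
  show "vectorspace.fin_dim class_ring ?V" by (rule dim(1))
  have "N = card (basis_monomials k)" using Ms by (simp add: N_def distinct_card[symmetric])
  moreover have "vectorspace.dim class_ring ?V = N" by (rule dim(2))
  ultimately show "int (vectorspace.dim class_ring ?V) = frakd (int k) (2 * m) n - frakd (int k - 2) (2 * m) n"
    using card_basis_monomials[of k] by (simp only:)
qed

end

theorem theorem3p1:
  fixes m n :: nat
  assumes "n \<ge> 1"
  shows "let H = (cohomology (heis m n) ::
                    ('a::{alg_closed_field, field_char_0}, (hbasis list \<Rightarrow>\<^sub>0 'a) set set) gsalg)
         in gsalg_iso H (G_alg m n) \<and>
            (\<forall>k::nat.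
               vectorspace class_ring (degree_part H (int k)) \<and>
               vectorspace.fin_dim class_ring (degree_part H (int k)) \<and>
               int (vectorspace.dim class_ring (degree_part H (int k))) =
                 frakd (int k) (2 * m) n - frakd (int k - 2) (2 * m) n)"
  unfolding Let_def
  using cohomology_iso[OF assms] degree_part_vectorspace[OF assms] degree_part_dim[OF assms] by blast

end
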